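(* Let $X>0$ be a random variable with moments of Gamma type, with associated meromorphic function $F$, let $Y=\log X$, and let $\gamma$, $\gamma'$, $\varkappa$, $\nu_F$, $c_\ell(\cdot)$ be as in the context. Suppose that $\gamma>0$. (i) If $\gamma'>0$, then, for all $x>0$, $$f_X(x)=\sum_{\rho<0}\ \sum_{\ell=0}^{\nu_F(\rho)-1}\frac{c_{\ell+1}(\rho)}{\ell!}\,x^{|\rho|-1}\log^\ell(1/x),\qquad(1)$$ summing over all poles $\rho<0$ of $F$. In particular, if $F$ has only simple poles, $$f_X(x)=\sum_{\rho<0}\operatorname{Res}_\rho(F)\,x^{|\rho|-1}.\qquad(2)$$ (ii) If $\gamma'<0$ and there is an infinite number of poles $\rho<0$ of $F$, all simple, then the sum in (2) diverges for all $x>0$. (iii) If $\gamma'=0$, then (1) holds for $0<x<e^{\varkappa}$; hence (2) holds for $0<x<e^{\varkappa}$ provided all poles are simple. However, at least provided that there is an infinite number of poles $\rho<0$ of $F$ and all such poles are simple, the sum in (2) diverges for $x>e^{\varkappa}$. Corresponding results for $f_Y(y)$ are obtained by replacing $x^{|\rho|-1}$ by $e^{|\rho|y}$ and $\log^\ell(1/x)$ by $(-y)^\ell$; the cut-offs in (iii) become $y<\varkappa$ and $y>\varkappa$.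
   Context: A positive random variable $X$ has moments of Gamma type if there exist integers $J,K\ge0$ and real constants $C$, $D>0$, $a_j\ne0$, $b_j$ ($1\le j\le J$), $a'_k\neq0$, $b'_k$ ($1\le k\le K$) such that $$\mathbb E\,X^s=F(s):=C D^s\,\frac{\prod_{j=1}^J\Gamma(a_js+b_j)}{\prod_{k=1}^K\Gamma(a'_ks+b'_k)}$$ for all real $s$ in some interval of positive length. $F$ is regarded as a meromorphic function on $\mathbb C$ (removable singularities removed); all its poles are real. Define $\gamma=\sum_{j}|a_j|-\sum_{k}|a'_k|$, $\gamma'=\sum_j a_j-\sum_k a'_k$, $\varkappa=\sum_j a_j\log|a_j|-\sum_k a'_k\log|a'_k|+\log D$. For a pole $s_0$ of $F$, $\nu_F(s_0)\ge1$ denotes its order, and $c_\ell(s_0)$ are the coefficients of the singular part of the Laurent expansion: $F(s)=\sum_{\ell=1}^{\nu_F(s_0)}c_\ell(s_0)(s-s_0)^{-\ell}+O(1)$ as $s\to s_0$; in particular $c_1(s_0)=\operatorname{Res}_{s_0}(F)$. When $\gamma>0$, $X$ and $Y$ are absolutely continuous with densities continuous on $(0,\infty)$ and $\mathbb R$, respectively; $f_X$ and $f_Y$ denote these.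
   Formalization: The sums over poles are limits of sums over poles in (-R,0) as R→∞ with -R at a fixed distance from all poles, so nearby poles are grouped; term-by-term convergence can fail for F(s)=Γ(s+1)Γ(αs+1), α Liouville. Divergence is meant in the same sense. *)

theory Defs
  imports "HOL-Probability.Probability" "HOL-Complex_Analysis.Complex_Analysis"
begin

(* remove_sings implements the convention that F is a meromorphic function with its removable
   singularities removed. It also makes the library conventions Gamma (-n) = 0 and z / 0 = 0
   irrelevant, since they affect the bare quotient only on a discrete set. *)
definition gamma_type_fun ::
  "nat \<Rightarrow> nat \<Rightarrow> real \<Rightarrow> real \<Rightarrow> (nat \<Rightarrow> real) \<Rightarrow> (nat \<Rightarrow> real) \<Rightarrow> (nat \<Rightarrow> real) \<Rightarrow> (nat \<Rightarrow> real)
    \<Rightarrow> complex \<Rightarrow> complex" where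
  "gamma_type_fun J K C D a b a' b' = remove_sings (\<lambda>s.
     of_real C * of_real D powr s *
     (\<Prod>j=1..J. Gamma (of_real (a j) * s + of_real (b j))) /
     (\<Prod>k=1..K. Gamma (of_real (a' k) * s + of_real (b' k))))"

definition gamma_type_moments ::
  "'w measure \<Rightarrow> ('w \<Rightarrow> real) \<Rightarrow> nat \<Rightarrow> nat \<Rightarrow> real \<Rightarrow> real \<Rightarrow> (nat \<Rightarrow> real) \<Rightarrow> (nat \<Rightarrow> real)
    \<Rightarrow> (nat \<Rightarrow> real) \<Rightarrow> (nat \<Rightarrow> real) \<Rightarrow> bool" where
  "gamma_type_moments M X J K C D a b a' b' \<longleftrightarrow>
     X \<in> borel_measurable M \<and> (AE \<omega> in M. X \<omega> > 0) \<and>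
     D > 0 \<and> (\<forall>j\<in>{1..J}. a j \<noteq> 0) \<and> (\<forall>k\<in>{1..K}. a' k \<noteq> 0) \<and>
     (\<exists>u v :: real. u < v \<and> (\<forall>s. u < s \<and> s < v \<longrightarrow>
        integrable M (\<lambda>\<omega>. X \<omega> powr s) \<and>
        of_real (\<integral>\<omega>. X \<omega> powr s \<partial>M) = gamma_type_fun J K C D a b a' b' (of_real s)))"

definition gamma_coeff :: "nat \<Rightarrow> nat \<Rightarrow> (nat \<Rightarrow> real) \<Rightarrow> (nat \<Rightarrow> real) \<Rightarrow> real" where
  "gamma_coeff J K a a' = (\<Sum>j=1..J. \<bar>a j\<bar>) - (\<Sum>k=1..K. \<bar>a' k\<bar>)"

definition gamma'_coeff :: "nat \<Rightarrow> nat \<Rightarrow> (nat \<Rightarrow> real) \<Rightarrow> (nat \<Rightarrow> real) \<Rightarrow> real" where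
  "gamma'_coeff J K a a' = (\<Sum>j=1..J. a j) - (\<Sum>k=1..K. a' k)"

definition kappa_coeff ::
  "nat \<Rightarrow> nat \<Rightarrow> real \<Rightarrow> (nat \<Rightarrow> real) \<Rightarrow> (nat \<Rightarrow> real) \<Rightarrow> real" where
  "kappa_coeff J K D a a' =
     (\<Sum>j=1..J. a j * ln \<bar>a j\<bar>) - (\<Sum>k=1..K. a' k * ln \<bar>a' k\<bar>) + ln D"

definition pole_order :: "(complex \<Rightarrow> complex) \<Rightarrow> complex \<Rightarrow> nat" where
  "pole_order F s0 = nat (- zorder F s0)"

(* sing_coeff F l s0 is the coefficient of (s - s0)^(-l) in the Laurent expansion at s0. *)
definition sing_coeff :: "(complex \<Rightarrow> complex) \<Rightarrow> nat \<Rightarrow> complex \<Rightarrow> complex" where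
  "sing_coeff F l s0 = fls_nth (laurent_expansion F s0) (- int l)"

definition neg_poles :: "(complex \<Rightarrow> complex) \<Rightarrow> real set" where
  "neg_poles F = {\<rho>. \<rho> < 0 \<and> is_pole F (of_real \<rho>)}"

definition continuous_density_on ::
  "'w measure \<Rightarrow> ('w \<Rightarrow> real) \<Rightarrow> real set \<Rightarrow> (real \<Rightarrow> real) \<Rightarrow> bool" where
  "continuous_density_on M Z S f \<longleftrightarrow>
     distributed M lborel Z (\<lambda>x. ennreal (f x)) \<and> continuous_on S f \<and> (\<forall>x\<in>S. 0 \<le> f x)"

(* The value of an infinite sum over negative poles: the sum over the poles in (-R, 0), as R tends
   to infinity while -R stays at some fixed positive distance delta from all poles.
   If distinct poles have a minimal distance, this is exactly the convergent sum taken in the order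
   of increasing |rho| (outward_sum_iff_sums below).
   In general it differs from that sum in one respect: poles that are arbitrarily close to each
   other are added as a group. This is unavoidable. For F(s) = Gamma(s + 1) Gamma(alpha s + 1) with
   alpha a suitable Liouville number, all poles are simple, but the residues at a pole -n and at the
   nearby pole -m/alpha can be arbitrarily large and of opposite sign, so that the individual terms
   of the residue series of the density are unbounded, although it converges when grouped.
   A series that converges in increasing order of |rho|, or unconditionally, has the same value in
   this sense (outward_sum_of_ordered, outward_sum_of_has_sum). So divergence in this sense implies
   divergence in the two others. *)
definition has_outward_sum :: "real set \<Rightarrow> (real \<Rightarrow> complex) \<Rightarrow> complex \<Rightarrow> bool" where
  "has_outward_sum P t L \<longleftrightarrow>
     (\<forall>\<delta> R. \<delta> > 0 \<and> filterlim R at_top sequentially \<and> (\<forall>n. \<forall>\<rho>\<in>P. \<delta> \<le> \<bar>\<rho> - (- R n)\<bar>)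
        \<longrightarrow> (\<lambda>n::nat. \<Sum>\<rho>\<in>{\<rho>\<in>P. - R n < \<rho>}. t \<rho>) \<longlonglongrightarrow> L)"

definition outward_divergent :: "real set \<Rightarrow> (real \<Rightarrow> complex) \<Rightarrow> bool" where
  "outward_divergent P t \<longleftrightarrow> \<not> (\<exists>L. has_outward_sum P t L)"

lemma outward_sum_of_ordered:
  assumes "((\<lambda>R. \<Sum>\<rho>\<in>{\<rho>\<in>P. - R < \<rho>}. t \<rho>) \<longlongrightarrow> L) at_top"
  shows "has_outward_sum P t L"
  unfolding has_outward_sum_def using filterlim_compose[OF assms] by blast

lemma outward_sum_of_has_sum:
  assumes "(t has_sum L) P" and fin: "\<And>R. finite {\<rho>\<in>P. - R < \<rho>}"
  shows "has_outward_sum P t L"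
proof (rule outward_sum_of_ordered)
  have lim: "(sum t \<longlongrightarrow> L) (finite_subsets_at_top P)"
    using assms(1) by (simp add: has_sum_def)
  have "filterlim (\<lambda>R. {\<rho>\<in>P. - R < \<rho>}) (finite_subsets_at_top P) at_top"
    unfolding filterlim_finite_subsets_at_top
  proof (intro allI impI)
    fix A assume A: "finite A \<and> A \<subseteq> P"
    have "eventually (\<lambda>R. \<forall>\<rho>\<in>A. - R < \<rho>) at_top"
    proof (rule eventually_ball_finite)
      show "\<forall>\<rho>\<in>A. eventually (\<lambda>R. - R < \<rho>) at_top"
      proof
        fix \<rho> :: real show "eventually (\<lambda>R. - R < \<rho>) at_top"
          using eventually_gt_at_top[of "-\<rho>"] by eventually_elim auto
      qed
    qed (use A in auto)
    then show "eventually (\<lambda>R. finite {\<rho>\<in>P. - R < \<rho>} \<and> A \<subseteq> {\<rho>\<in>P. - R < \<rho>}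
        \<and> {\<rho>\<in>P. - R < \<rho>} \<subseteq> P) at_top"
      by eventually_elim (use A fin in auto)
  qed
  from filterlim_compose[OF lim this]
  show "((\<lambda>R. \<Sum>\<rho>\<in>{\<rho>\<in>P. - R < \<rho>}. t \<rho>) \<longlongrightarrow> L) at_top" .
qed

lemma outward_sum_iff_sums:
  fixes p :: "nat \<Rightarrow> real"
  assumes "\<delta> > 0" and gap: "\<And>n. p (Suc n) \<le> p n - \<delta>"
  shows "has_outward_sum (range p) t L \<longleftrightarrow> (\<lambda>n. t (p n)) sums L"
proof -
  have gaps: "p (m + k) \<le> p m - of_nat k * \<delta>" for m k
  proof (induction k)
    case (Suc k)
    then show ?case using gap[of "m + k"] by (simp add: algebra_simps)
  qed simp
  have dec: "p n \<le> p m - \<delta>" if "m < n" for m n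
  proof -
    obtain k where k: "n = m + Suc k" using less_imp_Suc_add[OF \<open>m < n\<close>] by auto
    have "1 * \<delta> \<le> of_nat (Suc k) * \<delta>" using \<open>\<delta> > 0\<close> by (intro mult_right_mono) auto
    then show ?thesis using gaps[of m "Suc k"] k by simp
  qed
  have inj: "inj p"
    using dec \<open>\<delta> > 0\<close> by (intro linorder_injI) fastforce
  have tend: "filterlim (\<lambda>n. - p n) at_top sequentially"
  proof (rule filterlim_at_top_mono)
    show "filterlim (\<lambda>n. - p 0 + of_nat n * \<delta>) at_top sequentially"
      using \<open>\<delta> > 0\<close>
      by (intro filterlim_tendsto_add_at_top[OF tendsto_const]
          filterlim_at_top_mult_tendsto_pos[OF tendsto_const _ filterlim_real_sequentially]) auto
    show "eventually (\<lambda>n. - p 0 + of_nat n * \<delta> \<le> - p n) sequentially"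
      using gaps[of 0] by (intro always_eventually allI) (simp add: algebra_simps)
  qed
  show ?thesis
  proof
    assume H: "has_outward_sum (range p) t L"
    define R where "R n = - p n - \<delta> / 2" for n
    have Rtend: "filterlim R at_top sequentially"
      using filterlim_tendsto_add_at_top[OF tendsto_const tend, of "- \<delta> / 2"]
      by (simp add: R_def[abs_def] algebra_simps)
    have sep: "\<delta> / 2 \<le> \<bar>p i - (- R n)\<bar>" for i n
      using dec[of i n] dec[of n i] \<open>\<delta> > 0\<close>
      by (cases i n rule: linorder_cases) (auto simp: R_def)
    have win: "{\<rho> \<in> range p. - R n < \<rho>} = p ` {..<n}" for n
    proof -
      have "- R n < p i \<longleftrightarrow> i < n" for i
        using dec[of i n] dec[of n i] \<open>\<delta> > 0\<close>
        by (cases i n rule: linorder_cases) (auto simp: R_def)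
      then show ?thesis by auto
    qed
    have "(\<lambda>n. \<Sum>\<rho>\<in>{\<rho> \<in> range p. - R n < \<rho>}. t \<rho>) \<longlonglongrightarrow> L"
      using H \<open>\<delta> > 0\<close> Rtend sep unfolding has_outward_sum_def
      by (auto dest!: spec[of _ "\<delta> / 2"] spec[of _ R])
    then show "(\<lambda>n. t (p n)) sums L"
      unfolding sums_def win using inj by (simp add: sum.reindex inj_on_def)
  next
    assume H: "(\<lambda>n. t (p n)) sums L"
    show "has_outward_sum (range p) t L"
    proof (rule outward_sum_of_ordered)
      define N where "N R = (LEAST n. p n \<le> - R)" for R
      have ex: "\<exists>n. p n \<le> - R" for R
      proof -
        have "eventually (\<lambda>n. R \<le> - p n) sequentially"
          using tend by (simp add: filterlim_at_top)
        then obtain n where "R \<le> - p n" by (auto simp: eventually_sequentially)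
        then show ?thesis by (intro exI[of _ n]) linarith
      qed
      have N: "p i \<le> - R \<longleftrightarrow> N R \<le> i" for i R
      proof
        assume "p i \<le> - R" then show "N R \<le> i" unfolding N_def by (rule Least_le)
      next
        assume "N R \<le> i"
        moreover have "p (N R) \<le> - R" unfolding N_def using ex by (rule LeastI_ex)
        ultimately show "p i \<le> - R"
          using dec[of "N R" i] \<open>\<delta> > 0\<close> by (cases "N R = i") auto
      qed
      have win: "{\<rho> \<in> range p. - R < \<rho>} = p ` {..<N R}" for R
        using N[of _ R] by (auto simp: not_le[symmetric])
      have "filterlim N sequentially at_top"
        unfolding filterlim_at_top
      proof
        fix k
        show "eventually (\<lambda>R. k \<le> N R) at_top"
        proof (cases k)
          case (Suc m)
          show ?thesis using eventually_gt_at_top[of "- p m"]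
          proof eventually_elim
            case (elim R)
            then have "\<not> p m \<le> - R" by auto
            then show ?case using N[of m R] Suc by simp
          qed
        qed simp
      qed
      from filterlim_compose[OF H[unfolded sums_def] this]
      show "((\<lambda>R. \<Sum>\<rho>\<in>{\<rho> \<in> range p. - R < \<rho>}. t \<rho>) \<longlongrightarrow> L) at_top"
        unfolding win using inj by (simp add: sum.reindex inj_on_def)
    qed
  qed
qed

end

theory Submission
  imports Defs "HOL-Real_Asymp.Real_Asymp"
begin

text \<open>
  Write \<open>w = -s\<close>. Mellin inversion gives \<open>f\<^sub>Y(y)\<close> as the integral of \<open>F(s) e\<^sup>-\<^sup>y\<^sup>s / 2\<pi>i\<close> over a vertical
  line in the strip where the moments are finite, and \<open>F\<close> has no pole between that line and \<open>0\<close>.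
  Moving the line to \<open>Re s = -R\<close> picks up the residues at the poles in \<open>(-R, 0)\<close>; the residue at \<open>\<rho>\<close>
  is the corresponding term of the sum. Reflecting the factors with \<open>a > 0\<close> and applying Stirling's formula,
  \<open>F(-w) = C exp(-\<gamma>'(w Ln w - w) - \<kappa> w + \<beta> Ln w) Q(w) L(w)\<close>, where \<open>L\<close> tends to a nonzero constant and
  \<open>Q\<close> is a quotient of products of sines. This makes the integral over \<open>Re s = -R\<close> vanish in the limit if \<open>\<gamma>' > 0\<close>,
  or if \<open>\<gamma>' = 0\<close> and \<open>y < \<kappa>\<close>. The given \<open>R\<close> avoid only the genuine poles, not
  the singularities of numerator factors that cancel; so \<open>R\<close> is first moved, within the gap, away from all of them.

  For the divergence, the zeros of the sines nearly repeat: by Dirichlet's theorem there are arbitrarily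
  large \<open>T\<close> for which all \<open>a\<^sub>j T\<close>, \<open>a'\<^sub>k T\<close> are within a negative power of \<open>T\<close> of integers. Hence the poles of \<open>F\<close>
  near \<open>\<rho>\<^sub>0 - T\<close>, for one fixed simple pole \<open>\<rho>\<^sub>0\<close> far to the left, form a cluster whose total residue is
  asymptotically that of \<open>Q\<close> at \<open>-\<rho>\<^sub>0\<close> times the smooth factor at \<open>-\<rho>\<^sub>0 + T\<close>, and the latter tends to infinity.
\<close>

section \<open>Stirling's formula in the right half-plane\<close>

text \<open>The obstacle to divergence is that the \<open>a j\<close> need not be commensurable, so
  single residues cannot be estimated, only totals over clusters of poles. Three scales make this
  work. With N = n + 1, Dirichlet's theorem gives N \<le> T \<le> N^d with errors below 1/N, so a
  cluster has width O(1/N). The circle around it has radius N^(-1/2): this is large compared with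
  1/N, so the sines on it reproduce those around \<rho>0 up to a factor tending to 1; and it is so
  small that the logarithm of the smooth factor, with derivative O(log T) = O(log N), varies by o(1)
  on it. Other poles stay at a fixed distance, so cut-offs on both sides of the cluster are
  admissible in \<open>has_outward_sum\<close>; convergence would force the cluster totals to tend
  to 0. For convergence, the bound on Re s = -R must be integrable along the whole line. There the
  Stirling factor grows like exp (pi \<gamma>' |t| / 2), while the sines contribute exp (- pi
  (\<gamma> + \<gamma>') |t| / 2). Half of the remaining rate pi \<gamma> / 2 is spent on polynomial
  factors, which explains the constant pi \<gamma> / 4.\<close>

abbreviation at_Re_top :: "complex filter" where
  "at_Re_top \<equiv> filtercomap Re at_top"

lemma eventually_at_Re_top: "eventually P at_Re_top \<longleftrightarrow> (\<exists>x0. \<forall>z. Re z \<ge> x0 \<longrightarrow> P z)"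
proof
  assume "eventually P at_Re_top"
  then obtain Q where Q: "eventually Q at_top" "\<And>z. Q (Re z) \<Longrightarrow> P z"
    by (auto simp: eventually_filtercomap)
  then show "\<exists>x0. \<forall>z. Re z \<ge> x0 \<longrightarrow> P z"
    by (auto simp: eventually_at_top_linorder)
next
  assume "\<exists>x0. \<forall>z. Re z \<ge> x0 \<longrightarrow> P z"
  then obtain x0 where x0: "\<And>z. Re z \<ge> x0 \<Longrightarrow> P z" by auto
  show "eventually P at_Re_top"
    unfolding eventually_filtercomap
    by (rule exI[of _ "\<lambda>x. x \<ge> x0"]) (auto simp: x0 eventually_ge_at_top)
qed

text \<open>The difference vanishes at 0 and has derivative v^2 / (1 + v), of modulus at most 2
  |u|^2 on the disc of radius |u|. The quadratic term is kept explicit because it cancels the effect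
  of the shift 1/2 in \<open>stirling_step\<close>.\<close>

lemma norm_Ln_1_plus_quadratic_le:
  fixes u :: complex
  assumes "norm u \<le> 1 / 2"
  shows "norm (Ln (1 + u) - u + u\<^sup>2 / 2) \<le> 2 * norm u ^ 3"
proof -
  have pos: "Re (1 + v) > 0" "norm (1 + v) \<ge> 1/2" if "norm v \<le> norm u" for v
  proof -
    have "norm v \<le> 1/2" using that assms by simp
    then show "Re (1 + v) > 0" using abs_Re_le_cmod[of v] by simp
    have "1 \<le> norm (1 + v) + norm v" by (metis add_diff_cancel_right' norm_one norm_triangle_ineq4)
    then show "norm (1 + v) \<ge> 1/2" using \<open>norm v \<le> 1/2\<close> by simp
  qed
  have "norm ((Ln (1 + u) - u + u\<^sup>2 / 2) - (Ln (1 + 0) - 0 + 0\<^sup>2 / 2)) \<le> 2 * (norm u)\<^sup>2 * norm (u - 0)"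
  proof (rule field_differentiable_bound[where S = "cball 0 (norm u)" and f' = "\<lambda>v. v\<^sup>2 / (1 + v)"])
    fix v assume "v \<in> cball (0::complex) (norm u)"
    then have v: "norm v \<le> norm u" by simp
    have nz: "1 + v \<noteq> 0" and nn: "1 + v \<notin> \<real>\<^sub>\<le>\<^sub>0"
      using pos[OF v] by (auto simp: complex_nonpos_Reals_iff)
    show "((\<lambda>v. Ln (1 + v) - v + v\<^sup>2 / 2) has_field_derivative v\<^sup>2 / (1 + v)) (at v within cball 0 (norm u))"
    proof -
      have e: "v\<^sup>2 / (1 + v) = 1 / (1 + v) - 1 + v" using nz by (simp add: field_simps power2_eq_square)
      show ?thesis unfolding e using nn by (auto intro!: derivative_eq_intros simp: inverse_eq_divide)
    qed
    have "norm (v\<^sup>2 / (1 + v)) \<le> (norm u)\<^sup>2 / (1/2)"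
      unfolding norm_divide norm_power using pos[OF v] v by (intro frac_le power_mono) auto
    then show "norm (v\<^sup>2 / (1 + v)) \<le> 2 * (norm u)\<^sup>2" by simp
  qed auto
  then show ?thesis by (simp add: power3_eq_cube power2_eq_square)
qed

text \<open>The main term of Stirling's formula without the factor sqrt (2 pi). The constant is
  never evaluated: its existence and nonvanishing suffice.\<close>

definition stirling_base :: "complex \<Rightarrow> complex" where
  "stirling_base z = exp ((z - 1/2) * Ln z - z)"

text \<open>Logarithm of the defect of \<open>stirling_base\<close> in the functional equation of
  Gamma, see \<open>stirling_base_plus1\<close>.\<close>

definition stirling_step :: "complex \<Rightarrow> complex" where
  "stirling_step z = (z + 1/2) * Ln (1 + 1 / z) - 1"

lemma stirling_base_nonzero [simp]: "stirling_base z \<noteq> 0"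
  by (simp add: stirling_base_def)

text \<open>With u = 1/z, the shift 1/2 makes the terms of order u cancel. What remains is - u^2 / 4
  and a remainder of the same order, so the defects are summable over z + k.\<close>

lemma norm_stirling_step_le:
  assumes "norm z \<ge> 2"
  shows "norm (stirling_step z) \<le> 3 / (norm z)\<^sup>2"
proof -
  define u where "u = 1 / z"
  have z0: "z \<noteq> 0" using assms by auto
  then have uz: "z * u = 1" "norm u = 1 / norm z" by (auto simp: u_def norm_divide)
  have u: "norm u \<le> 1/2" unfolding uz(2) using assms by (intro frac_le) auto
  define r where "r = Ln (1 + u) - u + u\<^sup>2 / 2"
  have r: "norm r \<le> 2 * norm u ^ 3" unfolding r_def by (rule norm_Ln_1_plus_quadratic_le[OF u])
  have "stirling_step z = (z + 1/2) * (r + u - u\<^sup>2 / 2) - 1"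
    by (simp add: stirling_step_def u_def r_def)
  also have "\<dots> = (z + 1/2) * r - u\<^sup>2 / 4 + (z * u - 1) * (1 - u / 2)"
    by (simp add: field_simps power2_eq_square)
  finally have eq: "stirling_step z = (z + 1/2) * r - u\<^sup>2 / 4" by (simp add: uz(1))
  have "norm (z + 1/2) \<le> norm z + 1/2"
    using norm_triangle_ineq[of z "1/2"] by simp
  then have "norm ((z + 1/2) * r) \<le> (norm z + 1/2) * (2 * norm u ^ 3)"
    unfolding norm_mult using r by (intro mult_mono) auto
  also have "\<dots> = 2 * (norm z * norm u) * (norm u)\<^sup>2 + norm u * (norm u)\<^sup>2"
    by (simp add: field_simps power3_eq_cube power2_eq_square)
  also have "norm z * norm u = 1" using z0 by (simp add: uz)
  also have "norm u * (norm u)\<^sup>2 \<le> 1/2 * (norm u)\<^sup>2" using u by (intro mult_right_mono) auto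
  finally have a: "norm ((z + 1/2) * r) \<le> (5/2) * (norm u)\<^sup>2" by simp
  have "norm (stirling_step z) \<le> norm ((z + 1/2) * r) + norm (u\<^sup>2 / 4)"
    unfolding eq by (rule norm_triangle_ineq4)
  also have "\<dots> \<le> 3 * (norm u)\<^sup>2"
  proof -
    have "norm (u\<^sup>2 / 4) = (norm u)\<^sup>2 / 4" by (simp add: norm_divide norm_power)
    then show ?thesis using a zero_le_power2[of "norm u"] by linarith
  qed
  also have "\<dots> = 3 / (norm z)\<^sup>2" by (simp add: uz power_divide)
  finally show ?thesis .
qed

text \<open>Comparison with the telescoping sum of 3 / (y - 1) - 3 / y for y = Re z + k. The bound
  involves only Re z; this is the source of the uniformity in Im z of the limits along
  \<open>at_Re_top\<close>.\<close>

lemma stirling_step_sum_le: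
  assumes "Re z \<ge> 2"
  shows "(\<Sum>k<n. norm (stirling_step (z + of_nat k))) \<le> 3 / (Re z - 1)"
proof -
  have "norm (stirling_step (z + of_nat k)) \<le> 3 / (Re z + of_nat k - 1) - 3 / (Re z + of_nat (Suc k) - 1)" for k
  proof -
    define y where "y = Re z + of_nat k"
    have y: "y \<ge> 2" using assms by (simp add: y_def)
    have ny: "norm (z + of_nat k) \<ge> y"
      using abs_Re_le_cmod[of "z + of_nat k"] by (simp add: y_def)
    have "norm (stirling_step (z + of_nat k)) \<le> 3 / (norm (z + of_nat k))\<^sup>2"
      using ny y by (intro norm_stirling_step_le) simp
    also have "\<dots> \<le> 3 / (y * (y - 1))"
    proof (intro divide_left_mono)
      have "y * (y - 1) \<le> y\<^sup>2" using y by (simp add: power2_eq_square algebra_simps)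
      also have "\<dots> \<le> (norm (z + of_nat k))\<^sup>2" using ny y by (intro power_mono) auto
      finally show "y * (y - 1) \<le> (norm (z + of_nat k))\<^sup>2" .
    qed (use ny y in \<open>auto intro!: mult_pos_pos\<close>)
    also have "\<dots> = 3 / (y - 1) - 3 / y" using y by (simp add: field_simps)
    finally show ?thesis by (simp add: y_def)
  qed
  then have "(\<Sum>k<n. norm (stirling_step (z + of_nat k)))
     \<le> (\<Sum>k<n. 3 / (Re z + of_nat k - 1) - 3 / (Re z + of_nat (Suc k) - 1))"
    by (intro sum_mono)
  also have "\<dots> = 3 / (Re z - 1) - 3 / (Re z + of_nat n - 1)"
    by (subst sum_lessThan_telescope'[where f = "\<lambda>k. 3 / (Re z + of_nat k - 1)"]) simp
  also have "\<dots> \<le> 3 / (Re z - 1)" using assms by simp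
  finally show ?thesis .
qed

text \<open>Besides algebra this needs Ln (z + 1) = Ln z + Ln (1 + 1/z): both factors lie in the
  right half-plane, so the imaginary parts of their logarithms add up to less than pi in
  modulus.\<close>

lemma stirling_base_plus1:
  assumes "Re z > 0"
  shows "stirling_base (z + 1) = stirling_base z * z * exp (stirling_step z)"
proof -
  have z0: "z \<noteq> 0" using assms by auto
  have "Ln (z + 1) = Ln z + Ln (1 + 1 / z)"
  proof -
    have re: "Re (1 + 1 / z) > 0" using assms by (simp add: Re_divide add_pos_nonneg)
    then have nz: "1 + 1 / z \<noteq> 0" by (metis zero_complex.sel(1) less_irrefl)
    have "Ln (z * (1 + 1/z)) = Ln z + Ln (1 + 1/z)"
    proof (rule Ln_times_simple)
      have "\<bar>Im (Ln z)\<bar> < pi/2" "\<bar>Im (Ln (1 + 1/z))\<bar> < pi/2"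
        using Re_Ln_pos_lt[OF z0] Re_Ln_pos_lt[OF nz] assms re by simp_all
      then show "- pi < Im (Ln z) + Im (Ln (1 + 1 / z))" "Im (Ln z) + Im (Ln (1 + 1 / z)) \<le> pi" by linarith+
    qed (use z0 nz in auto)
    moreover have "z * (1 + 1/z) = z + 1" using z0 by (simp add: field_simps)
    ultimately show ?thesis by simp
  qed
  then have "(z + 1 - 1/2) * Ln (z + 1) - (z + 1) = ((z - 1/2) * Ln z - z) + Ln z + stirling_step z"
    unfolding stirling_step_def by (simp only: ring_distribs) simp
  then have "stirling_base (z + 1) = exp (((z - 1/2) * Ln z - z) + Ln z + stirling_step z)"
    by (simp only: stirling_base_def)
  also have "\<dots> = stirling_base z * z * exp (stirling_step z)"
    using z0 by (simp add: exp_add stirling_base_def)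
  finally show ?thesis .
qed

definition stirling_quot :: "complex \<Rightarrow> complex" where
  "stirling_quot z = Gamma z / stirling_base z"

lemma nonpos_Ints_imp_Re_le: "z \<in> \<int>\<^sub>\<le>\<^sub>0 \<Longrightarrow> Re z \<le> 0" for z :: complex
  by (auto elim!: nonpos_Ints_cases)

lemma stirling_quot_shift:
  assumes "Re z > 0"
  shows "stirling_quot z = stirling_quot (z + of_nat n) * exp (\<Sum>k<n. stirling_step (z + of_nat k))"
proof (induction n)
  case (Suc n)
  define y where "y = z + of_nat n"
  have y: "Re y > 0" using assms by (simp add: y_def)
  then have "y \<notin> \<int>\<^sub>\<le>\<^sub>0" "y \<noteq> 0" using nonpos_Ints_imp_Re_le[of y] by auto
  then have "stirling_quot y = stirling_quot (y + 1) * exp (stirling_step y)"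
    by (simp add: stirling_quot_def stirling_base_plus1[OF y] Gamma_plus1)
  then show ?case using Suc by (simp add: y_def exp_add algebra_simps)
qed simp

text \<open>Euler's limit for Gamma, read as Gamma (z + n) ~ Gamma n * n^z. Together with the same
  relation for \<open>stirling_base\<close>, it shows that \<open>stirling_quot\<close> has the same
  limit along z + n as along n.\<close>

lemma Gamma_plus_of_nat_asymp:
  fixes z :: complex
  assumes "Re z > 0"
  shows "(\<lambda>n. Gamma (z + of_nat n) / (Gamma (of_nat n) * exp (z * of_real (ln (of_nat n))))) \<longlonglongrightarrow> 1"
proof -
  have z: "z \<notin> \<int>\<^sub>\<le>\<^sub>0" using assms nonpos_Ints_imp_Re_le[of z] by auto
  then have G: "Gamma z \<noteq> 0" by (simp add: Gamma_eq_zero_iff)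
  have "(\<lambda>n. Gamma z / Gamma_series' z n) \<longlonglongrightarrow> Gamma z / Gamma z"
    using G by (intro tendsto_divide tendsto_const Gamma_series'_LIMSEQ)
  then have "(\<lambda>n. Gamma z / Gamma_series' z n) \<longlonglongrightarrow> 1" using G by simp
  moreover have "eventually (\<lambda>n. Gamma z / Gamma_series' z n =
     Gamma (z + of_nat n) / (Gamma (of_nat n) * exp (z * of_real (ln (of_nat n))))) sequentially"
    using eventually_gt_at_top[of 0]
  proof eventually_elim
    case (elim n)
    have "Gamma (of_nat n :: complex) = fact (n - 1)"
      using Gamma_fact[of "n - 1", where 'a = complex] elim by (simp add: of_nat_diff)
    moreover have "pochhammer z n = Gamma (z + of_nat n) / Gamma z"
      by (rule pochhammer_Gamma[OF z])
    ultimately show ?case using G by (simp add: Gamma_series'_def field_simps)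
  qed
  ultimately show ?thesis by (rule Lim_transform_eventually)
qed

text \<open>Apart from n^z, the exponents differ by n Ln (1 + z/n) - z and a multiple of Ln (1 +
  z/n), both of which tend to 0.\<close>

lemma stirling_base_plus_of_nat_asymp:
  fixes z :: complex
  shows "(\<lambda>n. stirling_base (z + of_nat n) / (stirling_base (of_nat n) * exp (z * of_real (ln (of_nat n))))) \<longlonglongrightarrow> 1"
proof -
  let ?u = "\<lambda>n. z / of_nat n"
  have u0: "?u \<longlonglongrightarrow> 0" by (rule lim_const_over_n)
  have L0: "(\<lambda>n. Ln (1 + ?u n)) \<longlonglongrightarrow> 0"
    using tendsto_Ln[OF tendsto_add[OF tendsto_const u0, of 1]] by (simp add: complex_nonpos_Reals_iff)
  have nL: "(\<lambda>n. of_nat n * Ln (1 + ?u n)) \<longlonglongrightarrow> z"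
  proof -
    have "((\<lambda>w. Ln (1 + w)) has_field_derivative 1) (at 0)"
      by (auto intro!: derivative_eq_intros simp: complex_nonpos_Reals_iff)
    then have d: "((\<lambda>w. Ln (1 + w) / w) \<longlongrightarrow> 1) (at 0)"
      by (simp add: has_field_derivative_iff)
    show ?thesis
    proof (cases "z = 0")
      case False
      have "filterlim ?u (at 0) sequentially"
        unfolding filterlim_at using u0 False
        by (auto intro!: eventually_mono[OF eventually_gt_at_top[of 0]])
      from filterlim_compose[OF d this]
      have "(\<lambda>n. z * (Ln (1 + ?u n) / ?u n)) \<longlonglongrightarrow> z * 1" by (intro tendsto_mult tendsto_const) 
      then show ?thesis
        unfolding mult_1_right
        by (rule Lim_transform_eventually)
          (auto intro!: eventually_mono[OF eventually_gt_at_top[of 0]] simp: False)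
    qed simp
  qed
  have "(\<lambda>n. exp ((z - 1/2) * Ln (1 + ?u n) + of_nat n * Ln (1 + ?u n) - z)) \<longlonglongrightarrow> exp ((z - 1/2) * 0 + z - z)"
    by (intro tendsto_intros L0 nL)
  moreover have "eventually (\<lambda>n. exp ((z - 1/2) * Ln (1 + ?u n) + of_nat n * Ln (1 + ?u n) - z) =
     stirling_base (z + of_nat n) / (stirling_base (of_nat n) * exp (z * of_real (ln (of_nat n))))) sequentially"
    using eventually_gt_at_top[of "nat \<lceil>norm z\<rceil>"]
  proof eventually_elim
    case (elim n)
    then have n: "real n > norm z" "n > 0" by linarith+
    have "norm (?u n) < 1" using n by (simp add: norm_divide)
    then have nz: "1 + ?u n \<noteq> 0"
      by (metis add_eq_0_iff norm_minus_cancel norm_one less_irrefl)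
    define A where "A = Ln (1 + ?u n)"
    define l where "l = complex_of_real (ln (real n))"
    have ln: "Ln (of_nat n) = l" using n by (simp add: l_def)
    have "z + of_nat n = of_nat n * (1 + ?u n)" using n by (simp add: distrib_left)
    then have "Ln (z + of_nat n) = Ln (of_nat n * (1 + ?u n))" by simp
    also have "\<dots> = l + A"
      using n nz by (simp add: Ln_times_of_nat A_def l_def)
    finally have L: "Ln (z + of_nat n) = l + A" .
    have "(z + of_nat n - 1/2) * (l + A) - (z + of_nat n)
        = ((z - 1/2) * A + of_nat n * A - z) + ((of_nat n - 1/2) * l - of_nat n) + z * l"
      by (simp add: algebra_simps)
    then have "stirling_base (z + of_nat n) = exp ((z - 1/2) * A + of_nat n * A - z)
       * stirling_base (of_nat n) * exp (z * l)"
      unfolding stirling_base_def exp_add[symmetric] L ln by (rule arg_cong)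
    then show ?case by (simp add: A_def l_def)
  qed
  ultimately show ?thesis by (rule Lim_transform_eventually[THEN tendsto_eq_rhs]) simp
qed

text \<open>Shifting z by n and letting n tend to infinity gives \<open>stirling_quot z\<close> = l
  * exp (\<sigma> z), where l does not depend on z and |\<sigma> z| \<le> 3 / (Re z - 1).\<close>

theorem Gamma_stirling_complex:
  obtains l where "l \<noteq> 0" "(stirling_quot \<longlongrightarrow> l) at_Re_top"
proof -
  define \<sigma> where "\<sigma> z = (\<Sum>k. stirling_step (z + of_nat k))" for z
  have summ: "summable (\<lambda>k. norm (stirling_step (z + of_nat k)))" if "Re z \<ge> 2" for z
    by (rule summableI_nonneg_bounded[OF norm_ge_zero stirling_step_sum_le[OF that]])
  have lim\<sigma>: "(\<lambda>n. \<Sum>k<n. stirling_step (z + of_nat k)) \<longlonglongrightarrow> \<sigma> z" if "Re z \<ge> 2" for z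
    unfolding \<sigma>_def using summable_LIMSEQ[OF summable_norm_cancel[OF summ[OF that]]] by simp
  have \<sigma>_le: "norm (\<sigma> z) \<le> 3 / (Re z - 1)" if "Re z \<ge> 2" for z
    by (rule LIMSEQ_le_const2[OF tendsto_norm[OF lim\<sigma>[OF that]]])
      (intro exI allI impI order_trans[OF norm_sum stirling_step_sum_le[OF that]])
  have quot_eq: "stirling_quot (z + of_nat n) = stirling_quot z / exp (\<Sum>k<n. stirling_step (z + of_nat k))"
    if "Re z \<ge> 2" for z n using stirling_quot_shift[of z n] that by simp
  \<comment> \<open>The limit along the integers, computed from the starting point 2 because the
    steps are known to be summable for Re z \<ge> 2.\<close>
  define l where "l = stirling_quot 2 / exp (\<sigma> 2)"
  have "(\<lambda>n. stirling_quot (2 + of_nat n)) \<longlonglongrightarrow> l"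
    unfolding l_def quot_eq[of 2, simplified] by (intro tendsto_divide tendsto_const tendsto_exp lim\<sigma>) auto
  then have lim_nat: "(\<lambda>n. stirling_quot (of_nat n)) \<longlonglongrightarrow> l"
    using LIMSEQ_offset[of "\<lambda>n. stirling_quot (of_nat n)" 2 l] by (simp add: add.commute)
  have "stirling_quot 2 \<noteq> 0" by (auto simp: stirling_quot_def Gamma_eq_zero_iff dest: nonpos_Ints_imp_Re_le)
  then have l0: "l \<noteq> 0" by (simp add: l_def)
  have eq: "stirling_quot z = l * exp (\<sigma> z)" if z: "Re z \<ge> 2" for z
  proof -
    have "(\<lambda>n. stirling_quot (of_nat n) * ((Gamma (z + of_nat n) / (Gamma (of_nat n) * exp (z * of_real (ln (of_nat n)))))
        / (stirling_base (z + of_nat n) / (stirling_base (of_nat n) * exp (z * of_real (ln (of_nat n))))))) \<longlonglongrightarrow> l * (1 / 1)"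
      using z by (intro tendsto_intros lim_nat Gamma_plus_of_nat_asymp stirling_base_plus_of_nat_asymp) auto
    moreover have "eventually (\<lambda>n. stirling_quot (of_nat n) * ((Gamma (z + of_nat n) / (Gamma (of_nat n) * exp (z * of_real (ln (of_nat n)))))
        / (stirling_base (z + of_nat n) / (stirling_base (of_nat n) * exp (z * of_real (ln (of_nat n))))))
        = stirling_quot (z + of_nat n)) sequentially"
      using eventually_gt_at_top[of 0]
    proof eventually_elim
      case (elim n)
      have "Gamma (of_nat n :: complex) \<noteq> 0" using elim by (auto simp: Gamma_eq_zero_iff dest: nonpos_Ints_imp_Re_le)
      then show ?case by (simp add: stirling_quot_def field_simps)
    qed
    ultimately have "(\<lambda>n. stirling_quot (z + of_nat n)) \<longlonglongrightarrow> l" by (rule Lim_transform_eventually[THEN tendsto_eq_rhs]) simp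
    then have "(\<lambda>n. stirling_quot (z + of_nat n) * exp (\<Sum>k<n. stirling_step (z + of_nat k))) \<longlonglongrightarrow> l * exp (\<sigma> z)"
      by (intro tendsto_intros lim\<sigma>[OF z])
    moreover have "stirling_quot (z + of_nat n) * exp (\<Sum>k<n. stirling_step (z + of_nat k)) = stirling_quot z" for n
      using stirling_quot_shift[of z n] z by simp
    ultimately show ?thesis by (simp add: LIMSEQ_const_iff)
  qed
  have "(\<sigma> \<longlongrightarrow> 0) at_Re_top"
  proof (rule Lim_null_comparison)
    show "eventually (\<lambda>z. norm (\<sigma> z) \<le> 3 / (Re z - 1)) at_Re_top"
      unfolding eventually_at_Re_top using \<sigma>_le by auto
    have "((\<lambda>x::real. 3 / (x - 1)) \<longlongrightarrow> 0) at_top" by real_asymp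
    then show "((\<lambda>z. 3 / (Re z - 1)) \<longlongrightarrow> 0) at_Re_top"
      by (rule filterlim_compose) (rule filterlim_filtercomap)
  qed
  then have "((\<lambda>z. l * exp (\<sigma> z)) \<longlongrightarrow> l * exp 0) at_Re_top" by (intro tendsto_intros)
  moreover have "eventually (\<lambda>z. l * exp (\<sigma> z) = stirling_quot z) at_Re_top"
    unfolding eventually_at_Re_top using eq by (intro exI[of _ 2]) auto
  ultimately have "(stirling_quot \<longlongrightarrow> l) at_Re_top" by (rule Lim_transform_eventually[THEN tendsto_eq_rhs]) simp
  with l0 that show ?thesis by blast
qed

section \<open>Growth of the Gamma function in vertical strips\<close>

text \<open>Only the exponential rate \<mu>, which is additive under products, is recorded; the
  polynomial factor is left open. The threshold T keeps s away from real poles.\<close>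

definition strip_growth :: "real \<Rightarrow> real \<Rightarrow> real \<Rightarrow> (complex \<Rightarrow> complex) \<Rightarrow> bool" where
  "strip_growth p q \<mu> G \<longleftrightarrow> (\<exists>K n T. \<forall>s. p \<le> Re s \<and> Re s \<le> q \<and> T \<le> \<bar>Im s\<bar> \<longrightarrow>
     norm (G s) \<le> K * (1 + \<bar>Im s\<bar>) ^ n * exp (\<mu> * \<bar>Im s\<bar>))"

lemma strip_growthI:
  assumes "\<And>s. p \<le> Re s \<Longrightarrow> Re s \<le> q \<Longrightarrow> T \<le> \<bar>Im s\<bar> \<Longrightarrow> norm (G s) \<le> K * (1 + \<bar>Im s\<bar>) ^ n * exp (\<mu> * \<bar>Im s\<bar>)"
  shows "strip_growth p q \<mu> G"
  unfolding strip_growth_def using assms by blast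

lemma strip_growthE:
  assumes "strip_growth p q \<mu> G"
  obtains K T n where "K \<ge> 0" "T \<ge> 0"
    "\<forall>s. p \<le> Re s \<longrightarrow> Re s \<le> q \<longrightarrow> T \<le> \<bar>Im s\<bar> \<longrightarrow> norm (G s) \<le> K * (1 + \<bar>Im s\<bar>) ^ n * exp (\<mu> * \<bar>Im s\<bar>)"
proof -
  obtain K n T where *: "\<And>s. p \<le> Re s \<Longrightarrow> Re s \<le> q \<Longrightarrow> T \<le> \<bar>Im s\<bar> \<Longrightarrow>
      norm (G s) \<le> K * (1 + \<bar>Im s\<bar>) ^ n * exp (\<mu> * \<bar>Im s\<bar>)"
    using assms unfolding strip_growth_def by blast
  have "norm (G s) \<le> max K 0 * (1 + \<bar>Im s\<bar>) ^ n * exp (\<mu> * \<bar>Im s\<bar>)"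
    if s: "p \<le> Re s" "Re s \<le> q" "max T 0 \<le> \<bar>Im s\<bar>" for s
  proof -
    have "norm (G s) \<le> K * (1 + \<bar>Im s\<bar>) ^ n * exp (\<mu> * \<bar>Im s\<bar>)" using * s by auto
    also have "\<dots> \<le> max K 0 * (1 + \<bar>Im s\<bar>) ^ n * exp (\<mu> * \<bar>Im s\<bar>)"
      by (intro mult_right_mono) auto
    finally show ?thesis .
  qed
  then show ?thesis by (intro that[of "max K 0" "max T 0" n]) auto
qed

lemma strip_growth_mult:
  assumes "strip_growth p q \<mu> G" "strip_growth p q \<nu> H"
  shows "strip_growth p q (\<mu> + \<nu>) (\<lambda>s. G s * H s)"
proof -
  obtain K T n where K_: "K \<ge> 0" "T \<ge> 0"
    "\<forall>s. p \<le> Re s \<longrightarrow> Re s \<le> q \<longrightarrow> T \<le> \<bar>Im s\<bar> \<longrightarrow> norm (G s) \<le> K * (1 + \<bar>Im s\<bar>) ^ n * exp (\<mu> * \<bar>Im s\<bar>)"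
    using assms(1) by (rule strip_growthE)
  note K = K_(1,2) K_(3)[rule_format]
  obtain K' T' n' where K'_: "K' \<ge> 0" "T' \<ge> 0"
    "\<forall>s. p \<le> Re s \<longrightarrow> Re s \<le> q \<longrightarrow> T' \<le> \<bar>Im s\<bar> \<longrightarrow> norm (H s) \<le> K' * (1 + \<bar>Im s\<bar>) ^ n' * exp (\<nu> * \<bar>Im s\<bar>)"
    using assms(2) by (rule strip_growthE)
  note K' = K'_(1,2) K'_(3)[rule_format]
  show ?thesis
  proof (rule strip_growthI[where T = "max T T'" and K = "K * K'" and n = "n + n'"])
    fix s assume s: "p \<le> Re s" "Re s \<le> q" "max T T' \<le> \<bar>Im s\<bar>"
    have "norm (G s * H s) \<le> (K * (1 + \<bar>Im s\<bar>) ^ n * exp (\<mu> * \<bar>Im s\<bar>)) * (K' * (1 + \<bar>Im s\<bar>) ^ n' * exp (\<nu> * \<bar>Im s\<bar>))"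
      unfolding norm_mult using s K K' by (intro mult_mono) auto
    also have "\<dots> = K * K' * (1 + \<bar>Im s\<bar>) ^ (n + n') * exp ((\<mu> + \<nu>) * \<bar>Im s\<bar>)"
      by (simp add: power_add exp_add algebra_simps)
    finally show "norm (G s * H s) \<le> K * K' * (1 + \<bar>Im s\<bar>) ^ (n + n') * exp ((\<mu> + \<nu>) * \<bar>Im s\<bar>)" .
  qed
qed

lemma strip_growth_const: "strip_growth p q 0 (\<lambda>_. c)"
  by (rule strip_growthI[where K = "norm c" and n = 0 and T = 0]) simp

lemma strip_growth_prod:
  assumes "finite A" "\<And>i. i \<in> A \<Longrightarrow> strip_growth p q (\<mu> i) (G i)"
  shows "strip_growth p q (\<Sum>i\<in>A. \<mu> i) (\<lambda>s. \<Prod>i\<in>A. G i s)"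
  using assms
proof (induction A rule: finite_induct)
  case empty
  then show ?case using strip_growth_const[of p q 1] by simp
next
  case (insert x F)
  then show ?case using strip_growth_mult[of p q "\<mu> x" "G x"] by simp
qed

lemma strip_growth_affine:
  fixes a b :: real
  assumes G: "\<And>p q. strip_growth p q \<mu> G" and a: "a \<noteq> 0"
  shows "strip_growth p q (\<bar>a\<bar> * \<mu>) (\<lambda>s. G (of_real a * s + of_real b))"
proof -
  define m where "m = \<bar>a\<bar> * max \<bar>p\<bar> \<bar>q\<bar> + \<bar>b\<bar>"
  obtain K T n where K_: "K \<ge> 0" "T \<ge> 0"
    "\<forall>s. -m \<le> Re s \<longrightarrow> Re s \<le> m \<longrightarrow> T \<le> \<bar>Im s\<bar> \<longrightarrow> norm (G s) \<le> K * (1 + \<bar>Im s\<bar>) ^ n * exp (\<mu> * \<bar>Im s\<bar>)"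
    using G[of "-m" m] by (rule strip_growthE)
  note K = K_(1,2) K_(3)[rule_format]
  show ?thesis
  proof (rule strip_growthI[where T = "T / \<bar>a\<bar>" and K = "K * (1 + \<bar>a\<bar>) ^ n" and n = n])
    fix s assume s: "p \<le> Re s" "Re s \<le> q" "T / \<bar>a\<bar> \<le> \<bar>Im s\<bar>"
    define z where "z = of_real a * s + of_real b"
    have "\<bar>Re s\<bar> \<le> max \<bar>p\<bar> \<bar>q\<bar>" using s by auto
    then have "\<bar>a * Re s\<bar> \<le> \<bar>a\<bar> * max \<bar>p\<bar> \<bar>q\<bar>" unfolding abs_mult by (intro mult_left_mono) auto
    then have "\<bar>Re z\<bar> \<le> m" using abs_triangle_ineq[of "a * Re s" b] by (simp add: z_def m_def)
    moreover have im: "\<bar>Im z\<bar> = \<bar>a\<bar> * \<bar>Im s\<bar>" by (simp add: z_def abs_mult)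
    moreover have "T \<le> \<bar>a\<bar> * \<bar>Im s\<bar>" using s(3) a by (simp add: field_simps)
    ultimately have "norm (G z) \<le> K * (1 + \<bar>a\<bar> * \<bar>Im s\<bar>) ^ n * exp (\<mu> * (\<bar>a\<bar> * \<bar>Im s\<bar>))"
      using K(3)[of z] by (simp add: abs_le_iff)
    also have "\<dots> \<le> K * ((1 + \<bar>a\<bar>) * (1 + \<bar>Im s\<bar>)) ^ n * exp (\<mu> * (\<bar>a\<bar> * \<bar>Im s\<bar>))"
      using K(1) by (intro mult_right_mono mult_left_mono power_mono) (auto simp: algebra_simps)
    finally show "norm (G (of_real a * s + of_real b)) \<le> K * (1 + \<bar>a\<bar>) ^ n * (1 + \<bar>Im s\<bar>) ^ n * exp (\<bar>a\<bar> * \<mu> * \<bar>Im s\<bar>)"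
      unfolding z_def power_mult_distrib by (simp only: mult_ac)
  qed
qed

lemma strip_growth_shift:
  fixes c :: real
  assumes "strip_growth (p + c) (q + c) \<mu> G"
  shows "strip_growth p q \<mu> (\<lambda>s. G (s + of_real c))"
proof -
  obtain K T n where K_: "K \<ge> 0" "T \<ge> 0"
    "\<forall>s. p + c \<le> Re s \<longrightarrow> Re s \<le> q + c \<longrightarrow> T \<le> \<bar>Im s\<bar> \<longrightarrow> norm (G s) \<le> K * (1 + \<bar>Im s\<bar>) ^ n * exp (\<mu> * \<bar>Im s\<bar>)"
    using assms by (rule strip_growthE)
  note K = K_(1,2) K_(3)[rule_format]
  show ?thesis
    by (rule strip_growthI[where T = T and K = K and n = n]) (use K(3)[of "_ + of_real c"] in auto)
qed

lemma strip_growth_linear: "strip_growth p q 0 (\<lambda>s. s + of_nat k)"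
proof (rule strip_growthI[where T = 0 and K = "\<bar>p\<bar> + \<bar>q\<bar> + real k + 1" and n = 1])
  fix s :: complex assume s: "p \<le> Re s" "Re s \<le> q"
  have "norm (s + of_nat k) \<le> \<bar>Re s\<bar> + real k + \<bar>Im s\<bar>"
    using cmod_le[of "s + of_nat k"] by simp
  also have "\<dots> \<le> (\<bar>p\<bar> + \<bar>q\<bar> + real k + 1) + \<bar>Im s\<bar>" using s by simp
  also have "\<dots> \<le> (\<bar>p\<bar> + \<bar>q\<bar> + real k + 1) * (1 + \<bar>Im s\<bar>)"
  proof -
    have "0 \<le> (\<bar>p\<bar> + \<bar>q\<bar> + real k) * \<bar>Im s\<bar>" by simp
    then show ?thesis by (simp add: algebra_simps)
  qed
  finally show "norm (s + of_nat k) \<le> (\<bar>p\<bar> + \<bar>q\<bar> + real k + 1) * (1 + \<bar>Im s\<bar>) ^ 1 * exp (0 * \<bar>Im s\<bar>)"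
    by simp
qed

lemma strip_growth_inverse_linear: "strip_growth p q 0 (\<lambda>s. inverse (s + of_nat k))"
proof (rule strip_growthI[where T = 1 and K = 1 and n = 0])
  fix s :: complex assume s: "1 \<le> \<bar>Im s\<bar>"
  have "1 \<le> norm (s + of_nat k)" using s abs_Im_le_cmod[of "s + of_nat k"] by simp
  then show "norm (inverse (s + of_nat k)) \<le> 1 * (1 + \<bar>Im s\<bar>) ^ 0 * exp (0 * \<bar>Im s\<bar>)"
    by (simp add: norm_inverse inverse_le_1_iff)
qed

section \<open>Size of the Stirling main term and of Gamma in strips\<close>

lemma norm_stirling_base:
  assumes "Re z > 0"
  shows "norm (stirling_base z) = exp ((Re z - 1/2) * ln (norm z) - Im z * Arg z - Re z)"
proof -
  have "z \<noteq> 0" using assms by auto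
  then have "Re (Ln z) = ln (norm z)" "Im (Ln z) = Arg z" by (simp_all add: Arg_def)
  then show ?thesis by (simp add: stirling_base_def)
qed

text \<open>In a strip, Im z * Arg z thus equals pi/2 * |Im z| up to a bounded error. The lower
  bound comes from arctan (t/x) = pi/2 - arctan (x/t) and arctan (x/t) \<le> x/t.\<close>

lemma Im_mult_Arg_bounds:
  assumes "Re z > 0"
  shows "Im z * Arg z \<le> pi / 2 * \<bar>Im z\<bar>" "Im z * Arg z \<ge> pi / 2 * \<bar>Im z\<bar> - Re z"
proof -
  have A: "Arg z = arctan (Im z / Re z)" using assms by (simp add: arg_conv_arctan)
  have "\<bar>Arg z\<bar> \<le> pi / 2" using arctan_bounded[of "Im z / Re z"] unfolding A by linarith
  have "Im z * Arg z \<le> \<bar>Im z\<bar> * \<bar>Arg z\<bar>" by (metis abs_ge_self abs_mult)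
  also have "\<dots> \<le> \<bar>Im z\<bar> * (pi / 2)" using \<open>\<bar>Arg z\<bar> \<le> pi / 2\<close> by (intro mult_left_mono) auto
  finally show "Im z * Arg z \<le> pi / 2 * \<bar>Im z\<bar>" by (simp add: mult.commute)
  have pos: "t * arctan (t / x) \<ge> pi / 2 * t - x" if "t > 0" "x > 0" for t x :: real
  proof -
    have "arctan (t / x) = pi / 2 - arctan (x / t)"
      using arctan_inverse[of "x / t"] that by (simp add: field_simps)
    moreover have "arctan (x / t) \<le> x / t" using that by (intro arctan_le_self) auto
    ultimately have "arctan (t / x) \<ge> pi / 2 - x / t" by simp
    then have "t * arctan (t / x) \<ge> t * (pi / 2 - x / t)" using that by (intro mult_left_mono) auto
    moreover have "t * (pi / 2 - x / t) = pi / 2 * t - x" using that by (simp add: field_simps)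
    ultimately show ?thesis by simp
  qed
  show "Im z * Arg z \<ge> pi / 2 * \<bar>Im z\<bar> - Re z"
  proof (cases "Im z" "0 :: real" rule: linorder_cases)
    case less
    then show ?thesis using pos[of "- Im z" "Re z"] assms by (simp add: A arctan_minus)
  next
    case greater
    then show ?thesis using pos[of "Im z" "Re z"] assms by (simp add: A)
  qed (use assms in simp)
qed

lemma strip_growth_Gamma_right:
  "\<exists>x0. \<forall>p q. x0 \<le> p \<longrightarrow> strip_growth p q (-pi/2) Gamma \<and> strip_growth p q (pi/2) (\<lambda>z. inverse (Gamma z))"
proof -
  obtain l where l: "l \<noteq> 0" "(stirling_quot \<longlongrightarrow> l) at_Re_top"
    by (rule Gamma_stirling_complex)
  have "eventually (\<lambda>z. dist (stirling_quot z) l < norm l / 2) at_Re_top"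
    using l by (intro tendstoD[OF l(2)]) auto
  then obtain x1 where x1: "\<And>z. Re z \<ge> x1 \<Longrightarrow> dist (stirling_quot z) l < norm l / 2"
    unfolding eventually_at_Re_top by auto
  have *: "strip_growth p q (-pi/2) Gamma \<and> strip_growth p q (pi/2) (\<lambda>z. inverse (Gamma z))"
    if p: "max x1 1 \<le> p" for p q
  proof -
    have up: "norm (Gamma z) \<le> (2 * norm l * (1 + \<bar>q\<bar>) ^ nat \<lceil>q\<rceil>) * (1 + \<bar>Im z\<bar>) ^ nat \<lceil>q\<rceil> * exp (-pi/2 * \<bar>Im z\<bar>)"
     and lo: "norm (inverse (Gamma z)) \<le> (2 / norm l * exp q) * (1 + \<bar>Im z\<bar>) ^ 0 * exp (pi/2 * \<bar>Im z\<bar>)"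
      if z: "p \<le> Re z" "Re z \<le> q" for z
    proof -
      have x: "Re z \<ge> 1" "Re z > 0" using z p by auto
      have d: "norm (stirling_quot z - l) < norm l / 2" using x1[of z] z p by (simp add: dist_norm)
      have q1: "norm (stirling_quot z) \<le> 2 * norm l" "norm (stirling_quot z) \<ge> norm l / 2"
        using d norm_triangle_ineq2[of "stirling_quot z" l] norm_triangle_ineq2[of l "stirling_quot z"]
        by (auto simp: norm_minus_commute)
      have G: "norm (Gamma z) = norm (stirling_quot z) * norm (stirling_base z)"
        by (simp add: stirling_quot_def norm_divide)
      have n1: "norm z \<ge> 1" using x abs_Re_le_cmod[of z] by simp
      have n2: "norm z \<le> (1 + \<bar>q\<bar>) * (1 + \<bar>Im z\<bar>)"
      proof -
        have "norm z \<le> \<bar>Re z\<bar> + \<bar>Im z\<bar>" by (rule cmod_le)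
        also have "\<dots> \<le> \<bar>q\<bar> + \<bar>Im z\<bar>" using z x by simp
        also have "\<dots> \<le> (1 + \<bar>q\<bar>) * (1 + \<bar>Im z\<bar>)" by (simp add: algebra_simps)
        finally show ?thesis .
      qed
      let ?n = "nat \<lceil>q\<rceil>"
      have "(Re z - 1/2) * ln (norm z) \<le> real ?n * ln (norm z)"
        using n1 z real_nat_ceiling_ge[of q] by (intro mult_right_mono) (linarith, simp)
      also have "\<dots> = ln (norm z ^ ?n)" using n1 by (simp add: ln_realpow)
      finally have e1: "exp ((Re z - 1/2) * ln (norm z)) \<le> norm z ^ ?n"
        using n1 by (smt (verit) exp_le_cancel_iff exp_ln zero_less_power)
      have "norm (stirling_base z) \<le> exp ((Re z - 1/2) * ln (norm z)) * exp (-pi/2 * \<bar>Im z\<bar>)"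
        unfolding norm_stirling_base[OF x(2)] exp_add[symmetric]
        using Im_mult_Arg_bounds(2)[OF x(2)] by simp
      also have "\<dots> \<le> ((1 + \<bar>q\<bar>) * (1 + \<bar>Im z\<bar>)) ^ ?n * exp (-pi/2 * \<bar>Im z\<bar>)"
        using n2 by (intro mult_right_mono order_trans[OF e1] power_mono) auto
      finally have "norm (stirling_base z) \<le> (1 + \<bar>q\<bar>) ^ ?n * (1 + \<bar>Im z\<bar>) ^ ?n * exp (-pi/2 * \<bar>Im z\<bar>)"
        by (simp add: power_mult_distrib)
      then have "norm (Gamma z) \<le> (2 * norm l) * ((1 + \<bar>q\<bar>) ^ ?n * (1 + \<bar>Im z\<bar>) ^ ?n * exp (-pi/2 * \<bar>Im z\<bar>))"
        unfolding G using q1 by (intro mult_mono) auto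
      then show "norm (Gamma z) \<le> (2 * norm l * (1 + \<bar>q\<bar>) ^ ?n) * (1 + \<bar>Im z\<bar>) ^ ?n * exp (-pi/2 * \<bar>Im z\<bar>)"
        by (simp add: algebra_simps)
      \<comment> \<open>For the lower bound the power of \<open>norm z\<close> is simply dropped,
        since it is at least 1.\<close>
      have "0 \<le> (Re z - 1/2) * ln (norm z)" using x n1 by simp
      then have "norm (stirling_base z) \<ge> exp (- (q + pi/2 * \<bar>Im z\<bar>))"
        unfolding norm_stirling_base[OF x(2)]
        using Im_mult_Arg_bounds(1)[OF x(2)] z by simp
      then have "norm (Gamma z) \<ge> (norm l / 2) * exp (- (q + pi/2 * \<bar>Im z\<bar>))"
        unfolding G using q1 by (intro mult_mono) auto
      then have "inverse (norm (Gamma z)) \<le> inverse ((norm l / 2) * exp (- (q + pi/2 * \<bar>Im z\<bar>)))"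
        using l by (intro le_imp_inverse_le) auto
      also have "\<dots> = 2 / norm l * exp q * exp (pi/2 * \<bar>Im z\<bar>)"
        by (simp only: exp_minus exp_add inverse_mult_distrib inverse_inverse_eq) (simp add: field_simps)
      finally show "norm (inverse (Gamma z)) \<le> (2 / norm l * exp q) * (1 + \<bar>Im z\<bar>) ^ 0 * exp (pi/2 * \<bar>Im z\<bar>)"
        by (simp add: norm_inverse)
    qed
    show ?thesis using strip_growthI[OF up] strip_growthI[OF lo] by blast
  qed
  then show ?thesis by blast
qed

text \<open>The estimates to the right of x0 carry over by the functional equation: the Pochhammer
  factor relating Gamma z to Gamma (z + n) has rate 0, and so has its inverse.\<close>

lemma strip_growth_Gamma:
  shows "strip_growth p q (-pi/2) Gamma" "strip_growth p q (pi/2) (\<lambda>z. inverse (Gamma z))"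
proof -
  obtain x0 where x0: "\<And>p q. x0 \<le> p \<Longrightarrow> strip_growth p q (-pi/2) Gamma \<and> strip_growth p q (pi/2) (\<lambda>z. inverse (Gamma z))"
    using strip_growth_Gamma_right by blast
  define n where "n = nat \<lceil>x0 - p\<rceil>"
  have n: "x0 \<le> p + real n" unfolding n_def by linarith
  have r: "inverse (Gamma z) = pochhammer z n * inverse (Gamma (z + of_real (real n)))" for z :: complex
    using pochhammer_rGamma[of z n] by (simp add: rGamma_inverse_Gamma)
  \<comment> \<open>Inverting \<open>r\<close> is legitimate at the poles too, as both Gamma there
    and \<open>inverse 0\<close> have the value 0.\<close>
  have g: "Gamma z = inverse (pochhammer z n) * Gamma (z + of_real (real n))" for z :: complex
    using arg_cong[OF r[of z], of inverse] by (simp add: inverse_mult_distrib)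
  have poch: "strip_growth p q 0 (\<lambda>z. pochhammer z n)" "strip_growth p q 0 (\<lambda>z. inverse (pochhammer z n))"
    using strip_growth_prod[of "{0..<n}" p q "\<lambda>_. 0" "\<lambda>k z. z + of_nat k"]
       strip_growth_prod[of "{0..<n}" p q "\<lambda>_. 0" "\<lambda>k z. inverse (z + of_nat k)"]
    by (simp_all add: strip_growth_linear strip_growth_inverse_linear pochhammer_prod flip: prod_inversef)
  have sh: "strip_growth p q (-pi/2) (\<lambda>z. Gamma (z + of_real (real n)))"
    "strip_growth p q (pi/2) (\<lambda>z. inverse (Gamma (z + of_real (real n))))"
    using x0[OF n] strip_growth_shift[of p "real n" q _ Gamma] strip_growth_shift[of p "real n" q _ "\<lambda>z. inverse (Gamma z)"]
    by blast+
  show "strip_growth p q (-pi/2) Gamma"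
    using strip_growth_mult[OF poch(2) sh(1)] by (subst g[abs_def]) simp
  show "strip_growth p q (pi/2) (\<lambda>z. inverse (Gamma z))"
    using strip_growth_mult[OF poch(1) sh(2)] by (subst r) simp
qed

section \<open>Asymptotics of a single Gamma factor\<close>

text \<open>For z = \<alpha> w + \<beta> one has Ln z = ln \<alpha> + Ln w + \<Lambda> w, where
  \<Lambda> w tends to 0 and \<alpha> w \<Lambda> w tends to \<beta>. Writing the exponent through
  Ln w alone lets the exponents of different factors add up to one of the same shape.\<close>

lemma Gamma_linear_asymp:
  fixes \<alpha> \<beta> :: real
  assumes "\<alpha> > 0"
  obtains l where "l \<noteq> 0"
    "((\<lambda>w. Gamma (of_real \<alpha> * w + of_real \<beta>) /
        exp (of_real \<alpha> * (w * Ln w - w) + of_real (\<alpha> * ln \<alpha>) * w + of_real (\<beta> - 1/2) * Ln w)) \<longlongrightarrow> l) at_Re_top"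
proof -
  obtain l where l: "l \<noteq> 0" "(stirling_quot \<longlongrightarrow> l) at_Re_top"
    by (rule Gamma_stirling_complex)
  define z where "z w = of_real \<alpha> * w + of_real \<beta>" for w :: complex
  define v where "v w = of_real \<beta> / (of_real \<alpha> * w)" for w :: complex
  define \<Lambda> where "\<Lambda> w = Ln (1 + v w)" for w
  have Re_top: "filterlim Re at_top at_Re_top" by (rule filterlim_filtercomap)
  have "filterlim (\<lambda>w. Re (z w)) at_top at_Re_top"
  proof -
    have "filterlim (\<lambda>x. \<alpha> * x + \<beta>) at_top at_top" using assms by real_asymp
    from filterlim_compose[OF this Re_top] show ?thesis by (simp add: z_def)
  qed
  then have "filterlim z at_Re_top at_Re_top" by (simp add: filterlim_filtercomap_iff o_def)
  from filterlim_compose[OF l(2) this] have q: "((\<lambda>w. stirling_quot (z w)) \<longlongrightarrow> l) at_Re_top" .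
  have inv0: "((\<lambda>w. 1 / w) \<longlongrightarrow> 0) at_Re_top"
  proof (rule Lim_null_comparison)
    have "norm (1 / w) \<le> 1 / Re w" if "Re w \<ge> 1" for w
      using that abs_Re_le_cmod[of w] by (auto simp: norm_divide intro!: divide_left_mono mult_pos_pos)
    then show "\<forall>\<^sub>F w in at_Re_top. norm (1 / w) \<le> 1 / Re w"
      unfolding eventually_at_Re_top by blast
    have "((\<lambda>x::real. 1 / x) \<longlongrightarrow> 0) at_top" by real_asymp
    from filterlim_compose[OF this Re_top] show "((\<lambda>w. 1 / Re w) \<longlongrightarrow> 0) at_Re_top" .
  qed
  have v0: "(v \<longlongrightarrow> 0) at_Re_top"
    using tendsto_mult[OF tendsto_const inv0, of "of_real (\<beta> / \<alpha>)"] by (simp add: v_def[abs_def])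
  have \<Lambda>0: "(\<Lambda> \<longlongrightarrow> 0) at_Re_top"
    unfolding \<Lambda>_def using tendsto_Ln[OF tendsto_add[OF tendsto_const v0, of 1]] by (simp add: complex_nonpos_Reals_iff)
  have w\<Lambda>: "((\<lambda>w. of_real \<alpha> * w * \<Lambda> w) \<longlongrightarrow> of_real \<beta>) at_Re_top"
  proof (cases "\<beta> = 0")
    case True
    then show ?thesis by (simp add: \<Lambda>_def v_def)
  next
    case False
    have "((\<lambda>u. Ln (1 + u)) has_field_derivative 1) (at 0)"
      by (auto intro!: derivative_eq_intros simp: complex_nonpos_Reals_iff)
    then have d: "((\<lambda>u. Ln (1 + u) / u) \<longlongrightarrow> 1) (at 0)"
      by (simp add: has_field_derivative_iff)
    have "\<forall>w. Re w \<ge> 1 \<longrightarrow> v w \<noteq> 0" using False assms by (auto simp: v_def)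
    then have "filterlim v (at 0) at_Re_top"
      unfolding filterlim_at using v0 by (auto simp: eventually_at_Re_top)
    from filterlim_compose[OF d this]
    have "((\<lambda>w. of_real \<beta> * (\<Lambda> w / v w)) \<longlongrightarrow> of_real \<beta> * 1) at_Re_top"
      unfolding \<Lambda>_def by (intro tendsto_mult tendsto_const)
    moreover have "\<forall>\<^sub>F w in at_Re_top. of_real \<beta> * (\<Lambda> w / v w) = of_real \<alpha> * w * \<Lambda> w"
      unfolding eventually_at_Re_top v_def using False assms by (auto intro!: exI[of _ 1])
    ultimately show ?thesis by (rule Lim_transform_eventually[THEN tendsto_eq_rhs]) simp
  qed
  define c where "c = complex_of_real ((\<beta> - 1/2) * ln \<alpha>)"
  have "((\<lambda>w. stirling_quot (z w) * exp (c + (of_real \<alpha> * w * \<Lambda> w + of_real (\<beta> - 1/2) * \<Lambda> w) - of_real \<beta>))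
      \<longlongrightarrow> l * exp (c + (of_real \<beta> + of_real (\<beta> - 1/2) * 0) - of_real \<beta>)) at_Re_top"
    by (intro tendsto_intros q w\<Lambda> \<Lambda>0)
  moreover have "\<forall>\<^sub>F w in at_Re_top. stirling_quot (z w) * exp (c + (of_real \<alpha> * w * \<Lambda> w + of_real (\<beta> - 1/2) * \<Lambda> w) - of_real \<beta>)
     = Gamma (of_real \<alpha> * w + of_real \<beta>) /
        exp (of_real \<alpha> * (w * Ln w - w) + of_real (\<alpha> * ln \<alpha>) * w + of_real (\<beta> - 1/2) * Ln w)"
    unfolding eventually_at_Re_top
  proof (intro exI allI impI)
    fix w assume w: "max 1 (\<bar>\<beta>\<bar> / \<alpha> + 1) \<le> Re w"
    have w0: "w \<noteq> 0" "Re w > 0" using w by auto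
    have "norm (v w) < 1"
    proof -
      have "\<bar>\<beta>\<bar> / \<alpha> < norm w" using w abs_Re_le_cmod[of w] by linarith
      then show ?thesis using assms w0 by (simp add: v_def norm_divide norm_mult field_simps)
    qed
    then have re: "Re (1 + v w) > 0" using abs_Re_le_cmod[of "v w"] by simp
    then have nz: "1 + v w \<noteq> 0" by (metis zero_complex.sel(1) less_irrefl)
    have "Ln (w * (1 + v w)) = Ln w + \<Lambda> w"
      unfolding \<Lambda>_def
    proof (rule Ln_times_simple)
      have "\<bar>Im (Ln w)\<bar> < pi/2" "\<bar>Im (Ln (1 + v w))\<bar> < pi/2"
        using Re_Ln_pos_lt[OF w0(1)] Re_Ln_pos_lt[OF nz] w0 re by simp_all
      then show "- pi < Im (Ln w) + Im (Ln (1 + v w))" "Im (Ln w) + Im (Ln (1 + v w)) \<le> pi" by linarith+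
    qed (use w0 nz in auto)
    moreover have "Ln (of_real \<alpha> * (w * (1 + v w))) = ln \<alpha> + Ln (w * (1 + v w))"
      using assms w0 nz by (subst Ln_times_of_real) (auto simp: Ln_of_real)
    moreover have zw: "z w = of_real \<alpha> * (w * (1 + v w))"
      using w0 assms by (simp add: z_def v_def field_simps)
    ultimately have L: "Ln (z w) = of_real (ln \<alpha>) + Ln w + \<Lambda> w" by simp
    have "(x * w + y - 1/2) * (la + A + B) - (x * w + y)
       = ((y - 1/2) * la + (x * w * B + (y - 1/2) * B) - y) + (x * (w * A - w) + x * la * w + (y - 1/2) * A)"
      for x y la A B :: complex by (simp add: algebra_simps)
    from this[of "of_real \<alpha>" "of_real \<beta>" "of_real (ln \<alpha>)" "Ln w" "\<Lambda> w"]
    have "(z w - 1/2) * Ln (z w) - z w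
       = (c + (of_real \<alpha> * w * \<Lambda> w + of_real (\<beta> - 1/2) * \<Lambda> w) - of_real \<beta>)
         + (of_real \<alpha> * (w * Ln w - w) + of_real (\<alpha> * ln \<alpha>) * w + of_real (\<beta> - 1/2) * Ln w)"
      unfolding L by (simp add: z_def c_def)
    then have b: "stirling_base (z w) = exp (c + (of_real \<alpha> * w * \<Lambda> w + of_real (\<beta> - 1/2) * \<Lambda> w) - of_real \<beta>)
        * exp (of_real \<alpha> * (w * Ln w - w) + of_real (\<alpha> * ln \<alpha>) * w + of_real (\<beta> - 1/2) * Ln w)"
      unfolding stirling_base_def by (simp only: exp_add)
    show "stirling_quot (z w) * exp (c + (of_real \<alpha> * w * \<Lambda> w + of_real (\<beta> - 1/2) * \<Lambda> w) - of_real \<beta>)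
     = Gamma (of_real \<alpha> * w + of_real \<beta>) /
        exp (of_real \<alpha> * (w * Ln w - w) + of_real (\<alpha> * ln \<alpha>) * w + of_real (\<beta> - 1/2) * Ln w)"
      unfolding stirling_quot_def b by (simp add: z_def)
  qed
  ultimately have "((\<lambda>w. Gamma (of_real \<alpha> * w + of_real \<beta>) /
        exp (of_real \<alpha> * (w * Ln w - w) + of_real (\<alpha> * ln \<alpha>) * w + of_real (\<beta> - 1/2) * Ln w))
      \<longlongrightarrow> l * exp (c + (of_real \<beta> + of_real (\<beta> - 1/2) * 0) - of_real \<beta>)) at_Re_top"
    by (rule Lim_transform_eventually)
  moreover have "l * exp (c + (of_real \<beta> + of_real (\<beta> - 1/2) * 0) - of_real \<beta>) \<noteq> 0" using l by simp
  ultimately show ?thesis using that by blast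
qed

text \<open>
  \<open>Gamma (-a w + b) = gam_trig a b w * exp (gam_exp a b w) * gam_rest a b w\<close>: the factor is reflected if \<open>a > 0\<close>,
  so that only Gamma functions with arguments of large positive real part remain; the exponent
  is given by the same formula for both signs of \<open>a\<close>.
\<close>

definition gam_exp :: "real \<Rightarrow> real \<Rightarrow> complex \<Rightarrow> complex" where
  "gam_exp a b w = of_real (-a) * (w * Ln w - w) + of_real (- a * ln \<bar>a\<bar>) * w + of_real (b - 1/2) * Ln w"

definition gam_trig :: "real \<Rightarrow> real \<Rightarrow> complex \<Rightarrow> complex" where
  "gam_trig a b w = (if a < 0 then 1 else of_real pi / sin (of_real pi * (of_real a * w + of_real (1 - b))))"

definition gam_rest :: "real \<Rightarrow> real \<Rightarrow> complex \<Rightarrow> complex" where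
  "gam_rest a b w = (if a < 0 then Gamma (of_real (-a) * w + of_real b) / exp (gam_exp a b w)
     else inverse (Gamma (of_real a * w + of_real (1 - b)) * exp (gam_exp a b w)))"

text \<open>For a > 0, the bound on Re w puts the reflected argument a w + 1 - b into the right
  half-plane, where Gamma has no pole and can be divided out of the reflection formula.\<close>

lemma Gamma_factor:
  assumes "a \<noteq> 0" "Re w > (b - 1) / \<bar>a\<bar>"
  shows "Gamma (of_real a * (-w) + of_real b) = gam_trig a b w * exp (gam_exp a b w) * gam_rest a b w"
proof (cases "a < 0")
  case True
  then show ?thesis by (simp add: gam_trig_def gam_rest_def)
next
  case False
  define z where "z = of_real a * w + of_real (1 - b)"
  have "1 - z = of_real a * (-w) + of_real b" by (simp add: z_def)
  then have r: "Gamma z * Gamma (of_real a * (-w) + of_real b) = of_real pi / sin (of_real pi * z)"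
    using Gamma_reflection_complex[of z] by simp
  have "Re z > 0" using assms False by (simp add: z_def field_simps)
  then have "Gamma z \<noteq> 0" by (auto simp: Gamma_eq_zero_iff dest: nonpos_Ints_imp_Re_le)
  then have "Gamma (of_real a * (-w) + of_real b) = of_real pi / sin (of_real pi * z) / Gamma z"
    using r by (metis nonzero_mult_div_cancel_left)
  also have "\<dots> = gam_trig a b w * exp (gam_exp a b w) * gam_rest a b w"
  proof -
    have "gam_trig a b w = of_real pi / sin (of_real pi * z)" "gam_rest a b w = inverse (Gamma z * exp (gam_exp a b w))"
      using False by (simp_all add: gam_trig_def gam_rest_def z_def)
    then show ?thesis by (simp add: divide_inverse)
  qed
  finally show ?thesis .
qed

text \<open>For a > 0 this is the reciprocal of the quotient in \<open>Gamma_linear_asymp\<close>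
  with parameters a and 1 - b: since - (1 - b - 1/2) = b - 1/2, the exponent there is exactly minus
  \<open>gam_exp a b\<close>.\<close>

lemma gam_rest_asymp:
  assumes "a \<noteq> 0"
  obtains l where "l \<noteq> 0" "(gam_rest a b \<longlongrightarrow> l) at_Re_top"
proof (cases "a < 0")
  case True
  then have na: "- a > 0" by simp
  obtain l where "l \<noteq> 0" "((\<lambda>w. Gamma (of_real (-a) * w + of_real b) /
        exp (of_real (-a) * (w * Ln w - w) + of_real (-a * ln (-a)) * w + of_real (b - 1/2) * Ln w)) \<longlongrightarrow> l) at_Re_top"
    by (rule Gamma_linear_asymp[OF na, of b])
  then show ?thesis using True that by (simp add: gam_rest_def[abs_def] gam_exp_def)
next
  case False
  then have a: "a > 0" using assms by simp
  define E where "E w = of_real a * (w * Ln w - w) + of_real (a * ln a) * w + of_real (1 - b - 1/2) * Ln w" for w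
  obtain l where l: "l \<noteq> 0" "((\<lambda>w. Gamma (of_real a * w + of_real (1 - b)) / exp (E w)) \<longlongrightarrow> l) at_Re_top"
    unfolding E_def by (rule Gamma_linear_asymp[OF a, of "1 - b"])
  have E: "gam_exp a b w = - E w" for w
    using a by (simp add: gam_exp_def E_def algebra_simps)
  have "((\<lambda>w. inverse (Gamma (of_real a * w + of_real (1 - b)) / exp (E w))) \<longlongrightarrow> inverse l) at_Re_top"
    using l by (intro tendsto_inverse)
  moreover have "(\<lambda>w. inverse (Gamma (of_real a * w + of_real (1 - b)) / exp (E w))) = gam_rest a b"
    using False by (simp add: gam_rest_def[abs_def] E exp_minus divide_inverse)
  ultimately show ?thesis using that[of "inverse l"] l by simp
qed

lemma gam_rest_isCont:
  assumes "a \<noteq> 0" "Re w > 0" "Re w > (b - 1) / \<bar>a\<bar>" "Re w > - b / \<bar>a\<bar>"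
  shows "isCont (gam_rest a b) w"
proof -
  have w: "w \<notin> \<real>\<^sub>\<le>\<^sub>0" using assms by (auto simp: complex_nonpos_Reals_iff)
  have e: "isCont (\<lambda>w. exp (gam_exp a b w)) w"
    unfolding gam_exp_def using w by (intro continuous_intros) auto
  show ?thesis
  proof (cases "a < 0")
    case True
    have "Re (of_real (-a) * w + of_real b) > 0" using assms True by (simp add: field_simps)
    then have "of_real (-a) * w + of_real b \<notin> \<int>\<^sub>\<le>\<^sub>0" using nonpos_Ints_imp_Re_le by force
    then have "isCont (\<lambda>w. Gamma (of_real (-a) * w + of_real b) / exp (gam_exp a b w)) w"
      by (intro continuous_divide e isCont_Gamma continuous_intros) auto
    then show ?thesis using True by (simp add: gam_rest_def[abs_def])
  next
    case False
    have "Re (of_real a * w + of_real (1 - b)) > 0" using assms False by (simp add: field_simps)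
    then have n: "of_real a * w + of_real (1 - b) \<notin> \<int>\<^sub>\<le>\<^sub>0" using nonpos_Ints_imp_Re_le by force
    then have "Gamma (of_real a * w + of_real (1 - b)) \<noteq> 0" by (simp only: Gamma_eq_zero_iff not_False_eq_True)
    then have "isCont (\<lambda>w. inverse (Gamma (of_real a * w + of_real (1 - b)) * exp (gam_exp a b w))) w"
      using n by (intro continuous_at_within_inverse continuous_mult e isCont_Gamma continuous_intros) auto
    then show ?thesis using False by (simp add: gam_rest_def[abs_def])
  qed
qed

section \<open>The Gamma quotient to the left\<close>

lemma poly_le_exp:
  fixes p \<epsilon> :: real
  assumes "\<epsilon> > 0" "p \<ge> 0"
  obtains K where "K > 0" "\<And>t. t \<ge> 0 \<Longrightarrow> (1 + t) powr p \<le> K * exp (\<epsilon> * t)"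
proof -
  \<comment> \<open>Applying ln x \<le> x - 1 to x = \<eta> (1 + t) bounds p ln (1 + t) by a linear
    function of slope p \<eta>, so p \<eta> \<le> \<epsilon> is required; p + 1 instead of p admits
    p = 0.\<close>
  define \<eta> where "\<eta> = \<epsilon> / (p + 1)"
  have \<eta>: "\<eta> > 0" "p * \<eta> \<le> \<epsilon>" using assms by (auto simp: \<eta>_def field_simps)
  show ?thesis
  proof (rule that[of "exp (\<epsilon> - p * (1 + ln \<eta>))"])
    fix t :: real assume t: "t \<ge> 0"
    have "ln (\<eta> * (1 + t)) \<le> \<eta> * (1 + t) - 1" using \<eta> t by (intro ln_le_minus_one) auto
    then have "ln (1 + t) \<le> \<eta> * (1 + t) - (1 + ln \<eta>)" using \<eta> t by (simp add: ln_mult)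
    then have "p * ln (1 + t) \<le> p * (\<eta> * (1 + t) - (1 + ln \<eta>))" using assms by (intro mult_left_mono) auto
    also have "\<dots> = (p * \<eta>) * (1 + t) - p * (1 + ln \<eta>)" by (simp add: algebra_simps)
    also have "\<dots> \<le> \<epsilon> * (1 + t) - p * (1 + ln \<eta>)" using \<eta> t by (intro diff_mono order_refl mult_right_mono) auto
    finally have "exp (p * ln (1 + t)) \<le> exp ((\<epsilon> - p * (1 + ln \<eta>)) + \<epsilon> * t)"
      by (simp add: algebra_simps)
    then show "(1 + t) powr p \<le> exp (\<epsilon> - p * (1 + ln \<eta>)) * exp (\<epsilon> * t)"
      using t by (simp add: powr_def exp_add[symmetric])
  qed simp
qed

text \<open>Subtracting the nearest integer changes only the sign of the sine and leaves a distance
  of at most 1/2, where the sine is monotone; hence the minimum with 1/2.\<close>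

lemma abs_sin_pi_ge:
  fixes \<delta> u :: real
  assumes "0 < \<delta>" "\<And>m::int. \<delta> \<le> \<bar>u - of_int m\<bar>"
  shows "sin (pi * min \<delta> (1/2)) \<le> \<bar>sin (pi * u)\<bar>"
proof -
  define m where "m = round u"
  define r where "r = u - of_int m"
  have r: "\<bar>r\<bar> \<le> 1/2" "\<delta> \<le> \<bar>r\<bar>"
    using of_int_round_abs_le[of u] assms(2)[of m] by (auto simp: r_def m_def abs_minus_commute)
  have "pi * u = pi * r + pi * of_int m" by (simp add: r_def algebra_simps)
  then have "\<bar>sin (pi * u)\<bar> = \<bar>sin (pi * r)\<bar>"
    by (simp add: sin_add abs_mult sin_npi_int cos_npi_int)
  also have "\<dots> = sin (pi * \<bar>r\<bar>)"
  proof -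
    have "sin (pi * \<bar>r\<bar>) \<ge> 0" using r by (intro sin_ge_zero) (auto intro!: mult_left_le)
    moreover have "\<bar>sin (pi * r)\<bar> = \<bar>sin (pi * \<bar>r\<bar>)\<bar>" by (cases "r \<ge> 0") auto
    ultimately show ?thesis by simp
  qed
  also have "\<dots> \<ge> sin (pi * min \<delta> (1/2))"
  proof (rule sin_monotone_2pi_le)
    have "0 \<le> pi * min \<delta> (1/2)" using assms by simp
    then show "- (pi / 2) \<le> pi * min \<delta> (1/2)" using pi_gt_zero by linarith
    show "pi * min \<delta> (1/2) \<le> pi * \<bar>r\<bar>" using r by (intro mult_left_mono) auto
    show "pi * \<bar>r\<bar> \<le> pi / 2" using r mult_left_mono[of "\<bar>r\<bar>" "1/2" pi] by simp
  qed
  finally show ?thesis by simp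
qed

text \<open>The squared modulus is sinh^2 (Im z) + sin^2 (Re z). As c \<le> 1, it is at least c^2
  (sinh^2 y + 1) = c^2 cosh^2 y \<ge> c^2 exp (2 y) / 4 with y = |Im z|.\<close>

lemma norm_sin_ge:
  fixes z :: complex
  assumes "0 \<le> c" "c \<le> \<bar>sin (Re z)\<bar>"
  shows "c / 2 * exp \<bar>Im z\<bar> \<le> norm (sin z)"
proof -
  define y where "y = \<bar>Im z\<bar>"
  have c: "c\<^sup>2 \<le> (sin (Re z))\<^sup>2" using assms by (simp add: abs_le_square_iff[symmetric])
  have c1: "c\<^sup>2 \<le> 1" using c by (smt (verit) sin_cos_squared_add zero_le_power2)
  have "exp (2 * Im z) + inverse (exp (2 * Im z)) = exp (2 * y) + exp (- (2 * y))"
    by (cases "Im z \<ge> 0") (auto simp: y_def exp_minus)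
  then have n: "(norm (sin z))\<^sup>2 = (exp (2 * y) + exp (- (2 * y)) - 2) / 4 + (sin (Re z))\<^sup>2"
    unfolding norm_sin_squared cos_double_sin by (simp add: field_simps)
  have pos: "0 \<le> exp (2 * y) + exp (- (2 * y)) - 2"
  proof -
    have "0 \<le> (exp y - exp (- y))\<^sup>2" by simp
    also have "\<dots> = exp (2 * y) + exp (- (2 * y)) - 2"
      by (simp add: power2_eq_square algebra_simps flip: exp_add)
    finally show ?thesis .
  qed
  have "(c / 2 * exp y)\<^sup>2 = c\<^sup>2 * exp (2 * y) / 4"
    by (simp add: power2_eq_square flip: exp_add)
  also have "\<dots> \<le> c\<^sup>2 * ((exp (2 * y) + exp (- (2 * y)) - 2) / 4 + 1)"
    by (subst times_divide_eq_right[symmetric], intro mult_left_mono) (auto simp: field_simps add_pos_pos less_imp_le)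
  also have "\<dots> = c\<^sup>2 * ((exp (2 * y) + exp (- (2 * y)) - 2) / 4) + c\<^sup>2" by (simp add: algebra_simps)
  also have "\<dots> \<le> 1 * ((exp (2 * y) + exp (- (2 * y)) - 2) / 4) + (sin (Re z))\<^sup>2"
    using c c1 pos by (intro add_mono mult_right_mono) auto
  also have "\<dots> = (norm (sin z))\<^sup>2" using n by simp
  finally show ?thesis unfolding y_def by (rule power2_le_imp_le) simp
qed

lemma gam_trig_upper:
  assumes "\<delta> > 0"
  obtains K where "K \<ge> 0" "\<And>w. (\<And>m::int. \<delta> \<le> \<bar>a * Re w - b - of_int m\<bar>) \<Longrightarrow>
     norm (gam_trig a b w) \<le> K * exp (- pi * max a 0 * \<bar>Im w\<bar>)"
proof -
  define c where "c = sin (pi * min \<delta> (1/2))"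
  have c: "c > 0" unfolding c_def using assms by (intro sin_gt_zero) (auto simp: min_def)
  show ?thesis
  \<comment> \<open>The summand 1 covers the case a < 0, where \<open>gam_trig\<close> is 1.\<close>
  proof (rule that[of "1 + 2 * pi / c"])
    show "0 \<le> 1 + 2 * pi / c" using c by simp
    fix w assume w: "\<And>m::int. \<delta> \<le> \<bar>a * Re w - b - of_int m\<bar>"
    show "norm (gam_trig a b w) \<le> (1 + 2 * pi / c) * exp (- pi * max a 0 * \<bar>Im w\<bar>)"
    proof (cases "a < 0")
      case False
      define z where "z = of_real pi * (of_real a * w + of_real (1 - b))"
      have "c \<le> \<bar>sin (pi * (a * Re w + (1 - b)))\<bar>"
        unfolding c_def
      proof (rule abs_sin_pi_ge[OF assms])
        fix m :: int show "\<delta> \<le> \<bar>a * Re w + (1 - b) - of_int m\<bar>" using w[of "m - 1"] by (simp add: algebra_simps)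
      qed
      then have "c / 2 * exp \<bar>Im z\<bar> \<le> norm (sin z)" using c by (intro norm_sin_ge) (auto simp: z_def)
      then have "norm (of_real pi / sin z) \<le> pi / (c / 2 * exp \<bar>Im z\<bar>)"
      proof -
        have "c / 2 * exp \<bar>Im z\<bar> > 0" using c by simp
        then show ?thesis using \<open>c / 2 * exp \<bar>Im z\<bar> \<le> norm (sin z)\<close>
          unfolding norm_divide by (intro frac_le) auto
      qed
      also have "\<dots> = 2 * pi / c * exp (- pi * max a 0 * \<bar>Im w\<bar>)"
        using False by (simp add: z_def exp_minus abs_mult field_simps)
      also have "\<dots> \<le> (1 + 2 * pi / c) * exp (- pi * max a 0 * \<bar>Im w\<bar>)" by (intro mult_right_mono) auto
      finally show ?thesis using False by (simp add: gam_trig_def z_def)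
    qed (use c in \<open>simp add: gam_trig_def\<close>)
  qed
qed

lemma gam_trig_inverse_upper:
  "norm (inverse (gam_trig a b w)) \<le> exp (pi * max a 0 * \<bar>Im w\<bar>)"
proof (cases "a < 0")
  case False
  define z where "z = of_real pi * (of_real a * w + of_real (1 - b))"
  have "norm (sin z) \<le> exp \<bar>Im z\<bar>" using cmod_sin_le_exp[of 1 z] by simp
  also have "\<bar>Im z\<bar> = pi * max a 0 * \<bar>Im w\<bar>" using False by (simp add: z_def abs_mult)
  finally have "norm (sin z) / pi \<le> exp (pi * max a 0 * \<bar>Im w\<bar>) / 1"
    using pi_gt3 by (intro frac_le) auto
  then show ?thesis using False by (simp add: gam_trig_def z_def norm_divide)
qed (simp add: gam_trig_def)

section \<open>The Gamma quotient, its factorization and its bounds\<close>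

locale gamma_type_params =
  fixes J K :: nat and C D :: real and a b a' b' :: "nat \<Rightarrow> real"
  assumes D_pos: "D > 0"
    and a_nz: "\<forall>j\<in>{1..J}. a j \<noteq> 0"
    and a'_nz: "\<forall>k\<in>{1..K}. a' k \<noteq> 0"
begin

definition F :: "complex \<Rightarrow> complex" where "F = gamma_type_fun J K C D a b a' b'"
definition \<gamma> :: real where "\<gamma> = gamma_coeff J K a a'"
definition \<gamma>' :: real where "\<gamma>' = gamma'_coeff J K a a'"
definition \<kappa> :: real where "\<kappa> = kappa_coeff J K D a a'"
definition \<beta> :: real where "\<beta> = (\<Sum>j=1..J. b j - 1/2) - (\<Sum>k=1..K. b' k - 1/2)"

definition quot :: "complex \<Rightarrow> complex" where
  "quot s = of_real C * of_real D powr s *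
     (\<Prod>j=1..J. Gamma (of_real (a j) * s + of_real (b j))) /
     (\<Prod>k=1..K. Gamma (of_real (a' k) * s + of_real (b' k)))"

definition aexp :: "complex \<Rightarrow> complex" where
  "aexp w = of_real (- \<gamma>') * (w * Ln w - w) - of_real \<kappa> * w + of_real \<beta> * Ln w"

definition atrig :: "complex \<Rightarrow> complex" where
  "atrig w = (\<Prod>j=1..J. gam_trig (a j) (b j) w) / (\<Prod>k=1..K. gam_trig (a' k) (b' k) w)"

definition arest :: "complex \<Rightarrow> complex" where
  "arest w = (\<Prod>j=1..J. gam_rest (a j) (b j) w) / (\<Prod>k=1..K. gam_rest (a' k) (b' k) w)"

lemma F_eq_remove_sings: "F = remove_sings quot"
  by (simp add: F_def gamma_type_fun_def quot_def[abs_def])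

lemma sum_gam_exp:
  "(\<Sum>j=1..J. gam_exp (a j) (b j) w) - (\<Sum>k=1..K. gam_exp (a' k) (b' k) w) - of_real (ln D) * w = aexp w"
proof -
  have s: "(\<Sum>j=1..n. gam_exp (a j) (b j) w) =
     of_real (-(\<Sum>j=1..n. a j)) * (w * Ln w - w) + of_real (-(\<Sum>j=1..n. a j * ln \<bar>a j\<bar>)) * w + of_real (\<Sum>j=1..n. b j - 1/2) * Ln w"
    for n :: nat and a b :: "nat \<Rightarrow> real"
    unfolding gam_exp_def sum.distrib of_real_sum sum_distrib_right sum_negf[symmetric] by simp
  have alg: "(x * u + y * w + z * v) - (x' * u + y' * w + z' * v) - d * w = (x - x') * u - (- y + y' + d) * w + (z - z') * v"
    for x y z x' y' z' u v d w :: complex by (simp add: algebra_simps)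
  show ?thesis
    unfolding s alg aexp_def \<gamma>'_def gamma'_coeff_def \<kappa>_def kappa_coeff_def \<beta>_def
    by (simp add: of_real_diff)
qed

lemma quot_factor:
  "\<forall>\<^sub>F w in at_Re_top. quot (-w) = of_real C * exp (aexp w) * atrig w * arest w"
proof -
  have ev: "\<forall>\<^sub>F w in at_Re_top. \<forall>j\<in>{1..n}. Gamma (of_real (a j) * (-w) + of_real (b j)) =
      gam_trig (a j) (b j) w * exp (gam_exp (a j) (b j) w) * gam_rest (a j) (b j) w"
    if nz: "\<forall>j\<in>{1..n}. a j \<noteq> 0" for n and a b :: "nat \<Rightarrow> real"
  proof (rule eventually_ball_finite[OF finite_atLeastAtMost], rule ballI)
    fix j assume j: "j \<in> {1..n}"
    show "\<forall>\<^sub>F w in at_Re_top. Gamma (of_real (a j) * (-w) + of_real (b j)) =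
      gam_trig (a j) (b j) w * exp (gam_exp (a j) (b j) w) * gam_rest (a j) (b j) w"
      unfolding eventually_at_Re_top
      using Gamma_factor[of "a j" "b j"] nz[rule_format, OF j] by (intro exI[of _ "(b j - 1) / \<bar>a j\<bar> + 1"]) auto
  qed
  from ev[of J a b, OF a_nz] ev[of K a' b', OF a'_nz] show ?thesis
  proof eventually_elim
    case (elim w)
    have p: "(\<Prod>j=1..n. gam_trig (a j) (b j) w * exp (gam_exp (a j) (b j) w) * gam_rest (a j) (b j) w)
      = (\<Prod>j=1..n. gam_trig (a j) (b j) w) * exp (\<Sum>j=1..n. gam_exp (a j) (b j) w) * (\<Prod>j=1..n. gam_rest (a j) (b j) w)"
      for n and a b :: "nat \<Rightarrow> real" by (simp add: prod.distrib exp_sum)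
    have D: "of_real D powr (-w) = exp (- (of_real (ln D) * w))"
      using D_pos by (simp add: powr_def Ln_of_real algebra_simps)
    have "quot (-w) = of_real C * exp (- (of_real (ln D) * w)) *
      ((\<Prod>j=1..J. gam_trig (a j) (b j) w) * exp (\<Sum>j=1..J. gam_exp (a j) (b j) w) * (\<Prod>j=1..J. gam_rest (a j) (b j) w)) /
      ((\<Prod>j=1..K. gam_trig (a' j) (b' j) w) * exp (\<Sum>j=1..K. gam_exp (a' j) (b' j) w) * (\<Prod>j=1..K. gam_rest (a' j) (b' j) w))"
      unfolding quot_def D p[symmetric] using elim by simp
    also have "\<dots> = of_real C * exp (aexp w) * atrig w * arest w"
      unfolding sum_gam_exp[symmetric] exp_diff atrig_def arest_def
      by (simp add: exp_minus divide_inverse mult_ac)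
    finally show ?case .
  qed
qed

lemma arest_asymp:
  obtains l where "l \<noteq> 0" "(arest \<longlongrightarrow> l) at_Re_top"
proof -
  have ex: "\<exists>l. l \<noteq> 0 \<and> ((\<lambda>w. \<Prod>j=1..n. gam_rest (a j) (b j) w) \<longlongrightarrow> l) at_Re_top"
    if nz: "\<forall>j\<in>{1..n}. a j \<noteq> 0" for n and a b :: "nat \<Rightarrow> real"
  proof -
    have "\<forall>j\<in>{1..n}. \<exists>l. l \<noteq> 0 \<and> (gam_rest (a j) (b j) \<longlongrightarrow> l) at_Re_top"
      using gam_rest_asymp nz by metis
    then obtain l where l: "\<And>j. j \<in> {1..n} \<Longrightarrow> l j \<noteq> 0 \<and> (gam_rest (a j) (b j) \<longlongrightarrow> l j) at_Re_top"
      by metis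
    have "((\<lambda>w. \<Prod>j=1..n. gam_rest (a j) (b j) w) \<longlongrightarrow> (\<Prod>j=1..n. l j)) at_Re_top"
      using l by (intro tendsto_prod) auto
    then show ?thesis using l by (intro exI[of _ "\<Prod>j=1..n. l j"]) auto
  qed
  obtain l l' where "l \<noteq> 0" "((\<lambda>w. \<Prod>j=1..J. gam_rest (a j) (b j) w) \<longlongrightarrow> l) at_Re_top"
     "l' \<noteq> 0" "((\<lambda>w. \<Prod>j=1..K. gam_rest (a' j) (b' j) w) \<longlongrightarrow> l') at_Re_top"
    using ex[of J a b] ex[of K a' b'] a_nz a'_nz by blast
  then show ?thesis using that[of "l / l'"] tendsto_divide unfolding arest_def[abs_def] by force
qed

lemma arest_isCont: "\<forall>\<^sub>F w in at_Re_top. isCont arest w"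
proof -
  have ev: "\<forall>\<^sub>F w in at_Re_top. \<forall>j\<in>{1..n}. isCont (gam_rest (a j) (b j)) w"
    if nz: "\<forall>j\<in>{1..n}. a j \<noteq> 0" for n and a b :: "nat \<Rightarrow> real"
  proof (rule eventually_ball_finite[OF finite_atLeastAtMost], rule ballI)
    fix j assume j: "j \<in> {1..n}"
    show "\<forall>\<^sub>F w in at_Re_top. isCont (gam_rest (a j) (b j)) w"
      unfolding eventually_at_Re_top
      using gam_rest_isCont[of "a j" _ "b j"] nz[rule_format, OF j]
      by (intro exI[of _ "max 0 (max ((b j - 1) / \<bar>a j\<bar>) (- b j / \<bar>a j\<bar>)) + 1"]) auto
  qed
  have nz: "\<forall>\<^sub>F w in at_Re_top. \<forall>j\<in>{1..K}. gam_rest (a' j) (b' j) w \<noteq> 0"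
  proof (rule eventually_ball_finite[OF finite_atLeastAtMost], rule ballI)
    fix j assume j: "j \<in> {1..K}"
    obtain l where "l \<noteq> 0" "(gam_rest (a' j) (b' j) \<longlongrightarrow> l) at_Re_top"
      using gam_rest_asymp[OF a'_nz[rule_format, OF j]] by blast
    then show "\<forall>\<^sub>F w in at_Re_top. gam_rest (a' j) (b' j) w \<noteq> 0" by (intro tendsto_imp_eventually_ne)
  qed
  from ev[of J a b, OF a_nz] ev[of K a' b', OF a'_nz] nz show ?thesis
    unfolding arest_def[abs_def]
    by eventually_elim (intro continuous_divide continuous_prod, auto)
qed

text \<open>Only factors with positive coefficient are reflected, so these sums govern the decay of
  the sines in |Im w|.\<close>

lemma sum_max_a: "(\<Sum>j=1..J. max (a j) 0) - (\<Sum>k=1..K. max (a' k) 0) = (\<gamma> + \<gamma>') / 2"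
proof -
  have m: "max x 0 = (\<bar>x\<bar> + x) / 2" for x :: real by (auto simp: max_def)
  show ?thesis unfolding m \<gamma>_def \<gamma>'_def gamma_coeff_def gamma'_coeff_def
    by (simp add: sum.distrib field_simps flip: sum_divide_distrib)
qed

text \<open>The denominator factors contribute sines in the numerator, whose upper bounds hold
  everywhere; hence only the lattices belonging to the \<open>a j\<close> have to be
  avoided.\<close>

lemma norm_atrig_le:
  assumes "\<delta> > 0"
  obtains A where "A \<ge> 0" "\<forall>w. (\<forall>j\<in>{1..J}. \<forall>m::int. \<delta> \<le> \<bar>a j * Re w - b j - of_int m\<bar>) \<longrightarrow>
     norm (atrig w) \<le> A * exp (- pi * (\<gamma> + \<gamma>') / 2 * \<bar>Im w\<bar>)"
proof -
  have "\<exists>A. A \<ge> 0 \<and> (\<forall>w. (\<forall>m::int. \<delta> \<le> \<bar>a j * Re w - b j - of_int m\<bar>) \<longrightarrow>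
     norm (gam_trig (a j) (b j) w) \<le> A * exp (- pi * max (a j) 0 * \<bar>Im w\<bar>))" for j
    using gam_trig_upper[OF assms, of "a j" "b j"] by metis
  then obtain A where A: "\<And>j. A j \<ge> 0" "\<And>j w. (\<And>m::int. \<delta> \<le> \<bar>a j * Re w - b j - of_int m\<bar>) \<Longrightarrow>
     norm (gam_trig (a j) (b j) w) \<le> A j * exp (- pi * max (a j) 0 * \<bar>Im w\<bar>)"
    by metis
  show ?thesis
  proof (rule that[of "\<Prod>j=1..J. A j"])
    show "0 \<le> (\<Prod>j=1..J. A j)" using A by (intro prod_nonneg) auto
    show "\<forall>w. (\<forall>j\<in>{1..J}. \<forall>m::int. \<delta> \<le> \<bar>a j * Re w - b j - of_int m\<bar>) \<longrightarrow>
      norm (atrig w) \<le> (\<Prod>j=1..J. A j) * exp (- pi * (\<gamma> + \<gamma>') / 2 * \<bar>Im w\<bar>)"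
    proof (intro allI impI)
    fix w assume w: "\<forall>j\<in>{1..J}. \<forall>m::int. \<delta> \<le> \<bar>a j * Re w - b j - of_int m\<bar>"
    have "norm (\<Prod>j=1..J. gam_trig (a j) (b j) w) \<le> (\<Prod>j=1..J. A j * exp (- pi * max (a j) 0 * \<bar>Im w\<bar>))"
      unfolding prod_norm[symmetric] using A w by (intro prod_mono) auto
    also have "\<dots> = (\<Prod>j=1..J. A j) * exp (\<Sum>j=1..J. - pi * max (a j) 0 * \<bar>Im w\<bar>)"
      by (simp add: prod.distrib exp_sum)
    finally have 1: "norm (\<Prod>j=1..J. gam_trig (a j) (b j) w) \<le> (\<Prod>j=1..J. A j) * exp (\<Sum>j=1..J. - pi * max (a j) 0 * \<bar>Im w\<bar>)" .
    have "norm (\<Prod>k=1..K. inverse (gam_trig (a' k) (b' k) w)) \<le> (\<Prod>k=1..K. exp (pi * max (a' k) 0 * \<bar>Im w\<bar>))"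
      unfolding prod_norm[symmetric] using gam_trig_inverse_upper by (intro prod_mono) auto
    also have "\<dots> = exp (\<Sum>k=1..K. pi * max (a' k) 0 * \<bar>Im w\<bar>)" by (simp add: exp_sum)
    finally have 2: "norm (\<Prod>k=1..K. inverse (gam_trig (a' k) (b' k) w)) \<le> exp (\<Sum>k=1..K. pi * max (a' k) 0 * \<bar>Im w\<bar>)" .
    have "norm (atrig w) = norm (\<Prod>j=1..J. gam_trig (a j) (b j) w) * norm (\<Prod>k=1..K. inverse (gam_trig (a' k) (b' k) w))"
      unfolding atrig_def divide_inverse norm_mult prod_inversef[symmetric] by (simp add: o_def)
    also have "\<dots> \<le> ((\<Prod>j=1..J. A j) * exp (\<Sum>j=1..J. - pi * max (a j) 0 * \<bar>Im w\<bar>)) * exp (\<Sum>k=1..K. pi * max (a' k) 0 * \<bar>Im w\<bar>)"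
      using 1 2 \<open>0 \<le> (\<Prod>j=1..J. A j)\<close> by (intro mult_mono) auto
    also have "\<dots> = (\<Prod>j=1..J. A j) * exp (- pi * ((\<Sum>j=1..J. max (a j) 0) - (\<Sum>k=1..K. max (a' k) 0)) * \<bar>Im w\<bar>)"
      by (simp add: mult.assoc sum_negf algebra_simps sum_distrib_left sum_distrib_right flip: exp_add)
    finally show "norm (atrig w) \<le> (\<Prod>j=1..J. A j) * exp (- pi * (\<gamma> + \<gamma>') / 2 * \<bar>Im w\<bar>)"
      unfolding sum_max_a by simp
    qed
  qed
qed

lemma Re_aexp:
  assumes "Re w > 0"
  shows "Re (aexp w) = - \<gamma>' * (Re w * ln (norm w) - Im w * Arg w - Re w) - \<kappa> * Re w + \<beta> * ln (norm w)"
proof -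
  have "w \<noteq> 0" using assms by auto
  then have "Re (Ln w) = ln (norm w)" "Im (Ln w) = Arg w" by (simp_all add: Arg_def)
  then show ?thesis by (simp add: aexp_def algebra_simps)
qed

abbreviation left_bound :: "real \<Rightarrow> real" where
  "left_bound R \<equiv> exp (- \<gamma>' * (R * (ln R - 1)) - \<kappa> * R + \<bar>\<beta>\<bar> * ln R)"

text \<open>By \<open>Re_aexp\<close>, the term Im w * Arg w costs exp (pi \<gamma>' |t| / 2), which
  the sines more than compensate. The sign of \<gamma>' allows ln |w| to be replaced by ln R in the
  main term, whereas the term with \<beta> is estimated by ln |w| \<le> ln R + ln (1 + |t|), and the
  resulting power of 1 + |t| absorbs half of the decay.\<close>

lemma quot_left_bound:
  assumes "\<delta> > 0" "\<gamma> > 0" "\<gamma>' \<ge> 0"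
  obtains A x0 where "x0 \<ge> 1" "A \<ge> 0"
    "\<forall>w. Re w \<ge> x0 \<longrightarrow> (\<forall>j\<in>{1..J}. \<forall>m::int. \<delta> \<le> \<bar>a j * Re w - b j - of_int m\<bar>) \<longrightarrow>
     norm (quot (-w)) \<le> A * left_bound (Re w)
        * exp (- (pi * \<gamma> / 4) * \<bar>Im w\<bar>)"
proof -
  obtain A1 where A1: "A1 \<ge> 0" "\<forall>w. (\<forall>j\<in>{1..J}. \<forall>m::int. \<delta> \<le> \<bar>a j * Re w - b j - of_int m\<bar>) \<longrightarrow>
     norm (atrig w) \<le> A1 * exp (- pi * (\<gamma> + \<gamma>') / 2 * \<bar>Im w\<bar>)"
    by (rule norm_atrig_le[OF assms(1)])
  obtain l where l: "(arest \<longlongrightarrow> l) at_Re_top" using arest_asymp by blast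
  have "\<forall>\<^sub>F w in at_Re_top. norm (arest w) < norm l + 1"
    by (rule order_tendstoD[OF tendsto_norm[OF l]]) simp
  with quot_factor have "\<forall>\<^sub>F w in at_Re_top. norm (quot (-w)) \<le> norm C * exp (Re (aexp w)) * norm (atrig w) * (norm l + 1)"
  proof eventually_elim
    case (elim w)
    then show ?case by (auto simp: norm_mult intro!: mult_left_mono)
  qed
  then obtain x1 where x1: "\<And>w. Re w \<ge> x1 \<Longrightarrow> norm (quot (-w)) \<le> norm C * exp (Re (aexp w)) * norm (atrig w) * (norm l + 1)"
    unfolding eventually_at_Re_top by blast
  have e: "pi * \<gamma> / 4 > 0" using assms by simp
  obtain A2 where A2: "A2 > 0" "\<And>t. t \<ge> 0 \<Longrightarrow> (1 + t) powr \<bar>\<beta>\<bar> \<le> A2 * exp (pi * \<gamma> / 4 * t)"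
    by (rule poly_le_exp[OF e, of "\<bar>\<beta>\<bar>"]) auto
  show ?thesis
  proof (rule that[of "max 1 x1" "norm C * A1 * (norm l + 1) * A2"])
    show "0 \<le> norm C * A1 * (norm l + 1) * A2" using A1 A2 by (intro mult_nonneg_nonneg) auto
    show "\<forall>w. Re w \<ge> max 1 x1 \<longrightarrow> (\<forall>j\<in>{1..J}. \<forall>m::int. \<delta> \<le> \<bar>a j * Re w - b j - of_int m\<bar>) \<longrightarrow>
      norm (quot (-w)) \<le> norm C * A1 * (norm l + 1) * A2 *
        left_bound (Re w) * exp (- (pi * \<gamma> / 4) * \<bar>Im w\<bar>)"
    proof (intro allI impI)
    fix w assume w: "max 1 x1 \<le> Re w" "\<forall>j\<in>{1..J}. \<forall>m::int. \<delta> \<le> \<bar>a j * Re w - b j - of_int m\<bar>"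
    define R t where "R = Re w" and "t = \<bar>Im w\<bar>"
    have R: "R \<ge> 1" "Re w > 0" and t: "t \<ge> 0" using w by (auto simp: R_def t_def)
    have nR: "R \<le> norm w" using abs_Re_le_cmod[of w] by (simp add: R_def)
    have n2: "norm w \<le> R * (1 + t)"
    proof -
      have "norm w \<le> R + t" using cmod_le[of w] R by (simp add: R_def t_def)
      also have "\<dots> \<le> R * (1 + t)" using mult_right_mono[OF R(1) t] by (simp add: algebra_simps)
      finally show ?thesis .
    qed
    have ln0: "0 \<le> ln (norm w)" using R nR by simp
    have "ln (norm w) \<le> ln (R * (1 + t))" using n2 R nR t by (subst ln_le_cancel_iff) auto
    then have ln1: "ln (norm w) \<le> ln R + ln (1 + t)" using R t by (simp add: ln_mult)
    have ln2: "R * ln R \<le> R * ln (norm w)" using R nR by (intro mult_left_mono ln_mono) auto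
    have "\<beta> * ln (norm w) \<le> \<bar>\<beta>\<bar> * ln (norm w)" using ln0 by (intro mult_right_mono) auto
    also have "\<dots> \<le> \<bar>\<beta>\<bar> * (ln R + ln (1 + t))" using ln1 by (intro mult_left_mono) auto
    finally have b: "\<beta> * ln (norm w) \<le> \<bar>\<beta>\<bar> * (ln R + ln (1 + t))" .
    have g: "\<gamma>' * (R * ln R - pi / 2 * t - R) \<le> \<gamma>' * (R * ln (norm w) - Im w * Arg w - R)"
      using Im_mult_Arg_bounds(1)[OF R(2)] ln2 assms by (intro mult_left_mono) (auto simp: t_def)
    have "Re (aexp w) \<le> - (\<gamma>' * (R * ln R - pi / 2 * t - R)) - \<kappa> * R + \<bar>\<beta>\<bar> * (ln R + ln (1 + t))"
      unfolding Re_aexp[OF R(2)] using b g by (simp add: R_def)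
    also have "\<dots> = (- \<gamma>' * (R * (ln R - 1)) - \<kappa> * R + \<bar>\<beta>\<bar> * ln R) + \<bar>\<beta>\<bar> * ln (1 + t) + pi * \<gamma>' / 2 * t"
      by (simp add: algebra_simps)
    finally have "exp (Re (aexp w)) \<le> exp \<dots>" by simp
    also have "\<dots> = left_bound R * (1 + t) powr \<bar>\<beta>\<bar> * exp (pi * \<gamma>' / 2 * t)"
      using t by (simp add: exp_add powr_def)
    also have "\<dots> \<le> left_bound R * (A2 * exp (pi * \<gamma> / 4 * t)) * exp (pi * \<gamma>' / 2 * t)"
      using A2(2)[OF t] by (intro mult_right_mono mult_left_mono) auto
    finally have E: "exp (Re (aexp w)) \<le> left_bound R * (A2 * exp (pi * \<gamma> / 4 * t)) * exp (pi * \<gamma>' / 2 * t)" (is "_ \<le> ?E") .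
    have T: "norm (atrig w) \<le> A1 * exp (- pi * (\<gamma> + \<gamma>') / 2 * t)" using A1(2)[rule_format, of w] w(2) by (simp add: t_def)
    have "norm (quot (-w)) \<le> norm C * exp (Re (aexp w)) * norm (atrig w) * (norm l + 1)" using x1 w by simp
    also have "\<dots> \<le> norm C * ?E * (A1 * exp (- pi * (\<gamma> + \<gamma>') / 2 * t)) * (norm l + 1)"
      using E T A2 by (intro mult_right_mono mult_mono mult_left_mono) auto
    also have "\<dots> = (norm C * A1 * (norm l + 1) * A2) * left_bound R
       * (exp (pi * \<gamma> / 4 * t) * exp (pi * \<gamma>' / 2 * t) * exp (- pi * (\<gamma> + \<gamma>') / 2 * t))"
      by (simp only: mult_ac)
    also have "exp (pi * \<gamma> / 4 * t) * exp (pi * \<gamma>' / 2 * t) * exp (- pi * (\<gamma> + \<gamma>') / 2 * t) = exp (- (pi * \<gamma> / 4) * t)"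
      unfolding exp_add[symmetric] by (rule arg_cong[where f = exp]) (simp add: field_simps)
    finally show "norm (quot (-w)) \<le> norm C * A1 * (norm l + 1) * A2 *
        left_bound (Re w) * exp (- (pi * \<gamma> / 4) * \<bar>Im w\<bar>)"
      by (simp add: R_def t_def)
    qed
  qed simp
qed

text \<open>A Gamma factor of slope x has rate - pi |x| / 2 and its reciprocal the opposite one. In
  a fixed strip the sign of the slope is irrelevant, so \<gamma> alone appears, in contrast to the
  behaviour far to the left.\<close>

lemma quot_strip_growth: "strip_growth p q (- pi * \<gamma> / 2) quot"
proof -
  have D: "strip_growth p q 0 (\<lambda>s. of_real C * of_real D powr s)"
  proof (rule strip_growthI[where T = 0 and n = 0 and K = "norm C * exp (\<bar>ln D\<bar> * (\<bar>p\<bar> + \<bar>q\<bar>))"])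
    fix s :: complex assume s: "p \<le> Re s" "Re s \<le> q"
    have "Re s * ln D \<le> \<bar>Re s\<bar> * \<bar>ln D\<bar>" by (metis abs_ge_self abs_mult)
    also have "\<dots> \<le> (\<bar>p\<bar> + \<bar>q\<bar>) * \<bar>ln D\<bar>" using s by (intro mult_right_mono) auto
    finally have "Re s * ln D \<le> \<bar>ln D\<bar> * (\<bar>p\<bar> + \<bar>q\<bar>)" by (simp add: mult.commute)
    moreover have "norm (of_real D powr s) = exp (Re s * ln D)"
      using D_pos by (simp add: powr_def Ln_of_real mult.commute)
    ultimately show "norm (of_real C * of_real D powr s) \<le> norm C * exp (\<bar>ln D\<bar> * (\<bar>p\<bar> + \<bar>q\<bar>)) * (1 + \<bar>Im s\<bar>) ^ 0 * exp (0 * \<bar>Im s\<bar>)"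
      by (simp add: norm_mult mult_left_mono)
  qed
  have G: "strip_growth p q (\<bar>x\<bar> * (- pi / 2)) (\<lambda>s. Gamma (of_real x * s + of_real y))"
     "strip_growth p q (\<bar>x\<bar> * (pi / 2)) (\<lambda>s. inverse (Gamma (of_real x * s + of_real y)))" if "x \<noteq> 0" for x y
    using strip_growth_affine[OF strip_growth_Gamma(1) that] strip_growth_affine[OF strip_growth_Gamma(2) that] by auto
  have "strip_growth p q (0 + (\<Sum>j=1..J. \<bar>a j\<bar> * (- pi / 2)) + (\<Sum>k=1..K. \<bar>a' k\<bar> * (pi / 2)))
     (\<lambda>s. of_real C * of_real D powr s * (\<Prod>j=1..J. Gamma (of_real (a j) * s + of_real (b j)))
        * (\<Prod>k=1..K. inverse (Gamma (of_real (a' k) * s + of_real (b' k)))))"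
    by (intro strip_growth_mult D strip_growth_prod G) (use a_nz a'_nz in auto)
  moreover have "0 + (\<Sum>j=1..J. \<bar>a j\<bar> * (- pi / 2)) + (\<Sum>k=1..K. \<bar>a' k\<bar> * (pi / 2)) = - pi * \<gamma> / 2"
    unfolding sum_distrib_right[symmetric] \<gamma>_def gamma_coeff_def by (simp add: field_simps)
  moreover have "(\<lambda>s. of_real C * of_real D powr s * (\<Prod>j=1..J. Gamma (of_real (a j) * s + of_real (b j)))
        * (\<Prod>k=1..K. inverse (Gamma (of_real (a' k) * s + of_real (b' k))))) = quot"
    unfolding quot_def[abs_def] divide_inverse prod_inversef[symmetric] o_def ..
  ultimately show ?thesis by simp
qed

lemma quot_strip_bound:
  assumes "\<gamma> > 0"
  obtains A T where "A \<ge> 0" "T \<ge> 0" "\<forall>s. p \<le> Re s \<longrightarrow> Re s \<le> q \<longrightarrow> T \<le> \<bar>Im s\<bar> \<longrightarrow>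
    norm (quot s) \<le> A * exp (- (pi * \<gamma> / 4) * \<bar>Im s\<bar>)"
proof -
  obtain A T n where A: "A \<ge> 0" "T \<ge> 0" "\<forall>s. p \<le> Re s \<longrightarrow> Re s \<le> q \<longrightarrow> T \<le> \<bar>Im s\<bar> \<longrightarrow>
    norm (quot s) \<le> A * (1 + \<bar>Im s\<bar>) ^ n * exp (- pi * \<gamma> / 2 * \<bar>Im s\<bar>)"
    by (rule strip_growthE[OF quot_strip_growth])
  have e: "pi * \<gamma> / 4 > 0" using assms by simp
  obtain A2 where A2: "A2 > 0" "\<And>t. t \<ge> 0 \<Longrightarrow> (1 + t) powr real n \<le> A2 * exp (pi * \<gamma> / 4 * t)"
    by (rule poly_le_exp[OF e, of "real n"]) auto
  have "norm (quot s) \<le> A * A2 * exp (- (pi * \<gamma> / 4) * \<bar>Im s\<bar>)"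
    if s: "p \<le> Re s" "Re s \<le> q" "T \<le> \<bar>Im s\<bar>" for s
  proof -
    define t where "t = \<bar>Im s\<bar>"
    have t: "t \<ge> 0" by (simp add: t_def)
    have "norm (quot s) \<le> A * (1 + t) ^ n * exp (- pi * \<gamma> / 2 * t)" using A s by (simp add: t_def)
    also have "\<dots> \<le> A * (A2 * exp (pi * \<gamma> / 4 * t)) * exp (- pi * \<gamma> / 2 * t)"
      using A2(2)[OF t] A(1) t by (intro mult_right_mono mult_left_mono) (auto simp: powr_realpow)
    also have "\<dots> = A * A2 * (exp (pi * \<gamma> / 4 * t) * exp (- pi * \<gamma> / 2 * t))" by simp
    also have "exp (pi * \<gamma> / 4 * t) * exp (- pi * \<gamma> / 2 * t) = exp (- (pi * \<gamma> / 4) * t)"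
      unfolding exp_add[symmetric] by (rule arg_cong[where f = exp]) (simp add: field_simps)
    finally show ?thesis by (simp add: t_def)
  qed
  then show ?thesis using that[of "A * A2" T] A A2 by simp
qed

end

section \<open>Poles and residues\<close>

text \<open>The coefficient of index -1 in the product of the Laurent expansion of f with the Taylor
  expansion of exp (c s) at z pairs the coefficient of index -(l + 1) with exp (c z) c^l /
  l!.\<close>

lemma residue_mult_exp:
  fixes f :: "complex \<Rightarrow> complex" and z c :: complex
  assumes "isolated_singularity_at f z" "not_essential f z" "is_pole f z"
  shows "residue (\<lambda>s. f s * exp (c * s)) z =
    (\<Sum>l<pole_order f z. sing_coeff f (l + 1) z / fact l * exp (c * z) * c ^ l)"
proof -
  define L where "L = laurent_expansion f z"
  have L: "(\<lambda>x. f (z + x)) has_laurent_expansion L"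
    unfolding L_def by (rule not_essential_has_laurent_expansion) fact+
  have sub: "fls_subdegree L < 0"
    using has_laurent_expansion_imp_is_pole_iff[OF L] assms(3) by simp
  then have L0: "L \<noteq> 0" by auto
  have zo: "zorder f z = fls_subdegree L" using has_laurent_expansion_zorder[OF L L0] .
  define G where "G = fps_const (exp (c * z)) * fps_exp c"
  have "(\<lambda>x. exp (c * z) * exp (c * x)) has_fps_expansion G"
    unfolding G_def by (intro fps_expansion_intros)
  then have "(\<lambda>x. exp (c * (z + x))) has_fps_expansion G"
    by (simp add: exp_add distrib_left)
  then have G: "(\<lambda>x. exp (c * (z + x))) has_laurent_expansion fps_to_fls G"
    by (rule has_laurent_expansion_fps)
  have Gn: "fps_nth G n = exp (c * z) * (c ^ n / fact n)" for n
    by (simp add: G_def)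
  have "subdegree G = 0" by (rule subdegree_eq_0) (simp add: Gn)
  then have sG: "fls_subdegree (fps_to_fls G) = 0" by (simp add: fls_subdegree_fls_to_fps)
  have "residue (\<lambda>s. f s * exp (c * s)) z = fls_residue (L * fps_to_fls G)"
    by (intro has_laurent_expansion_residue has_laurent_expansion_mult L G)
  also have "\<dots> = (\<Sum>i = fls_subdegree L..-1. fls_nth L i * fls_nth (fps_to_fls G) (-1 - i))"
    unfolding fls_residue_def by (subst fls_times_nth(2)) (simp add: sG)
  also have "\<dots> = (\<Sum>l<pole_order f z. fls_nth L (- int (l + 1)) * fps_nth G l)"
  proof (rule sum.reindex_bij_witness[where i = "\<lambda>l. - int (l + 1)" and j = "\<lambda>i. nat (-1 - i)"])
    fix i assume "i \<in> {fls_subdegree L..-1}"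
    then show "- int (nat (-1 - i) + 1) = i" "nat (-1 - i) \<in> {..<pole_order f z}"
      by (auto simp: pole_order_def zo)
    then show "fls_nth L (- int (nat (-1 - i) + 1)) * fps_nth G (nat (-1 - i)) = fls_nth L i * fls_nth (fps_to_fls G) (-1 - i)"
      using \<open>i \<in> {fls_subdegree L..-1}\<close> by simp
  next
    fix l assume "l \<in> {..<pole_order f z}"
    then show "nat (-1 - - int (l + 1)) = l" "- int (l + 1) \<in> {fls_subdegree L..-1}"
      by (auto simp: pole_order_def zo)
  qed
  also have "\<dots> = (\<Sum>l<pole_order f z. sing_coeff f (l + 1) z / fact l * exp (c * z) * c ^ l)"
    by (intro sum.cong refl) (simp add: Gn sing_coeff_def L_def)
  finally show ?thesis .
qed

lemma sing_coeff_1: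
  assumes "isolated_singularity_at f z" "not_essential f z"
  shows "sing_coeff f 1 z = residue f z"
  using has_laurent_expansion_residue[OF not_essential_has_laurent_expansion[OF assms]]
  by (simp add: sing_coeff_def)

text \<open>For f = F and a pole \<rho> < 0 this is the residue of F s * exp (- y s) at \<rho>, see
  \<open>residue_eq_pole_term\<close>; the absolute value is - \<rho>.\<close>

definition pole_term :: "(complex \<Rightarrow> complex) \<Rightarrow> real \<Rightarrow> real \<Rightarrow> complex" where
  "pole_term f y \<rho> = (\<Sum>l<pole_order f (of_real \<rho>). sing_coeff f (l + 1) (of_real \<rho>) / fact l
      * of_real (exp (\<bar>\<rho>\<bar> * y)) * of_real ((- y) ^ l))"

section \<open>Location of the poles and the residue theorem for the inversion kernel\<close>

context gamma_type_params
begin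

text \<open>\<open>S0\<close> contains the poles of the numerator factors, even if they cancel in \<open>F\<close>.\<close>

definition S0 :: "complex set" where
  "S0 = {s. \<exists>j\<in>{1..J}. of_real (a j) * s + of_real (b j) \<in> \<int>\<^sub>\<le>\<^sub>0}"

lemma S0_lattice:
  assumes "s \<in> S0"
  shows "Im s = 0" "\<exists>j\<in>{1..J}. \<exists>m::int. a j * Re s + b j = of_int m"
proof -
  obtain j where j: "j \<in> {1..J}" "of_real (a j) * s + of_real (b j) \<in> \<int>\<^sub>\<le>\<^sub>0" using assms by (auto simp: S0_def)
  obtain n where n: "of_real (a j) * s + of_real (b j) = - of_nat n"
    using j(2) by (rule nonpos_Ints_cases')
  have "a j * Im s = 0" using arg_cong[OF n, of Im] by simp
  then show "Im s = 0" using a_nz j by auto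
  have "a j * Re s + b j = of_int (- int n)" using arg_cong[OF n, of Re] by simp
  then show "\<exists>j\<in>{1..J}. \<exists>m::int. a j * Re s + b j = of_int m" using j by blast
qed

lemma finite_lattice_strip:
  "finite {x. p \<le> x \<and> x \<le> q \<and> (\<exists>j\<in>{1..J}. \<exists>m::int. a j * x + b j = of_int m)}"
proof (rule finite_subset)
  define M where "M j = \<lceil>\<bar>a j\<bar> * (\<bar>p\<bar> + \<bar>q\<bar>) + \<bar>b j\<bar>\<rceil>" for j
  let ?A = "\<Union>j\<in>{1..J}. (\<lambda>m::int. (of_int m - b j) / a j) ` {- M j..M j}"
  show "{x. p \<le> x \<and> x \<le> q \<and> (\<exists>j\<in>{1..J}. \<exists>m::int. a j * x + b j = of_int m)} \<subseteq> ?A"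
  proof safe
    fix x j and m :: int assume x: "p \<le> x" "x \<le> q" and j: "j \<in> {1..J}" "a j * x + b j = of_int m"
    have "\<bar>x\<bar> \<le> \<bar>p\<bar> + \<bar>q\<bar>" using x by auto
    then have "\<bar>a j * x\<bar> \<le> \<bar>a j\<bar> * (\<bar>p\<bar> + \<bar>q\<bar>)" unfolding abs_mult by (intro mult_left_mono) auto
    then have "\<bar>of_int m\<bar> \<le> \<bar>a j\<bar> * (\<bar>p\<bar> + \<bar>q\<bar>) + \<bar>b j\<bar>" unfolding j(2)[symmetric] by linarith
    then have "m \<in> {- M j..M j}" unfolding M_def by (simp add: abs_le_iff) linarith
    moreover have "x = (of_int m - b j) / a j" using j a_nz by (auto simp: field_simps)
    ultimately show "x \<in> ?A" using j(1) by blast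
  qed
qed auto

lemma finite_S0_strip: "finite {s \<in> S0. p \<le> Re s \<and> Re s \<le> q}"
proof (rule finite_subset)
  show "{s \<in> S0. p \<le> Re s \<and> Re s \<le> q} \<subseteq>
    complex_of_real ` {x. p \<le> x \<and> x \<le> q \<and> (\<exists>j\<in>{1..J}. \<exists>m::int. a j * x + b j = of_int m)}"
  proof
    fix s assume s: "s \<in> {s \<in> S0. p \<le> Re s \<and> Re s \<le> q}"
    then have "s = of_real (Re s)" using S0_lattice(1)[of s] by (simp add: complex_eq_iff)
    then show "s \<in> complex_of_real ` {x. p \<le> x \<and> x \<le> q \<and> (\<exists>j\<in>{1..J}. \<exists>m::int. a j * x + b j = of_int m)}"
      using s S0_lattice(2)[of s] by (intro image_eqI[of _ _ "Re s"]) auto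
  qed
qed (intro finite_imageI finite_lattice_strip)

text \<open>Also valid where a denominator factor has a pole: there \<open>Gamma\<close> is \<open>0\<close>, and \<open>x / 0 = 0 = rGamma\<close>.\<close>

lemma quot_eq: "quot s = of_real C * of_real D powr s *
     (\<Prod>j=1..J. Gamma (of_real (a j) * s + of_real (b j))) *
     (\<Prod>k=1..K. rGamma (of_real (a' k) * s + of_real (b' k)))"
  unfolding quot_def divide_inverse rGamma_inverse_Gamma prod_inversef[symmetric] o_def ..

lemma D_powr_analytic [analytic_intros]: "(\<lambda>s. of_real D powr s) analytic_on A"
  using D_pos by (simp add: powr_def) (auto intro!: analytic_intros)

lemma quot_analytic: "s \<notin> S0 \<Longrightarrow> quot analytic_on {s}"
  unfolding quot_eq[abs_def] by (intro analytic_intros) (auto simp: S0_def)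

lemma quot_meromorphic: "quot meromorphic_on UNIV"
proof -
  \<comment> \<open>In terms of reciprocal Gamma functions this is a quotient of entire
    functions.\<close>
  have "quot = (\<lambda>s. of_real C * of_real D powr s * (\<Prod>k=1..K. rGamma (of_real (a' k) * s + of_real (b' k))) /
     (\<Prod>j=1..J. rGamma (of_real (a j) * s + of_real (b j))))"
    unfolding quot_def divide_inverse rGamma_inverse_Gamma prod_inversef[symmetric] o_def
    by (simp add: mult_ac)
  moreover have "\<dots> meromorphic_on UNIV"
    by (intro meromorphic_on_divide analytic_on_imp_meromorphic_on analytic_intros)
  ultimately show ?thesis by simp
qed

lemma F_eq_quot: "s \<notin> S0 \<Longrightarrow> F s = quot s"
  unfolding F_eq_remove_sings by (intro remove_sings_at_analytic quot_analytic)

lemma F_nicely_meromorphic: "F nicely_meromorphic_on UNIV"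
  unfolding F_eq_remove_sings by (intro remove_sings_nicely_meromorphic quot_meromorphic)

lemma F_isolated: "isolated_singularity_at F s" and F_not_essential: "not_essential F s"
  using F_nicely_meromorphic meromorphic_on_isolated_singularity meromorphic_on_not_essential meromorphic_on_subset
  unfolding nicely_meromorphic_on_def by blast+

lemma F_analytic_not_pole: "\<not> is_pole F s \<Longrightarrow> F analytic_on {s}"
  using nicely_meromorphic_on_imp_analytic_at[OF F_nicely_meromorphic] by auto

lemma F_analytic: "s \<notin> S0 \<Longrightarrow> F analytic_on {s}"
  unfolding F_eq_remove_sings using quot_analytic by (intro remove_sings_analytic_on)

lemma pole_in_S0: "is_pole F s \<Longrightarrow> s \<in> S0"
  using F_analytic analytic_at_imp_no_pole by blast

lemma pole_real: "is_pole F s \<Longrightarrow> s = of_real (Re s)"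
  using S0_lattice(1)[OF pole_in_S0] by (simp add: complex_eq_iff)

lemma finite_neg_poles: "finite {\<rho> \<in> neg_poles F. r < \<rho>}"
proof (rule finite_imageD)
  show "finite (complex_of_real ` {\<rho> \<in> neg_poles F. r < \<rho>})"
    by (rule finite_subset[OF _ finite_S0_strip[of r 0]]) (auto simp: neg_poles_def pole_in_S0)
qed (auto simp: inj_on_def)

lemma residue_eq_pole_term:
  assumes "\<rho> \<in> neg_poles F"
  shows "residue (\<lambda>s. F s * exp (- of_real y * s)) (of_real \<rho>) = pole_term F y \<rho>"
proof -
  have "\<rho> < 0" "is_pole F (of_real \<rho>)" using assms by (auto simp: neg_poles_def)
  then have "residue (\<lambda>s. F s * exp (- of_real y * s)) (of_real \<rho>) =
    (\<Sum>l<pole_order F (of_real \<rho>). sing_coeff F (l + 1) (of_real \<rho>) / fact l * exp (- of_real y * of_real \<rho>) * (- of_real y) ^ l)"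
    using residue_mult_exp[OF F_isolated F_not_essential] by blast
  moreover have "exp (- of_real y * of_real \<rho>) = complex_of_real (exp (\<bar>\<rho>\<bar> * y))"
    using \<open>\<rho> < 0\<close> by (simp add: exp_of_real[symmetric] mult.commute)
  ultimately show ?thesis by (simp add: pole_term_def)
qed

lemma pole_term_simple:
  assumes "pole_order F (of_real \<rho>) = 1"
  shows "pole_term F y \<rho> = residue F (of_real \<rho>) * of_real (exp (\<bar>\<rho>\<bar> * y))"
  using sing_coeff_1[OF F_isolated F_not_essential, of "of_real \<rho>"] assms by (simp add: pole_term_def)

lemma kernel_analytic: "\<not> is_pole F s \<Longrightarrow> (\<lambda>s. F s * exp (- of_real y * s)) analytic_on {s}"
  by (intro analytic_intros F_analytic_not_pole)

text \<open>Only the points of \<open>S0\<close> that are genuine poles contribute to the residue sum.\<close>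

lemma residue_sum:
  assumes U: "open U" "connected U" "finite (S0 \<inter> U)"
    and g: "valid_path g" "pathfinish g = pathstart g" "path_image g \<subseteq> U - S0"
    and w: "\<And>z. z \<notin> U \<Longrightarrow> winding_number g z = 0"
    and A: "A \<subseteq> neg_poles F" "of_real ` A \<subseteq> U"
    and w1: "\<And>\<rho>. \<rho> \<in> A \<Longrightarrow> winding_number g (of_real \<rho>) = 1"
    and w0: "\<And>s. is_pole F s \<Longrightarrow> s \<in> U \<Longrightarrow> s \<notin> of_real ` A \<Longrightarrow> winding_number g s = 0"
  shows "contour_integral g (\<lambda>s. F s * exp (- of_real y * s)) = 2 * pi * \<i> * (\<Sum>\<rho>\<in>A. pole_term F y \<rho>)"
proof -
  let ?f = "\<lambda>s. F s * exp (- of_real y * s)"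
  have "?f analytic_on U - S0 \<inter> U"
    using kernel_analytic pole_in_S0 by (subst analytic_on_analytic_at) blast
  then have hol: "?f holomorphic_on U - S0 \<inter> U" by (rule analytic_imp_holomorphic)
  have "contour_integral g ?f = 2 * pi * \<i> * (\<Sum>s\<in>S0 \<inter> U. winding_number g s * residue ?f s)"
    using U g w hol by (intro Residue_theorem) auto
  also have "(\<Sum>s\<in>S0 \<inter> U. winding_number g s * residue ?f s) = (\<Sum>s\<in>of_real ` A. winding_number g s * residue ?f s)"
  proof (rule sum.mono_neutral_right)
    show "of_real ` A \<subseteq> S0 \<inter> U" using A pole_in_S0 by (auto simp: neg_poles_def)
    show "\<forall>s\<in>S0 \<inter> U - of_real ` A. winding_number g s * residue ?f s = 0"
    proof
      fix s assume s: "s \<in> S0 \<inter> U - of_real ` A"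
      show "winding_number g s * residue ?f s = 0"
      proof (cases "is_pole F s")
        case False
        then obtain e where "e > 0" "?f holomorphic_on ball s e"
          using kernel_analytic[OF False, of y] by (auto simp: analytic_on_def)
        then have "residue ?f s = 0" by (intro residue_holo[of "ball s e"]) auto
        then show ?thesis by simp
      qed (use w0 s in auto)
    qed
  qed (use U in auto)
  also have "\<dots> = (\<Sum>\<rho>\<in>A. winding_number g (of_real \<rho>) * residue ?f (of_real \<rho>))"
    by (subst sum.reindex) (auto simp: inj_on_def)
  also have "\<dots> = (\<Sum>\<rho>\<in>A. pole_term F y \<rho>)"
    using A w1 residue_eq_pole_term by (intro sum.cong) auto
  finally show ?thesis .
qed

end

section \<open>Shifting the line of integration\<close>

text \<open>The margin d is chosen before x, which gives a bound on the shifted lines uniform in R.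
  Induction on the number of lattices: within the interval that avoids the first n of them, the
  centre is moved away from the nearest point of the next one, and the interval is shrunk. The sign
  in - b j arises because u stands for Re w = - Re s.\<close>

lemma avoid_lattices:
  fixes a b :: "nat \<Rightarrow> real"
  assumes "\<forall>j\<in>{1..n}. a j \<noteq> 0" "L > 0"
  shows "\<exists>d>0. \<forall>x. \<exists>x'. x - L \<le> x' - d \<and> x' + d \<le> x + L \<and>
     (\<forall>u. \<bar>u - x'\<bar> \<le> d \<longrightarrow> (\<forall>j\<in>{1..n}. \<forall>m::int. d \<le> \<bar>a j * u - b j - of_int m\<bar>))"
  using assms(1)
proof (induction n)
  case 0
  show ?case by (rule exI[of _ L]) (use assms(2) in auto)
next
  case (Suc n)
  then obtain d where d: "d > 0" "\<And>x. \<exists>x'. x - L \<le> x' - d \<and> x' + d \<le> x + L \<and>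
     (\<forall>u. \<bar>u - x'\<bar> \<le> d \<longrightarrow> (\<forall>j\<in>{1..n}. \<forall>m::int. d \<le> \<bar>a j * u - b j - of_int m\<bar>))"
    by force
  define \<alpha> \<beta> where "\<alpha> = a (Suc n)" and "\<beta> = b (Suc n)"
  have \<alpha>: "\<alpha> \<noteq> 0" using Suc.prems by (simp add: \<alpha>_def)
  \<comment> \<open>The second bound keeps the displacement small compared with the spacing 1 /
    |\<alpha>| of the new lattice.\<close>
  define d0 where "d0 = min d (1 / (4 * \<bar>\<alpha>\<bar>))"
  have "\<bar>\<alpha>\<bar> * d0 \<le> \<bar>\<alpha>\<bar> * (1 / (4 * \<bar>\<alpha>\<bar>))"
    unfolding d0_def by (intro mult_left_mono) auto
  then have d0: "d0 > 0" "d0 \<le> d" "\<bar>\<alpha>\<bar> * d0 \<le> 1/4"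
    using d \<alpha> by (auto simp: d0_def)
  define d' where "d' = min (d0 / 4) (\<bar>\<alpha>\<bar> * d0 / 4)"
  have d': "d' > 0" "d' \<le> d0 / 4" "d' \<le> \<bar>\<alpha>\<bar> * d0 / 4" using d0 \<alpha> by (auto simp: d'_def)
  have "\<exists>x'. x - L \<le> x' - d' \<and> x' + d' \<le> x + L \<and>
     (\<forall>u. \<bar>u - x'\<bar> \<le> d' \<longrightarrow> (\<forall>j\<in>{1..Suc n}. \<forall>m::int. d' \<le> \<bar>a j * u - b j - of_int m\<bar>))" for x
  proof -
    obtain x1 where x1: "x - L \<le> x1 - d" "x1 + d \<le> x + L"
      "\<And>u j m. \<bar>u - x1\<bar> \<le> d \<Longrightarrow> j \<in> {1..n} \<Longrightarrow> d \<le> \<bar>a j * u - b j - of_int m\<bar>"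
      using d(2)[of x] by blast
    define k where "k = round (\<alpha> * x1 - \<beta>)"
    define e where "e = \<alpha> * x1 - \<beta> - of_int k"
    have e: "\<bar>e\<bar> \<le> 1/2" using of_int_round_abs_le[of "\<alpha> * x1 - \<beta>"] by (simp add: e_def k_def abs_minus_commute)
    \<comment> \<open>The direction is such that \<alpha> \<tau> has the sign of e: moving along
      \<tau> increases the distance from the nearest integer k.\<close>
    define \<tau> :: real where "\<tau> = (if e \<ge> 0 then 1 else -1) * sgn \<alpha>"
    define x2 where "x2 = x1 + \<tau> * (d0 / 2)"
    have "\<bar>\<tau>\<bar> = 1" using \<alpha> by (simp add: \<tau>_def abs_mult sgn_if)
    then have x21: "\<bar>x2 - x1\<bar> \<le> d0 / 2" using d0 by (simp add: x2_def abs_mult)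
    define q where "q = \<bar>\<alpha>\<bar> * d0 / 2"
    have q: "0 < q" using d0 \<alpha> by (simp add: q_def)
    have q8: "q \<le> 1/8" unfolding q_def using d0 by linarith
    \<comment> \<open>The displaced offset has modulus |e| + q, between q and 5/8, so it is at least
      q away from 0 and at least 3/8 away from every other integer.\<close>
    have far: "q \<le> \<bar>\<alpha> * x2 - \<beta> - of_int m\<bar>" for m :: int
    proof -
      have eq: "\<alpha> * x2 - \<beta> - of_int m = e + (if e \<ge> 0 then 1 else -1) * q - of_int (m - k)"
        by (simp add: x2_def \<tau>_def e_def q_def algebra_simps abs_sgn)
      have "m - k \<le> -1 \<or> m - k = 0 \<or> m - k \<ge> 1" by linarith
      then have "real_of_int (m - k) \<le> -1 \<or> real_of_int (m - k) = 0 \<or> real_of_int (m - k) \<ge> 1"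
        by linarith
      then show ?thesis unfolding eq using q q8 e by (auto simp: abs_if)
    qed
    have "d' \<le> \<bar>a j * u - b j - of_int m\<bar>" if u: "\<bar>u - x2\<bar> \<le> d'" and j: "j \<in> {1..Suc n}" for u j and m :: int
    proof (cases "j = Suc n")
      case True
      have "\<bar>\<alpha> * u - \<alpha> * x2\<bar> = \<bar>\<alpha>\<bar> * \<bar>u - x2\<bar>" by (simp add: abs_mult flip: right_diff_distrib)
      also have "\<dots> \<le> \<bar>\<alpha>\<bar> * (d0 / 4)" using u d' by (intro mult_left_mono) auto
      finally have "\<bar>\<alpha> * u - \<alpha> * x2\<bar> \<le> q / 2" by (simp add: q_def)
      moreover have "d' \<le> q / 2" using d' by (simp add: q_def)
      ultimately have "d' \<le> \<bar>\<alpha> * u - \<beta> - of_int m\<bar>" using far[of m] by linarith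
      then show ?thesis using True by (simp add: \<alpha>_def \<beta>_def)
    next
      case False
      then have "j \<in> {1..n}" using j by auto
      moreover have "\<bar>u - x1\<bar> \<le> d" using u x21 d' d0 by linarith
      ultimately have "d \<le> \<bar>a j * u - b j - of_int m\<bar>" using x1(3) by blast
      then show ?thesis using d' d0 by linarith
    qed
    moreover have "x - L \<le> x2 - d'" "x2 + d' \<le> x + L" using x1 x21 d' d0 by linarith+
    ultimately show ?thesis by blast
  qed
  then show ?case using d'(1) by blast
qed

lemma contour_integral_rectpath:
  assumes "continuous_on (path_image (rectpath p q)) f" "Re p \<le> Re q" "Im p \<le> Im q"
  shows "contour_integral (rectpath p q) f =
     contour_integral (linepath p (Complex (Re q) (Im p))) f + contour_integral (linepath (Complex (Re q) (Im p)) q) f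
   + contour_integral (linepath q (Complex (Re p) (Im q))) f + contour_integral (linepath (Complex (Re p) (Im q)) p) f"
proof -
  have im: "path_image (rectpath p q) = closed_segment p (Complex (Re q) (Im p)) \<union> closed_segment (Complex (Re q) (Im p)) q
     \<union> closed_segment q (Complex (Re p) (Im q)) \<union> closed_segment (Complex (Re p) (Im q)) p"
    by (simp add: rectpath_def Let_def path_image_join Un_assoc)
  have i: "f contour_integrable_on linepath p (Complex (Re q) (Im p))" "f contour_integrable_on linepath (Complex (Re q) (Im p)) q"
    "f contour_integrable_on linepath q (Complex (Re p) (Im q))" "f contour_integrable_on linepath (Complex (Re p) (Im q)) p"
    by (rule contour_integrable_continuous_linepath, rule continuous_on_subset[OF assms(1)], use im in blast)+
  show ?thesis
    unfolding rectpath_def Let_def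
    using i by (simp add: contour_integrable_joinI)
qed

text \<open>The majorant has integral B * pi over the whole line, so the bound does not depend on
  T.\<close>

lemma norm_integral_le_arctan:
  fixes f :: "real \<Rightarrow> complex"
  assumes "B \<ge> 0" "continuous_on {-T..T} f" "\<And>t. \<bar>t\<bar> \<le> T \<Longrightarrow> norm (f t) \<le> B / (1 + t\<^sup>2)"
  shows "norm (integral {-T..T} f) \<le> B * pi"
proof (cases "T \<ge> 0")
  case True
  have nz: "1 + t\<^sup>2 \<noteq> 0" for t :: real by (smt (verit) zero_le_power2)
  have "((\<lambda>t. B / (1 + t\<^sup>2)) has_integral B * arctan T - B * arctan (-T)) {-T..T}"
    using True
    by (intro fundamental_theorem_of_calculus)
      (auto intro!: derivative_eq_intros simp: has_real_derivative_iff_has_vector_derivative[symmetric] nz field_simps)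
  then have hi: "((\<lambda>t. B / (1 + t\<^sup>2)) has_integral 2 * B * arctan T) {-T..T}"
    by (simp add: arctan_minus mult.assoc)
  have "norm (integral {-T..T} f) \<le> integral {-T..T} (\<lambda>t. B / (1 + t\<^sup>2))"
    using assms by (intro integral_norm_bound_integral integrable_continuous_real has_integral_integrable[OF hi]) auto
  also have "\<dots> = 2 * B * arctan T" using hi by (rule integral_unique)
  also have "\<dots> \<le> B * pi"
    using arctan_ubound[of T] mult_left_mono[of "2 * arctan T" pi B] assms(1) by (simp add: algebra_simps)
  finally show ?thesis .
qed (use assms(1) in simp)

section \<open>The rectangular contour and the convergence of the pole sum\<close>

context gamma_type_params
begin

lemma kernel_continuous_on:
  assumes "A \<inter> S0 = {}"
  shows "continuous_on A (\<lambda>s. F s * exp (- of_real y * s))"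
  using assms kernel_analytic pole_in_S0
  by (intro holomorphic_on_imp_continuous_on analytic_imp_holomorphic) (subst analytic_on_analytic_at, blast)

lemma exp_le_inverse_square:
  assumes "\<eta> > 0"
  obtains A where "A > 0" "\<forall>t::real. exp (- \<eta> * \<bar>t\<bar>) \<le> A / (1 + t\<^sup>2)"
proof -
  obtain A where A: "A > 0" "\<And>t. t \<ge> 0 \<Longrightarrow> (1 + t) powr 2 \<le> A * exp (\<eta> * t)"
    by (rule poly_le_exp[OF assms, of 2]) auto
  show ?thesis
  proof (rule that[OF A(1)], rule allI)
    fix t :: real
    have "1 + t\<^sup>2 \<le> (1 + \<bar>t\<bar>)\<^sup>2" by (simp add: power2_eq_square algebra_simps)
    also have "\<dots> \<le> A * exp (\<eta> * \<bar>t\<bar>)" using A(2)[of "\<bar>t\<bar>"] by (simp add: powr_numeral)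
    finally have "(1 + t\<^sup>2) * exp (- \<eta> * \<bar>t\<bar>) \<le> A * exp (\<eta> * \<bar>t\<bar>) * exp (- \<eta> * \<bar>t\<bar>)"
      by (intro mult_right_mono) auto
    also have "\<dots> = A" by (simp add: exp_minus)
    finally show "exp (- \<eta> * \<bar>t\<bar>) \<le> A / (1 + t\<^sup>2)"
      by (subst pos_le_divide_eq) (auto simp: mult.commute add_pos_nonneg)
  qed
qed

text \<open>Residue theorem for the rectangle with vertical sides Re s = -R and Re s = c and growing
  height: the horizontal sides vanish by \<open>quot_strip_bound\<close>, the right side gives 2 pi
  fy by \<open>inv\<close>, and the left side is at most B exp (y R) pi; dividing by 2 pi leaves the
  factor 1/2.\<close>

lemma shifted_contour_bound:
  assumes \<gamma>: "\<gamma> > 0"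
    and c: "complex_of_real c \<notin> S0" "\<And>\<rho>. is_pole F (of_real \<rho>) \<Longrightarrow> min 0 c \<le> \<rho> \<Longrightarrow> \<rho> \<le> max 0 c \<Longrightarrow> False"
    and inv: "(\<lambda>n. integral {-real n..real n} (\<lambda>t. F (Complex c t) * exp (- of_real y * Complex c t))) \<longlonglongrightarrow> 2 * pi * fy"
    and R: "-R < c" "\<And>s. Re s = -R \<Longrightarrow> s \<notin> S0"
    and B: "B \<ge> 0" "\<And>t. norm (F (Complex (-R) t)) \<le> B / (1 + t\<^sup>2)"
  shows "norm (fy - (\<Sum>\<rho>\<in>{\<rho>\<in>neg_poles F. - R < \<rho>}. pole_term F y \<rho>)) \<le> B * exp (y * R) / 2"
proof -
  let ?f = "\<lambda>s. F s * exp (- of_real y * s)"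
  define S where "S = (\<Sum>\<rho>\<in>{\<rho>\<in>neg_poles F. - R < \<rho>}. pole_term F y \<rho>)"
  obtain A T where A: "A \<ge> 0" "T \<ge> 0" "\<forall>s. -R \<le> Re s \<longrightarrow> Re s \<le> c \<longrightarrow> T \<le> \<bar>Im s\<bar> \<longrightarrow>
    norm (quot s) \<le> A * exp (- (pi * \<gamma> / 4) * \<bar>Im s\<bar>)"
    by (rule quot_strip_bound[OF \<gamma>])
  define Y where "Y = exp (\<bar>y\<bar> * (\<bar>R\<bar> + \<bar>c\<bar>))"
  define I where "I n = integral {-real n..real n} (\<lambda>t. ?f (Complex c t))" for n
  define E where "E n = 2 * (A * exp (- (pi * \<gamma> / 4) * real n) * Y * (c + R))" for n
  have main: "norm (2 * pi * S - I n) \<le> E n + B * exp (y * R) * pi" if n: "real n \<ge> max 1 T" for n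
  proof -
    define t where "t = real n"
    have t: "t \<ge> 1" "t \<ge> T" using n by (auto simp: t_def)
    define p q where "p = Complex (-R) (-t)" and "q = Complex c t"
    let ?U = "{s. - R - 1 < Re s} \<inter> {s. Re s < c + 1}"
    have pq: "Re p \<le> Re q" "Im p \<le> Im q" using R t by (auto simp: p_def q_def)
    \<comment> \<open>The points of \<open>S0\<close> are real and t \<ge> 1, so only the crossings
      of the vertical sides with the real axis have to be excluded.\<close>
    have im: "s \<notin> S0" "Re s \<in> {-R..c}" if "s \<in> path_image (rectpath p q)" for s
      using that S0_lattice(1)[of s] R(2)[of s] t c(1) R(1) unfolding path_image_rectpath[OF pq]
      by (auto simp: p_def q_def complex_eq_iff)
         (metis complex_surj complex_of_real_def)+
    have cont: "continuous_on (path_image (rectpath p q)) ?f"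
      using im by (intro kernel_continuous_on) auto
    have "contour_integral (rectpath p q) ?f = 2 * pi * \<i> * S"
      unfolding S_def
    proof (rule residue_sum[of ?U])
      show "open ?U" by (intro open_Int open_halfspace_Re_gt open_halfspace_Re_lt)
      show "connected ?U" by (intro convex_connected convex_Int convex_halfspace_Re_gt convex_halfspace_Re_lt)
      show "finite (S0 \<inter> ?U)" by (rule finite_subset[OF _ finite_S0_strip[of "-R-1" "c+1"]]) auto
      show "path_image (rectpath p q) \<subseteq> ?U - S0" using im by force
      show "winding_number (rectpath p q) z = 0" if "z \<notin> ?U" for z
        using that by (intro winding_number_rectpath_outside[OF pq]) (auto simp: in_cbox_complex_iff p_def q_def)
      \<comment> \<open>There is no pole between 0 and c, whichever is larger. So the poles inside
        the rectangle are exactly the negative ones beyond -R.\<close>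
      have neg: "\<rho> < c" if "\<rho> \<in> neg_poles F" for \<rho>
        using c(2)[of \<rho>] that by (force simp: neg_poles_def)
      show "winding_number (rectpath p q) (of_real \<rho>) = 1" if "\<rho> \<in> {\<rho>\<in>neg_poles F. - R < \<rho>}" for \<rho>
        using that neg t by (intro winding_number_rectpath) (auto simp: in_box_complex_iff p_def q_def)
      show "of_real ` {\<rho>\<in>neg_poles F. - R < \<rho>} \<subseteq> ?U" using neg by force
      show "winding_number (rectpath p q) s = 0"
        if s: "is_pole F s" "s \<in> ?U" "s \<notin> of_real ` {\<rho>\<in>neg_poles F. - R < \<rho>}" for s
      proof (rule winding_number_rectpath_outside[OF pq])
        have sr: "s = of_real (Re s)" using pole_real[OF s(1)] .
        then have "is_pole F (of_real (Re s))" using s(1) by simp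
        moreover have "Re s \<noteq> -R" using R(2) pole_in_S0[OF s(1)] by blast
        moreover have "\<not> (Re s \<in> neg_poles F \<and> - R < Re s)" using s(3) sr by blast
        ultimately have "Re s < -R \<or> Re s > c"
          using c(2)[of "Re s"] by (force simp: neg_poles_def)
        then show "s \<notin> cbox p q" by (auto simp: in_cbox_complex_iff p_def q_def)
      qed
    qed auto
    moreover have "contour_integral (rectpath p q) ?f =
      contour_integral (linepath p (Complex c (-t))) ?f + contour_integral (linepath (Complex c (-t)) q) ?f
      + contour_integral (linepath q (Complex (-R) t)) ?f + contour_integral (linepath (Complex (-R) t) p) ?f"
      using contour_integral_rectpath[OF cont pq] by (simp add: p_def q_def)
    moreover have "contour_integral (linepath (Complex c (-t)) q) ?f = \<i> * I n"
      unfolding I_def t_def[symmetric] using t by (subst contour_integral_linepath_same_Re[of _ c _ "-t" t]) (auto simp: q_def)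
    moreover have "contour_integral (linepath (Complex (-R) t) p) ?f = - (\<i> * integral {-t..t} (\<lambda>t. ?f (Complex (-R) t)))"
    proof -
      have "closed_segment (Complex (-R) t) p \<subseteq> {s. Re s = -R}"
        using closed_segment_same_Re[of "Complex (-R) t" p] by (auto simp: p_def)
      then have "contour_integral (linepath (Complex (-R) t) p) ?f = - contour_integral (linepath p (Complex (-R) t)) ?f"
        using R(2) by (intro contour_integral_reverse_linepath kernel_continuous_on) auto
      then show ?thesis
        using t by (subst (asm) contour_integral_linepath_same_Re[of _ "-R" _ "-t" t]) (auto simp: p_def)
    qed
    ultimately have eq: "2 * pi * \<i> * S = contour_integral (linepath p (Complex c (-t))) ?f + \<i> * I n
      + contour_integral (linepath q (Complex (-R) t)) ?f - \<i> * integral {-t..t} (\<lambda>t. ?f (Complex (-R) t))" by simp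
    have hb: "norm (?f s) \<le> A * exp (- (pi * \<gamma> / 4) * t) * Y" if s: "Re s \<in> {-R..c}" "\<bar>Im s\<bar> = t" for s
    proof -
      have "F s = quot s" using S0_lattice(1)[of s] s t by (intro F_eq_quot) auto
      then have 1: "norm (F s) \<le> A * exp (- (pi * \<gamma> / 4) * t)" using A(3)[rule_format, of s] s t by simp
      have "- (y * Re s) \<le> \<bar>y\<bar> * \<bar>Re s\<bar>" by (metis abs_ge_minus_self abs_mult)
      also have "\<dots> \<le> \<bar>y\<bar> * (\<bar>R\<bar> + \<bar>c\<bar>)" using s by (intro mult_left_mono) auto
      finally have "norm (exp (- of_real y * s)) \<le> Y" by (simp add: Y_def)
      with 1 show ?thesis unfolding norm_mult using A by (intro mult_mono) auto
    qed
    have seg1: "s \<in> closed_segment p (Complex c (-t)) \<Longrightarrow> Re s \<in> {-R..c} \<and> \<bar>Im s\<bar> = t"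
      and seg2: "s \<in> closed_segment q (Complex (-R) t) \<Longrightarrow> Re s \<in> {-R..c} \<and> \<bar>Im s\<bar> = t" for s
      using closed_segment_same_Im[of p "Complex c (-t)"] closed_segment_same_Im[of q "Complex (-R) t"] t R(1)
      by (auto simp: p_def q_def closed_segment_eq_real_ivl)
    have nS: "s \<notin> S0" if "\<bar>Im s\<bar> = t" for s using S0_lattice(1)[of s] that t by auto
    have "norm (contour_integral (linepath p (Complex c (-t))) ?f) \<le> A * exp (- (pi * \<gamma> / 4) * t) * Y * norm (Complex c (-t) - p)"
      using A seg1 nS hb
      by (intro contour_integral_bound_linepath contour_integrable_continuous_linepath kernel_continuous_on) (auto simp: Y_def)
    also have "norm (Complex c (-t) - p) = c + R" using R(1) by (simp add: p_def cmod_def)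
    finally have b1: "norm (contour_integral (linepath p (Complex c (-t))) ?f) \<le> E n / 2"
      using R by (simp add: E_def t_def)
    have "norm (contour_integral (linepath q (Complex (-R) t)) ?f) \<le> A * exp (- (pi * \<gamma> / 4) * t) * Y * norm (Complex (-R) t - q)"
      using A seg2 nS hb
      by (intro contour_integral_bound_linepath contour_integrable_continuous_linepath kernel_continuous_on) (auto simp: Y_def)
    also have "norm (Complex (-R) t - q) = c + R" using R(1) by (simp add: q_def cmod_def)
    finally have b2: "norm (contour_integral (linepath q (Complex (-R) t)) ?f) \<le> E n / 2"
      using R by (simp add: E_def t_def)
    have b3: "norm (integral {-t..t} (\<lambda>t. ?f (Complex (-R) t))) \<le> B * exp (y * R) * pi"
    proof (rule norm_integral_le_arctan)
      show "0 \<le> B * exp (y * R)" using B by simp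
      have "continuous_on {-t..t} (\<lambda>t. ((\<lambda>s. ?f s) \<circ> (\<lambda>t. Complex (-R) t)) t)"
        unfolding o_def[symmetric] using R(2)
        by (intro continuous_on_compose kernel_continuous_on continuous_intros) auto
      then show "continuous_on {-t..t} (\<lambda>t. ?f (Complex (-R) t))" by (simp add: o_def)
      fix u
      have "norm (?f (Complex (-R) u)) \<le> B / (1 + u\<^sup>2) * exp (y * R)"
        unfolding norm_mult using B(2)[of u] order_trans[OF norm_ge_zero B(2)[of u]] by (intro mult_mono) (auto simp: norm_exp_eq_Re)
      then show "norm (?f (Complex (-R) u)) \<le> B * exp (y * R) / (1 + u\<^sup>2)" by simp
    qed
    have "2 * pi * S - I n = (contour_integral (linepath p (Complex c (-t))) ?f + contour_integral (linepath q (Complex (-R) t)) ?f) / \<i>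
       - integral {-t..t} (\<lambda>t. ?f (Complex (-R) t))"
    proof -
      have "X * S - I = (P + Q) / \<i> - W" if "X * \<i> * S = P + \<i> * I + Q - \<i> * W" for X P Q I W :: complex
      proof -
        have "(X * S - I + W) * \<i> = P + Q" using that by (simp add: algebra_simps)
        then have "X * S - I + W = (P + Q) / \<i>" by (metis complex_i_not_zero nonzero_mult_div_cancel_right)
        then show ?thesis by (simp add: algebra_simps)
      qed
      from this[OF eq] show ?thesis .
    qed
    then have "norm (2 * pi * S - I n) \<le> norm (contour_integral (linepath p (Complex c (-t))) ?f) + norm (contour_integral (linepath q (Complex (-R) t)) ?f)
       + norm (integral {-t..t} (\<lambda>t. ?f (Complex (-R) t)))"
      using norm_triangle_ineq4 norm_triangle_ineq by (smt (verit) norm_divide norm_ii div_by_1)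
    then show ?thesis using b1 b2 b3 by linarith
  qed
  have "(\<lambda>n. norm (2 * pi * S - I n)) \<longlonglongrightarrow> norm (2 * pi * S - 2 * pi * fy)"
    using inv unfolding I_def by (intro tendsto_intros)
  moreover have "(\<lambda>n. E n + B * exp (y * R) * pi) \<longlonglongrightarrow> 2 * (A * 0 * Y * (c + R)) + B * exp (y * R) * pi"
  proof -
    have "(\<lambda>n. exp (- e * real n)) \<longlonglongrightarrow> 0" if "e > 0" for e :: real
      using that by real_asymp
    from this[of "pi * \<gamma> / 4"] have "(\<lambda>n. exp (- (pi * \<gamma> / 4) * real n)) \<longlonglongrightarrow> 0" using \<gamma> by simp
    then show ?thesis unfolding E_def by (intro tendsto_intros)
  qed
  moreover have "\<forall>\<^sub>F n in sequentially. norm (2 * pi * S - I n) \<le> E n + B * exp (y * R) * pi"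
    using eventually_ge_at_top[of "nat \<lceil>max 1 T\<rceil>"] by eventually_elim (rule main, linarith)
  ultimately have "norm (2 * pi * S - 2 * pi * fy) \<le> 2 * (A * 0 * Y * (c + R)) + B * exp (y * R) * pi"
    by (intro tendsto_le) auto
  moreover have "norm (2 * pi * S - 2 * pi * fy) = 2 * pi * norm (fy - S)"
    by (simp add: norm_mult norm_minus_commute flip: right_diff_distrib)
  ultimately have "norm (fy - S) \<le> B * exp (y * R) / 2" by simp
  then show ?thesis by (simp add: S_def)
qed

lemma left_bound_tendsto_0:
  assumes "\<gamma>' > 0 \<or> (\<gamma>' = 0 \<and> y < \<kappa>)"
  shows "((\<lambda>R. left_bound R * exp (y * R)) \<longlongrightarrow> 0) at_top"
  using assms
proof
  assume g: "\<gamma>' > 0"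
  have "((\<lambda>R. exp (- g * (R * (ln R - 1)) - k * R + b * ln R + y * R)) \<longlongrightarrow> 0) at_top" if "g > 0" for g k b :: real
    using that by real_asymp
  from this[OF g] show ?thesis unfolding exp_add[symmetric] .
next
  assume g: "\<gamma>' = 0 \<and> y < \<kappa>"
  define \<epsilon> where "\<epsilon> = \<kappa> - y"
  have "\<epsilon> > 0" using g by (simp add: \<epsilon>_def)
  have "((\<lambda>R. exp (b * ln R - e * R)) \<longlongrightarrow> 0) at_top" if "e > 0" for b e :: real
    using that by real_asymp
  from this[OF \<open>\<epsilon> > 0\<close>, of "\<bar>\<beta>\<bar>"] show ?thesis using g unfolding exp_add[symmetric] by (simp add: \<epsilon>_def algebra_simps)
qed

text \<open>The sequence R is only known to keep its distance from genuine poles, whereas the bound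
  on the shifted line needs distance from all numerator lattices. Replacing R by a nearby R' does
  not change the partial sums.\<close>

lemma pole_sum_converges:
  assumes \<gamma>: "\<gamma> > 0"
    and c: "complex_of_real c \<notin> S0" "\<And>\<rho>. is_pole F (of_real \<rho>) \<Longrightarrow> min 0 c \<le> \<rho> \<Longrightarrow> \<rho> \<le> max 0 c \<Longrightarrow> False"
    and inv: "(\<lambda>n. integral {-real n..real n} (\<lambda>t. F (Complex c t) * exp (- of_real y * Complex c t))) \<longlonglongrightarrow> 2 * pi * fy"
    and g: "\<gamma>' > 0 \<or> (\<gamma>' = 0 \<and> y < \<kappa>)"
  shows "has_outward_sum (neg_poles F) (pole_term F y) fy"
  unfolding has_outward_sum_def
proof (intro allI impI, elim conjE)
  fix \<delta> :: real and R :: "nat \<Rightarrow> real"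
  assume \<delta>: "\<delta> > 0" and R: "filterlim R at_top sequentially"
    and sep: "\<forall>n. \<forall>\<rho>\<in>neg_poles F. \<delta> \<le> \<bar>\<rho> - (- R n)\<bar>"
  obtain d where d: "d > 0" and ex: "\<And>x. \<exists>x'. x - \<delta>/2 \<le> x' - d \<and> x' + d \<le> x + \<delta>/2 \<and>
     (\<forall>u. \<bar>u - x'\<bar> \<le> d \<longrightarrow> (\<forall>j\<in>{1..J}. \<forall>m::int. d \<le> \<bar>a j * u - b j - of_int m\<bar>))"
    using avoid_lattices[OF a_nz, of "\<delta>/2" b] \<delta> by auto
  \<comment> \<open>R' differs from R by less than \<delta>/2, and no pole is closer than \<delta>
    to -R, so no pole lies between -R and -R'.\<close>
  from ex[of "R _"] obtain R' where R': "\<And>n. R n - \<delta>/2 \<le> R' n - d" "\<And>n. R' n + d \<le> R n + \<delta>/2"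
     "\<And>n. \<forall>u. \<bar>u - R' n\<bar> \<le> d \<longrightarrow> (\<forall>j\<in>{1..J}. \<forall>m::int. d \<le> \<bar>a j * u - b j - of_int m\<bar>)"
    by metis
  have far: "\<forall>j\<in>{1..J}. \<forall>m::int. d \<le> \<bar>a j * R' n - b j - of_int m\<bar>" for n
    using R'(3)[of n] d by simp
  have R'top: "filterlim R' at_top sequentially"
  proof (rule filterlim_at_top_mono)
    show "filterlim (\<lambda>n. - (\<delta>/2) + R n) at_top sequentially"
      by (rule filterlim_tendsto_add_at_top[OF tendsto_const R])
    show "\<forall>\<^sub>F n in sequentially. - (\<delta>/2) + R n \<le> R' n"
    proof (intro always_eventually allI)
      fix n show "- (\<delta>/2) + R n \<le> R' n" using R'(1)[of n] d by linarith
    qed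
  qed
  have same: "{\<rho>\<in>neg_poles F. - R n < \<rho>} = {\<rho>\<in>neg_poles F. - R' n < \<rho>}" for n
  proof -
    have "- R n < \<rho> \<longleftrightarrow> - R' n < \<rho>" if "\<rho> \<in> neg_poles F" for \<rho>
      using sep[rule_format, OF that, of n] R'(1,2)[of n] d \<delta> by linarith
    then show ?thesis by blast
  qed
  have \<gamma>0: "\<gamma>' \<ge> 0" using g by auto
  obtain A x0 where A: "x0 \<ge> 1" "A \<ge> 0"
    "\<forall>w. Re w \<ge> x0 \<longrightarrow> (\<forall>j\<in>{1..J}. \<forall>m::int. d \<le> \<bar>a j * Re w - b j - of_int m\<bar>) \<longrightarrow>
     norm (quot (-w)) \<le> A * left_bound (Re w)
        * exp (- (pi * \<gamma> / 4) * \<bar>Im w\<bar>)"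
    by (rule quot_left_bound[OF d \<gamma> \<gamma>0])
  have e: "pi * \<gamma> / 4 > 0" using \<gamma> by simp
  obtain A2 where A2: "A2 > 0" "\<forall>t::real. exp (- (pi * \<gamma> / 4) * \<bar>t\<bar>) \<le> A2 / (1 + t\<^sup>2)"
    by (rule exp_le_inverse_square[OF e])
  define h where "h r = left_bound r" for r
  have bound: "norm ((\<Sum>\<rho>\<in>{\<rho>\<in>neg_poles F. - R n < \<rho>}. pole_term F y \<rho>) - fy) \<le> A * A2 / 2 * (h (R' n) * exp (y * R' n))"
    if n: "R' n \<ge> x0" "R' n > - c" for n
  proof -
    have nS: "s \<notin> S0" if "Re s = - R' n" for s
    proof
      assume "s \<in> S0"
      then obtain j m where jm: "j \<in> {1..J}" "a j * Re s + b j = of_int m" using S0_lattice(2) by blast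
      have "d \<le> \<bar>a j * R' n - b j - of_int (- m)\<bar>" using far jm(1) by blast
      moreover have "a j * R' n - b j - of_int (- m) = 0" using jm(2) that by simp
      ultimately show False using d by simp
    qed
    have "norm (F (Complex (- R' n) t)) \<le> (A * h (R' n) * A2) / (1 + t\<^sup>2)" for t
    proof -
      \<comment> \<open>The bound to the left is stated in w = - s, so the imaginary part changes
        sign as well.\<close>
      have "- Complex (R' n) (- t) = Complex (- R' n) t" by (simp add: complex_eq_iff)
      then have "F (Complex (- R' n) t) = quot (- Complex (R' n) (- t))"
        using F_eq_quot[OF nS[of "Complex (- R' n) t"]] by simp
      then have "norm (F (Complex (- R' n) t)) \<le> A * h (R' n) * exp (- (pi * \<gamma> / 4) * \<bar>t\<bar>)"
        using A(3)[rule_format, of "Complex (R' n) (- t)"] n far by (simp add: h_def)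
      also have "\<dots> \<le> A * h (R' n) * (A2 / (1 + t\<^sup>2))"
        using A(2) A2(2)[rule_format, of t] by (intro mult_left_mono) (auto simp: h_def)
      finally show ?thesis by simp
    qed
    then have "norm (fy - (\<Sum>\<rho>\<in>{\<rho>\<in>neg_poles F. - R' n < \<rho>}. pole_term F y \<rho>)) \<le> (A * h (R' n) * A2) * exp (y * R' n) / 2"
      using n nS A A2 by (intro shifted_contour_bound[OF \<gamma> c inv]) (auto simp: h_def)
    then show ?thesis by (simp add: same norm_minus_commute mult_ac)
  qed
  have "(\<lambda>n. (\<Sum>\<rho>\<in>{\<rho>\<in>neg_poles F. - R n < \<rho>}. pole_term F y \<rho>) - fy) \<longlonglongrightarrow> 0"
  proof (rule Lim_null_comparison)
    have "\<forall>\<^sub>F n in sequentially. R' n \<ge> x0" "\<forall>\<^sub>F n in sequentially. R' n > - c"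
      using eventually_compose_filterlim[OF eventually_ge_at_top R'top, of x0]
        eventually_compose_filterlim[OF eventually_gt_at_top R'top, of "- c"] by simp_all
    then show "\<forall>\<^sub>F n in sequentially. norm ((\<Sum>\<rho>\<in>{\<rho>\<in>neg_poles F. - R n < \<rho>}. pole_term F y \<rho>) - fy)
        \<le> A * A2 / 2 * (h (R' n) * exp (y * R' n))"
      by eventually_elim (rule bound)
    have "((\<lambda>r. A * A2 / 2 * (h r * exp (y * r))) \<longlongrightarrow> A * A2 / 2 * 0) at_top"
      unfolding h_def by (intro tendsto_mult tendsto_const left_bound_tendsto_0 g)
    from filterlim_compose[OF this R'top]
    show "(\<lambda>n. A * A2 / 2 * (h (R' n) * exp (y * R' n))) \<longlonglongrightarrow> 0" by simp
  qed
  then show "(\<lambda>n. \<Sum>\<rho>\<in>{\<rho>\<in>neg_poles F. - R n < \<rho>}. pole_term F y \<rho>) \<longlonglongrightarrow> fy"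
    by (rule Lim_null[THEN iffD2])
qed

end

section \<open>Mellin inversion\<close>

text \<open>With h = w - s0, the series of exp (h Y) is integrated termwise. All partial sums of the
  moduli are dominated by \<open>g\<close>, since exp (|h| |Y|) \<le> exp (|h| Y) + exp (- |h| Y);
  both exponents Re s0 + |h| and Re s0 - |h| stay in the strip.\<close>

lemma exp_moment_holomorphic:
  fixes Y :: "'w \<Rightarrow> real"
  assumes [measurable]: "Y \<in> borel_measurable M"
    and int: "\<And>x. lo < x \<Longrightarrow> x < hi \<Longrightarrow> integrable M (\<lambda>\<omega>. exp (x * Y \<omega>))"
  shows "(\<lambda>s. \<integral>\<omega>. exp (s * of_real (Y \<omega>)) \<partial>M) holomorphic_on ({s. lo < Re s} \<inter> {s. Re s < hi})"
proof -
  let ?m = "\<lambda>s::complex. \<integral>\<omega>. exp (s * of_real (Y \<omega>)) \<partial>M"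
  have "?m analytic_on {s0}" if s0: "lo < Re s0" "Re s0 < hi" for s0
  proof -
    define r where "r = min (Re s0 - lo) (hi - Re s0)"
    have r: "r > 0" using s0 by (simp add: r_def)
    define a where "a n = (\<integral>\<omega>. exp (s0 * of_real (Y \<omega>)) * (of_real (Y \<omega>) ^ n / fact n) \<partial>M)" for n
    have "?m holomorphic_on ball s0 r"
    proof (rule power_series_holomorphic[where a = a])
      fix w assume "w \<in> ball s0 r"
      define h where "h = w - s0"
      have h: "norm h < r" using \<open>w \<in> ball s0 r\<close> by (simp add: h_def dist_norm norm_minus_commute)
      define f where "f n \<omega> = exp (s0 * of_real (Y \<omega>)) * ((h * of_real (Y \<omega>)) ^ n / fact n)" for n \<omega>
      define g where "g \<omega> = exp ((Re s0 + norm h) * Y \<omega>) + exp ((Re s0 - norm h) * Y \<omega>)" for \<omega>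
      have g: "integrable M g"
        proof -
        have "lo < Re s0 + norm h" "Re s0 + norm h < hi" "lo < Re s0 - norm h" "Re s0 - norm h < hi"
          using h s0 norm_ge_zero[of h] unfolding r_def by linarith+
        then show ?thesis unfolding g_def by (intro Bochner_Integration.integrable_add int)
      qed
      have sums: "(\<lambda>n. f n \<omega>) sums exp (w * of_real (Y \<omega>))" for \<omega>
      proof -
        have "(\<lambda>n. (h * of_real (Y \<omega>)) ^ n /\<^sub>R fact n) sums exp (h * of_real (Y \<omega>))" by (rule exp_converges)
        from sums_mult[OF this, of "exp (s0 * of_real (Y \<omega>))"]
        have "(\<lambda>n. f n \<omega>) sums (exp (s0 * of_real (Y \<omega>)) * exp (h * of_real (Y \<omega>)))"
          by (simp add: f_def scaleR_conv_of_real divide_inverse mult_ac)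
        then show ?thesis by (simp add: h_def algebra_simps flip: exp_add)
      qed
      have nf: "norm (f n \<omega>) = exp (Re s0 * Y \<omega>) * ((norm h * \<bar>Y \<omega>\<bar>) ^ n / fact n)" for n \<omega>
        by (simp add: f_def norm_mult norm_divide norm_power norm_exp_eq_Re power_mult_distrib)
      have nsums: "(\<lambda>n. norm (f n \<omega>)) sums (exp (Re s0 * Y \<omega>) * exp (norm h * \<bar>Y \<omega>\<bar>))" for \<omega>
        unfolding nf using exp_converges[of "norm h * \<bar>Y \<omega>\<bar>"]
        by (intro sums_mult) (simp add: divide_inverse mult_ac)
      have le_g: "exp (Re s0 * Y \<omega>) * exp (norm h * \<bar>Y \<omega>\<bar>) \<le> g \<omega>" for \<omega>
        by (cases "Y \<omega> \<ge> 0") (auto simp: g_def algebra_simps add_increasing add_increasing2 simp flip: exp_add)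
      have partial: "(\<Sum>i<n. norm (f i \<omega>)) \<le> g \<omega>" for n \<omega>
        using sum_le_suminf[OF sums_summable[OF nsums[of \<omega>]], of "{..<n}"] sums_unique[OF nsums[of \<omega>]] le_g[of \<omega>]
        by simp
      have fint: "integrable M (f n)" for n
      proof (rule Bochner_Integration.integrable_bound[OF g])
        show "f n \<in> borel_measurable M" unfolding f_def by measurable
        show "AE \<omega> in M. norm (f n \<omega>) \<le> norm (g \<omega>)"
        proof (rule AE_I2)
          fix \<omega>
          have "norm (f n \<omega>) \<le> (\<Sum>i<Suc n. norm (f i \<omega>))" by (simp add: sum_nonneg)
          also have "\<dots> \<le> g \<omega>" by (rule partial)
          finally show "norm (f n \<omega>) \<le> norm (g \<omega>)" by simp
        qed
      qed
      have "(\<lambda>n. integral\<^sup>L M (f n)) sums (\<integral>\<omega>. (\<Sum>n. f n \<omega>) \<partial>M)"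
      proof (rule sums_integral[OF fint])
        show "AE \<omega> in M. summable (\<lambda>n. norm (f n \<omega>))" using nsums by (auto simp: sums_iff)
        show "summable (\<lambda>n. \<integral>\<omega>. norm (f n \<omega>) \<partial>M)"
        proof (rule summableI_nonneg_bounded)
          fix n
          have "(\<Sum>i<n. \<integral>\<omega>. norm (f i \<omega>) \<partial>M) = (\<integral>\<omega>. (\<Sum>i<n. norm (f i \<omega>)) \<partial>M)"
            using fint by (subst Bochner_Integration.integral_sum) auto
          also have "\<dots> \<le> integral\<^sup>L M g"
            using fint partial g by (intro integral_mono) auto
          finally show "(\<Sum>i<n. \<integral>\<omega>. norm (f i \<omega>) \<partial>M) \<le> integral\<^sup>L M g" .
        qed simp
      qed
      moreover have "(\<Sum>n. f n \<omega>) = exp (w * of_real (Y \<omega>))" for \<omega> using sums by (simp add: sums_iff)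
      moreover have "integral\<^sup>L M (f n) = a n * (w - s0) ^ n" for n
      proof -
        have "f n = (\<lambda>\<omega>. (exp (s0 * of_real (Y \<omega>)) * (of_real (Y \<omega>) ^ n / fact n)) * h ^ n)"
          by (simp add: fun_eq_iff f_def power_mult_distrib mult_ac)
        then show ?thesis by (simp add: a_def h_def)
      qed
      ultimately show "(\<lambda>n. a n * (w - s0) ^ n) sums ?m w" by simp
    qed
    then show ?thesis using r unfolding analytic_on_def by auto
  qed
  then have "?m analytic_on ({s. lo < Re s} \<inter> {s. Re s < hi})" by (subst analytic_on_analytic_at) auto
  then show ?thesis by (rule analytic_imp_holomorphic)
qed

section \<open>Recovering a continuous density from transforms and masses of intervals\<close>

lemma distributed_measure_Icc:
  fixes f :: "real \<Rightarrow> real"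
  assumes "prob_space M" "distributed M lborel Z (\<lambda>x. ennreal (f x))"
    and f: "continuous_on {p..q} f" "\<And>x. x \<in> {p..q} \<Longrightarrow> 0 \<le> f x"
  shows "measure M {\<omega> \<in> space M. Z \<omega> \<in> {p..q}} = integral {p..q} f"
proof -
  have "(f has_integral integral {p..q} f) {p..q}"
    using f by (intro integrable_integral integrable_continuous_real)
  then have "(\<integral>\<^sup>+x. ennreal (f x) * indicator {p..q} x \<partial>lborel) = ennreal (integral {p..q} f)"
    using f by (intro nn_integral_has_integral_lebesgue') auto
  moreover have "emeasure M (Z -` {p..q} \<inter> space M) = (\<integral>\<^sup>+x. ennreal (f x) * indicator {p..q} x \<partial>lborel)"
    using assms by (intro distributed_emeasure) auto
  moreover have "Z -` {p..q} \<inter> space M = {\<omega> \<in> space M. Z \<omega> \<in> {p..q}}" by auto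
  moreover have "integral {p..q} f \<ge> 0" using f by (intro integral_nonneg integrable_continuous_real) auto
  ultimately show ?thesis by (simp add: measure_def)
qed

lemma right_quotient_tendsto:
  assumes "(G has_real_derivative d) (at x within {x..x + 1})"
  shows "(\<lambda>k. (G (x + 1 / real (Suc k)) - G x) * real (Suc k)) \<longlonglongrightarrow> d"
proof -
  have "((\<lambda>z. (G z - G x) / (z - x)) \<longlongrightarrow> d) (at x within {x..x + 1})"
    using assms by (simp add: has_field_derivative_iff)
  moreover have "filterlim (\<lambda>k. x + 1 / real (Suc k)) (at x within {x..x + 1}) sequentially"
    unfolding filterlim_at
  proof
    show "\<forall>\<^sub>F k in sequentially. x + 1 / real (Suc k) \<in> {x..x + 1} \<and> x + 1 / real (Suc k) \<noteq> x"
      by (intro always_eventually allI) (auto simp: field_simps)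
    show "(\<lambda>k. x + 1 / real (Suc k)) \<longlonglongrightarrow> x"
      using tendsto_add[OF tendsto_const LIMSEQ_Suc[OF lim_1_over_n], of x] by simp
  qed
  ultimately have "(\<lambda>k. (G (x + 1 / real (Suc k)) - G x) / (x + 1 / real (Suc k) - x)) \<longlonglongrightarrow> d"
    by (rule filterlim_compose)
  then show ?thesis by (simp add: field_simps)
qed

lemma integrable_inverse_1_plus_square': "integrable lborel (\<lambda>t::real. B / (1 + t\<^sup>2))"
proof -
  have "integrable lborel (\<lambda>t::real. inverse (1 + t\<^sup>2))"
    using integrable_inverse_1_plus_square by (simp add: set_integrable_def einterval_def)
  then show ?thesis by (simp add: divide_inverse)
qed

text \<open>Levy's inversion formula gives the mass of the interval from y to y + 1 / (k + 1).
  Multiplying by k + 1 and letting k grow, the mass side tends to \<psi> y by continuity and the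
  integral side to the integral of \<open>g\<close> by dominated convergence. So the formula holds
  at every y, not just almost everywhere.\<close>

lemma (in real_distribution) density_from_char:
  fixes \<psi> :: "real \<Rightarrow> real"
  assumes M: "M = density lborel (\<lambda>y. ennreal (\<psi> y))" and \<psi>: "continuous_on UNIV \<psi>" "\<And>y. 0 \<le> \<psi> y"
    and B: "\<And>t. norm (char M t) \<le> B / (1 + t\<^sup>2)"
  shows "(\<lambda>n. integral {-real n..real n} (\<lambda>t. char M t * iexp (- (t * y)))) \<longlonglongrightarrow> 2 * pi * \<psi> y"
proof -
  have [measurable]: "\<psi> \<in> borel_measurable borel" using \<psi>(1) by (rule borel_measurable_continuous_onI)
  have meas_Icc: "measure M {p..q} = integral {p..q} \<psi>" for p q
  proof -
    have "(\<psi> has_integral integral {p..q} \<psi>) {p..q}"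
      using \<psi> by (intro integrable_integral integrable_continuous_real) (auto intro: continuous_on_subset)
    then have "(\<integral>\<^sup>+x. ennreal (\<psi> x) * indicator {p..q} x \<partial>lborel) = ennreal (integral {p..q} \<psi>)"
      using \<psi> by (intro nn_integral_has_integral_lebesgue') auto
    moreover have "integral {p..q} \<psi> \<ge> 0"
      using \<psi> by (intro integral_nonneg integrable_continuous_real) (auto intro: continuous_on_subset)
    moreover have "emeasure M {p..q} = (\<integral>\<^sup>+x. ennreal (\<psi> x) * indicator {p..q} x \<partial>lborel)"
      unfolding M by (rule emeasure_density) auto
    ultimately show ?thesis by (simp add: measure_def)
  qed
  have atom: "measure M {p} = 0" for p using meas_Icc[of p p] by simp
  have meas_Ioc: "measure M {p<..q} = integral {p..q} \<psi>" if "p \<le> q" for p q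
  proof -
    have "{p..q} = {p} \<union> {p<..q}" using that by auto
    then have "measure M {p..q} = measure M {p} + measure M {p<..q}"
      by (simp only:) (rule finite_measure_Union, auto)
    then show ?thesis using meas_Icc[of p q] atom by simp
  qed
  have ch: "continuous_on UNIV (char M)" using isCont_char by (simp add: continuous_on_eq_continuous_at)
  have trunc: "(\<lambda>n. \<integral>t. indicator {-real n..real n} t *\<^sub>R g t \<partial>lborel) \<longlonglongrightarrow> integral\<^sup>L lborel g"
    if g: "integrable lborel g" for g :: "real \<Rightarrow> complex"
  proof (rule integral_dominated_convergence[where w = "\<lambda>t. norm (g t)"])
    show "integrable lborel (\<lambda>t. norm (g t))" using g by (rule integrable_norm)
    show "AE t in lborel. (\<lambda>n. indicator {-real n..real n} t *\<^sub>R g t) \<longlonglongrightarrow> g t"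
    proof (rule AE_I2)
      fix t :: real
      have "\<forall>\<^sub>F n in sequentially. indicator {-real n..real n} t *\<^sub>R g t = g t"
        using eventually_ge_at_top[of "nat \<lceil>\<bar>t\<bar>\<rceil>"]
      proof eventually_elim
        case (elim n)
        then have "\<bar>t\<bar> \<le> real n" by linarith
        then show ?case by (auto simp: indicator_def)
      qed
      then show "(\<lambda>n. indicator {-real n..real n} t *\<^sub>R g t) \<longlonglongrightarrow> g t" by (rule tendsto_eventually)
    qed
  qed (use g in \<open>auto simp: indicator_def\<close>)
  define g where "g t = char M t * iexp (- (t * y))" for t
  define q where "q k t = (iexp (- (t * y)) - iexp (- (t * (y + 1 / real (Suc k))))) / (\<i> * of_real t) * char M t" for k t
  have nch: "norm (char M t) \<le> norm (B / (1 + t\<^sup>2))" for t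
    by (metis B abs_ge_self order_trans real_norm_def)
  have gint: "integrable lborel g"
  proof (rule Bochner_Integration.integrable_bound[OF integrable_inverse_1_plus_square'[of B]])
    show "AE t in lborel. norm (g t) \<le> norm (B / (1 + t\<^sup>2))" using nch by (simp add: g_def norm_mult)
  qed (simp add: g_def[abs_def])
  \<comment> \<open>The difference of exponentials divided by t is at most the length 1 / (k + 1) of
    the interval, so the rescaled integrands keep the integrable majorant of the characteristic
    function.\<close>
  have qle: "norm (q k t) * real (Suc k) \<le> norm (char M t)" for k t
  proof (cases "t = 0")
    case False
    have "norm ((iexp (- (t * y)) - iexp (- (t * (y + 1 / real (Suc k))))) / (\<i> * of_real t)) \<le> 1 / real (Suc k)"
      using Levy_Inversion_aux2[of "- (y + 1 / real (Suc k))" "- y" t] False by (simp add: algebra_simps)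
    then have "norm (q k t) \<le> 1 / real (Suc k) * norm (char M t)"
      unfolding q_def norm_mult[of _ "char M t"] by (rule mult_right_mono) auto
    then have "norm (q k t) * real (Suc k) \<le> 1 / real (Suc k) * norm (char M t) * real (Suc k)"
      by (rule mult_right_mono) auto
    then show ?thesis by simp
  qed (simp add: q_def)
  have qmeas [measurable]: "q k \<in> borel_measurable borel" for k unfolding q_def by measurable
  have qint: "integrable lborel (q k)" for k
  proof (rule Bochner_Integration.integrable_bound[OF integrable_inverse_1_plus_square'[of B]])
    have "norm (q k t) \<le> norm (B / (1 + t\<^sup>2))" for t
    proof -
      have "norm (q k t) * 1 \<le> norm (q k t) * real (Suc k)" by (intro mult_left_mono) auto
      then show ?thesis using qle[of k t] nch[of t] by linarith
    qed
    then show "AE t in lborel. norm (q k t) \<le> norm (B / (1 + t\<^sup>2))" by simp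
  qed simp
  have levy: "integral\<^sup>L lborel (q k) / (2 * pi) = of_real (integral {y..y + 1 / real (Suc k)} \<psi>)" for k
  proof -
    have "(\<lambda>T. 1 / (2 * pi) * (CLBINT t=-T..T. q k t)) \<longlonglongrightarrow> of_real (measure M {y<..y + 1 / real (Suc k)})"
      unfolding q_def using Levy_Inversion[of y "y + 1 / real (Suc k)"] atom by simp
    moreover have "(CLBINT t=-real T..real T. q k t) = (\<integral>t. indicator {-real T..real T} t *\<^sub>R q k t \<partial>lborel)" for T :: nat
      by (subst interval_integral_Icc) (auto simp: set_lebesgue_integral_def)
    ultimately have "(\<lambda>T. 1 / (2 * pi) * (\<integral>t. indicator {-real T..real T} t *\<^sub>R q k t \<partial>lborel)) \<longlonglongrightarrow> of_real (integral {y..y + 1 / real (Suc k)} \<psi>)"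
      by (simp add: meas_Ioc)
    moreover have "(\<lambda>T. 1 / (2 * pi) * (\<integral>t. indicator {-real T..real T} t *\<^sub>R q k t \<partial>lborel)) \<longlonglongrightarrow> 1 / (2 * pi) * integral\<^sup>L lborel (q k)"
      by (intro tendsto_mult tendsto_const trunc qint)
    ultimately show ?thesis by (auto dest: LIMSEQ_unique)
  qed
  have "(\<lambda>k. \<integral>t. q k t * of_real (real (Suc k)) \<partial>lborel) \<longlonglongrightarrow> integral\<^sup>L lborel g"
  proof (rule integral_dominated_convergence[where w = "\<lambda>t. norm (B / (1 + t\<^sup>2))"])
    show "integrable lborel (\<lambda>t::real. norm (B / (1 + t\<^sup>2)))" by (intro integrable_norm integrable_inverse_1_plus_square')
    show "AE t in lborel. norm (q k t * of_real (real (Suc k))) \<le> norm (B / (1 + t\<^sup>2))" for k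
      using order_trans[OF qle nch] by (simp add: norm_mult del: of_nat_Suc)
    have "AE t::real in lborel. t \<noteq> 0" by (rule AE_lborel_singleton)
    then show "AE t in lborel. (\<lambda>k. q k t * of_real (real (Suc k))) \<longlonglongrightarrow> g t"
    proof eventually_elim
      case (elim t)
      \<comment> \<open>The pointwise limit is a derivative at y, divided by - i t; hence t = 0 is
        excluded.\<close>
      have "((\<lambda>x. exp (\<i> * of_real (- t) * x)) has_field_derivative (\<i> * of_real (- t)) * exp (\<i> * of_real (- t) * of_real y)) (at (of_real y))"
        by (auto intro!: derivative_eq_intros)
      then have d: "((\<lambda>x. (exp (\<i> * of_real (- t) * x) - exp (\<i> * of_real (- t) * of_real y)) / (x - of_real y)) \<longlongrightarrow> (\<i> * of_real (- t)) * exp (\<i> * of_real (- t) * of_real y)) (at (of_real y))"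
        by (simp add: has_field_derivative_iff)
      have "(\<lambda>k. complex_of_real y + of_real (1 / real (Suc k))) \<longlonglongrightarrow> of_real y + of_real 0"
        using LIMSEQ_Suc[OF lim_1_over_n] by (intro tendsto_intros) auto
      then have "filterlim (\<lambda>k. complex_of_real y + of_real (1 / real (Suc k))) (at (of_real y)) sequentially"
        unfolding filterlim_at by (auto simp del: of_nat_Suc intro!: always_eventually)
      from filterlim_compose[OF d this]
      have l: "(\<lambda>k. (exp (\<i> * of_real (- t) * (of_real y + of_real (1 / real (Suc k)))) - exp (\<i> * of_real (- t) * of_real y)) / (of_real y + of_real (1 / real (Suc k)) - of_real y))
        \<longlonglongrightarrow> (\<i> * of_real (- t)) * exp (\<i> * of_real (- t) * of_real y)" .
      have l2: "(\<lambda>k. (- 1 / (\<i> * of_real t)) * ((exp (\<i> * of_real (- t) * (of_real y + of_real (1 / real (Suc k)))) - exp (\<i> * of_real (- t) * of_real y)) / (of_real y + of_real (1 / real (Suc k)) - of_real y)) * char M t)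
        \<longlonglongrightarrow> (- 1 / (\<i> * of_real t)) * ((\<i> * of_real (- t)) * exp (\<i> * of_real (- t) * of_real y)) * char M t"
        by (intro tendsto_mult tendsto_const l)
      have e1: "(- 1 / (\<i> * of_real t)) * ((\<i> * of_real (- t)) * exp (\<i> * of_real (- t) * of_real y)) * char M t = g t"
        using elim by (simp add: g_def field_simps)
      have e2: "(- 1 / (\<i> * of_real t)) * ((exp (\<i> * of_real (- t) * (of_real y + of_real (1 / real (Suc k)))) - exp (\<i> * of_real (- t) * of_real y)) / (of_real y + of_real (1 / real (Suc k)) - of_real y)) * char M t
        = q k t * of_real (real (Suc k))" for k
        using elim by (simp add: q_def divide_simps del: of_nat_Suc) (simp add: algebra_simps del: of_nat_Suc)
      show ?case using l2 unfolding e1 e2 .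
    qed
  qed (simp_all add: g_def[abs_def])
  then have "(\<lambda>k. integral\<^sup>L lborel (q k) * of_real (real (Suc k))) \<longlonglongrightarrow> integral\<^sup>L lborel g"
    by (simp del: of_nat_Suc)
  then have lim1: "(\<lambda>k. (integral\<^sup>L lborel (q k) * of_real (real (Suc k))) / (2 * pi)) \<longlonglongrightarrow> integral\<^sup>L lborel g / (2 * pi)"
    by (intro tendsto_divide tendsto_const) auto
  have "((\<lambda>x. integral {y..x} \<psi>) has_real_derivative \<psi> y) (at y within {y..y+1})"
    using \<psi>(1) by (intro integral_has_real_derivative) (auto intro: continuous_on_subset)
  from right_quotient_tendsto[OF this]
  have "(\<lambda>k. complex_of_real (integral {y..y + 1 / real (Suc k)} \<psi> * real (Suc k))) \<longlonglongrightarrow> of_real (\<psi> y)"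
    by (intro tendsto_of_real) simp
  moreover have "complex_of_real (integral {y..y + 1 / real (Suc k)} \<psi> * real (Suc k)) = (integral\<^sup>L lborel (q k) * of_real (real (Suc k))) / (2 * pi)" for k
    using levy[of k] by (simp del: of_nat_Suc add: field_simps)
  ultimately have "(\<lambda>k. (integral\<^sup>L lborel (q k) * of_real (real (Suc k))) / (2 * pi)) \<longlonglongrightarrow> of_real (\<psi> y)" by simp
  then have eq: "integral\<^sup>L lborel g = 2 * pi * \<psi> y"
    using LIMSEQ_unique[OF lim1] by (simp add: field_simps)
  have "integral {-real n..real n} g = (\<integral>t. indicator {-real n..real n} t *\<^sub>R g t \<partial>lborel)" for n
  proof -
    have "set_integrable lborel {-real n..real n} g" unfolding set_integrable_def by (intro integrable_mult_indicator gint) auto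
    from set_borel_integral_eq_integral(2)[OF this] show ?thesis by (simp add: set_lebesgue_integral_def)
  qed
  then show ?thesis using trunc[OF gint] unfolding eq g_def by simp
qed

text \<open>Exponential tilting: \<psi> x = fY x exp (c x) / mc is a probability density whose
  characteristic function is the moment function on the line Re s = c divided by mc. Fourier
  inversion for \<psi> is Mellin inversion for fY.\<close>

lemma density_inversion:
  fixes Y :: "'w \<Rightarrow> real"
  assumes "prob_space M" and fY: "continuous_density_on M Y UNIV fY"
    and int: "integrable M (\<lambda>\<omega>. exp (c * Y \<omega>))"
    and B: "\<And>t. norm (\<integral>\<omega>. exp (Complex c t * of_real (Y \<omega>)) \<partial>M) \<le> B / (1 + t\<^sup>2)"
  shows "(\<lambda>n. integral {-real n..real n}
      (\<lambda>t. (\<integral>\<omega>. exp (Complex c t * of_real (Y \<omega>)) \<partial>M) * exp (- of_real y * Complex c t))) \<longlonglongrightarrow> 2 * pi * fY y"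
proof -
  interpret prob_space M by fact
  have dens: "distributed M lborel Y (\<lambda>x. ennreal (fY x))" and cont: "continuous_on UNIV fY" and nn: "\<And>x. 0 \<le> fY x"
    using fY by (auto simp: continuous_density_on_def)
  have [measurable]: "Y \<in> borel_measurable M" using distributed_measurable[OF dens] by simp
  have [measurable]: "fY \<in> borel_measurable borel" using cont by (rule borel_measurable_continuous_onI)
  define m where "m t = (\<integral>\<omega>. exp (Complex c t * of_real (Y \<omega>)) \<partial>M)" for t
  define mc where "mc = (\<integral>\<omega>. exp (c * Y \<omega>) \<partial>M)"
  have mc: "mc > 0"
  proof -
    have "mc \<ge> 0" unfolding mc_def by simp
    moreover have "mc \<noteq> 0"
      unfolding mc_def using integral_nonneg_eq_0_iff_AE[OF int] not_AE_zero_E by (auto simp: AE_False)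
    ultimately show ?thesis by simp
  qed
  define \<psi> where "\<psi> x = fY x * (exp (c * x) / mc)" for x
  have \<psi>c: "continuous_on UNIV \<psi>" unfolding \<psi>_def using mc by (intro continuous_intros cont) auto
  have \<psi>n: "0 \<le> \<psi> x" for x using mc nn by (simp add: \<psi>_def)
  have [measurable]: "\<psi> \<in> borel_measurable borel" using \<psi>c by (rule borel_measurable_continuous_onI)
  define N where "N = density lborel (\<lambda>x. ennreal (\<psi> x))"
  have "emeasure N (space N) = (\<integral>\<^sup>+x. ennreal (fY x) * ennreal (exp (c * x) / mc) \<partial>lborel)"
  proof -
    have "ennreal (\<psi> x) = ennreal (fY x) * ennreal (exp (c * x) / mc)" for x
      unfolding \<psi>_def using mc nn by (intro ennreal_mult) auto
    then show ?thesis unfolding N_def by (subst emeasure_density) auto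
  qed
  also have "\<dots> = (\<integral>\<^sup>+\<omega>. ennreal (exp (c * Y \<omega>) / mc) \<partial>M)"
    by (rule distributed_nn_integral[OF dens]) simp
  also have "\<dots> = ennreal (\<integral>\<omega>. exp (c * Y \<omega>) / mc \<partial>M)"
    using int mc by (intro nn_integral_eq_integral) auto
  also have "(\<integral>\<omega>. exp (c * Y \<omega>) / mc \<partial>M) = 1" using mc by (simp add: mc_def)
  finally have "prob_space N" by (intro prob_spaceI) simp
  then interpret N: real_distribution N
    by (intro real_distribution.intro real_distribution_axioms.intro) (auto simp: N_def)
  have char: "char N t = m t / mc" for t
  proof -
    have "char N t = (\<integral>x. \<psi> x *\<^sub>R iexp (t * x) \<partial>lborel)"
      unfolding char_def N_def by (subst integral_density) (auto simp: \<psi>n)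
    also have "\<dots> = (\<integral>x. fY x *\<^sub>R ((exp (c * x) / mc) *\<^sub>R iexp (t * x)) \<partial>lborel)"
      by (simp add: \<psi>_def)
    also have "\<dots> = (\<integral>x. (exp (c * x) / mc) *\<^sub>R iexp (t * x) \<partial>density lborel (\<lambda>x. ennreal (fY x)))"
      by (subst integral_density) (auto simp: nn)
    also have "\<dots> = (\<integral>\<omega>. (exp (c * Y \<omega>) / mc) *\<^sub>R iexp (t * Y \<omega>) \<partial>M)"
      unfolding distributed_distr_eq_density[OF dens, symmetric] by (subst integral_distr) auto
    also have "\<dots> = (\<integral>\<omega>. exp (Complex c t * of_real (Y \<omega>)) / mc \<partial>M)"
    proof (intro Bochner_Integration.integral_cong refl)
      fix \<omega>
      have "Complex c t * of_real (Y \<omega>) = of_real (c * Y \<omega>) + \<i> * of_real (t * Y \<omega>)" by (simp add: complex_eq_iff)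
      then show "(exp (c * Y \<omega>) / mc) *\<^sub>R iexp (t * Y \<omega>) = exp (Complex c t * of_real (Y \<omega>)) / mc"
        by (simp add: exp_add exp_of_real scaleR_conv_of_real flip: of_real_mult)
    qed
    finally show ?thesis by (simp add: m_def)
  qed
  have "norm (char N t) \<le> (B / mc) / (1 + t\<^sup>2)" for t
    using divide_right_mono[OF B[of t], of mc] mc by (simp add: char m_def norm_divide mult.commute)
  from N.density_from_char[OF N_def \<psi>c \<psi>n this]
  have "(\<lambda>n. of_real (mc * exp (- c * y)) * integral {-real n..real n} (\<lambda>t. char N t * iexp (- (t * y))))
     \<longlonglongrightarrow> of_real (mc * exp (- c * y)) * of_real (2 * pi * \<psi> y)"
    by (intro tendsto_mult tendsto_const)
  moreover have "of_real (mc * exp (- c * y)) * of_real (2 * pi * \<psi> y) = complex_of_real (2 * pi * fY y)"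
    using mc by (simp add: \<psi>_def exp_minus field_simps flip: of_real_mult)
  moreover have "of_real (mc * exp (- c * y)) * integral {-real n..real n} (\<lambda>t. char N t * iexp (- (t * y)))
     = integral {-real n..real n} (\<lambda>t. m t * exp (- of_real y * Complex c t))" for n
  proof -
    have "of_real (mc * exp (- c * y)) * (char N t * iexp (- (t * y))) = m t * exp (- of_real y * Complex c t)" for t
    proof -
      have "- of_real y * Complex c t = of_real (- c * y) + \<i> * of_real (- (t * y))" by (simp add: complex_eq_iff)
      then have "exp (- of_real y * Complex c t) = of_real (exp (- c * y)) * iexp (- (t * y))"
        by (simp only: exp_add exp_of_real)
      then show ?thesis using mc by (simp add: char)
    qed
    then show ?thesis by (simp only: integral_mult_right[symmetric])
  qed
  ultimately have "(\<lambda>n. integral {-real n..real n} (\<lambda>t. m t * exp (- of_real y * Complex c t))) \<longlonglongrightarrow> complex_of_real (2 * pi * fY y)"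
    by (simp only:)
  then show ?thesis by (simp add: m_def)
qed

text \<open>Both densities are continuous, so the identity holds pointwise: the masses of {y..z} and
  {exp y..exp z} agree, and both sides are differentiated from the right at z = y.\<close>

lemma log_density:
  fixes X :: "'w \<Rightarrow> real"
  assumes "prob_space M" and pos: "AE \<omega> in M. X \<omega> > 0"
    and fX: "continuous_density_on M X {0<..} fX"
    and fY: "continuous_density_on M (\<lambda>\<omega>. ln (X \<omega>)) UNIV fY"
  shows "fY y = fX (exp y) * exp y"
proof -
  interpret prob_space M by fact
  have dX: "distributed M lborel X (\<lambda>x. ennreal (fX x))" "continuous_on {0<..} fX" "\<And>x. x > 0 \<Longrightarrow> 0 \<le> fX x"
    and dY: "distributed M lborel (\<lambda>\<omega>. ln (X \<omega>)) (\<lambda>x. ennreal (fY x))" "continuous_on UNIV fY" "\<And>x. 0 \<le> fY x"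
    using fX fY by (auto simp: continuous_density_on_def)
  have [measurable]: "X \<in> borel_measurable M" using distributed_measurable[OF dX(1)] by simp
  have cX: "continuous_on {exp p..q} fX" for p q
    by (rule continuous_on_subset[OF dX(2)]) (auto intro: less_le_trans[OF exp_gt_zero])
  have eq: "integral {y..z} fY = integral {exp y..exp z} fX" for z
  proof -
    have "integral {y..z} fY = measure M {\<omega> \<in> space M. ln (X \<omega>) \<in> {y..z}}"
      using dY by (intro distributed_measure_Icc[symmetric] prob_space_axioms) (auto intro: continuous_on_subset)
    also have "\<dots> = measure M {\<omega> \<in> space M. X \<omega> \<in> {exp y..exp z}}"
      using pos
    proof (intro measure_eq_AE, eventually_elim)
      case (elim \<omega>)
      have "y \<le> ln (X \<omega>) \<longleftrightarrow> exp y \<le> X \<omega>" "ln (X \<omega>) \<le> z \<longleftrightarrow> X \<omega> \<le> exp z"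
        using elim by (metis exp_le_cancel_iff exp_ln)+
      then show ?case by auto
    qed measurable
    also have "\<dots> = integral {exp y..exp z} fX"
      using cX dX by (intro distributed_measure_Icc prob_space_axioms) (auto intro: less_le_trans[OF exp_gt_zero])
    finally show ?thesis .
  qed
  have "((\<lambda>x. integral {y..x} fY) has_real_derivative fY y) (at y within {y..y+1})"
    using dY(2) by (intro integral_has_real_derivative) (auto intro: continuous_on_subset)
  from right_quotient_tendsto[OF this]
  have l1: "(\<lambda>k. integral {y..y + 1 / real (Suc k)} fY * real (Suc k)) \<longlonglongrightarrow> fY y" by simp
  have "((\<lambda>x. integral {exp y..x} fX) has_real_derivative fX (exp y)) (at (exp y) within {exp y..exp (y + 1)})"
    using cX by (intro integral_has_real_derivative) auto
  then have "((\<lambda>x. integral {exp y..x} fX) has_real_derivative fX (exp y)) (at (exp y) within exp ` {y..y+1})"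
    by (rule DERIV_subset) auto
  then have "((\<lambda>x. integral {exp y..x} fX) \<circ> exp has_real_derivative fX (exp y) * exp y) (at y within {y..y+1})"
    by (rule DERIV_image_chain) (auto intro!: derivative_eq_intros)
  from right_quotient_tendsto[OF this]
  have l2: "(\<lambda>k. integral {exp y..exp (y + 1 / real (Suc k))} fX * real (Suc k)) \<longlonglongrightarrow> fX (exp y) * exp y"
    by simp
  show ?thesis using LIMSEQ_unique[OF l1[unfolded eq] l2] .
qed

section \<open>Continuation of the moment function to the whole strip\<close>

context gamma_type_params
begin

lemma exists_near_not_S0:
  fixes p q \<rho> e :: real
  assumes "p < q" "p \<le> \<rho>" "\<rho> \<le> q" "e > 0"
  shows "\<exists>x. p < x \<and> x < q \<and> \<bar>x - \<rho>\<bar> < e \<and> x \<noteq> \<rho> \<and> complex_of_real x \<notin> S0"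
proof -
  let ?I = "{max p (\<rho> - e)<..<min q (\<rho> + e)}"
  let ?A = "{x. complex_of_real x \<in> S0 \<and> p \<le> x \<and> x \<le> q}"
  have "finite (complex_of_real ` ?A)" by (rule finite_subset[OF _ finite_S0_strip[of p q]]) auto
  then have "finite ?A" by (rule finite_imageD) (auto simp: inj_on_def)
  moreover have "infinite ?I" using assms by (intro infinite_Ioo) auto
  ultimately have "infinite (?I - (?A \<union> {\<rho>}))" by (intro Diff_infinite_finite) auto
  then obtain x where "x \<in> ?I - (?A \<union> {\<rho>})" by (metis finite.emptyI ex_in_conv)
  then show ?thesis by (intro exI[of _ x]) auto
qed

text \<open>Since exp (x z) \<le> 1 + exp (s z) for x between 0 and s, the moments are finite and
  bounded between 0 and c. They equal F there by analytic continuation, so F cannot have a pole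
  between 0 and c, endpoints included.\<close>

lemma moment_inversion:
  fixes X :: "'w \<Rightarrow> real"
  assumes "prob_space M" and [measurable]: "X \<in> borel_measurable M" and pos: "AE \<omega> in M. X \<omega> > 0"
    and uv: "u < v"
    and mom: "\<And>s. u < s \<Longrightarrow> s < v \<Longrightarrow> integrable M (\<lambda>\<omega>. X \<omega> powr s) \<and> of_real (\<integral>\<omega>. X \<omega> powr s \<partial>M) = F (of_real s)"
    and fY: "continuous_density_on M (\<lambda>\<omega>. ln (X \<omega>)) UNIV fY"
    and \<gamma>: "\<gamma> > 0"
  obtains c where "complex_of_real c \<notin> S0"
    "\<And>\<rho>. is_pole F (of_real \<rho>) \<Longrightarrow> min 0 c \<le> \<rho> \<Longrightarrow> \<rho> \<le> max 0 c \<Longrightarrow> False"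
    "\<And>y. (\<lambda>n. integral {-real n..real n} (\<lambda>t. F (Complex c t) * exp (- of_real y * Complex c t))) \<longlonglongrightarrow> 2 * pi * fY y"
proof -
  interpret prob_space M by fact
  define Y where "Y \<omega> = ln (X \<omega>)" for \<omega>
  have [measurable]: "Y \<in> borel_measurable M" unfolding Y_def by measurable
  have powr: "AE \<omega> in M. X \<omega> powr s = exp (s * Y \<omega>)" for s
    using pos by eventually_elim (simp add: powr_def Y_def)
  have int1: "integrable M (\<lambda>\<omega>. exp (s * Y \<omega>))" if "u < s" "s < v" for s
    using mom[OF that] powr[of s] by (subst integrable_cong_AE[where g = "\<lambda>\<omega>. X \<omega> powr s"]) auto
  have val1: "of_real (\<integral>\<omega>. exp (s * Y \<omega>) \<partial>M) = F (of_real s)" if "u < s" "s < v" for s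
    using mom[OF that] powr[of s] by (subst integral_cong_AE[where g = "\<lambda>\<omega>. X \<omega> powr s"]) auto
  have between: "exp (x * z) \<le> 1 + exp (s * z)" if "(0 \<le> x \<and> x \<le> s) \<or> (s \<le> x \<and> x \<le> 0)" for x s z :: real
  proof -
    have "x * z \<le> 0 \<or> x * z \<le> s * z"
      using that by (metis linorder_linear mult_nonneg_nonpos mult_nonpos_nonneg mult_right_mono mult_right_mono_neg)
    then show ?thesis by (auto intro: add_increasing add_increasing2)
  qed
  have int_between: "integrable M (\<lambda>\<omega>. exp (x * Y \<omega>))" and le_between: "(\<integral>\<omega>. exp (x * Y \<omega>) \<partial>M) \<le> 1 + (\<integral>\<omega>. exp (s * Y \<omega>) \<partial>M)"
    if "(0 \<le> x \<and> x \<le> s) \<or> (s \<le> x \<and> x \<le> 0)" "u < s" "s < v" for x s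
  proof -
    have i: "integrable M (\<lambda>\<omega>. 1 + exp (s * Y \<omega>))" using int1[OF that(2,3)] by simp
    show i2: "integrable M (\<lambda>\<omega>. exp (x * Y \<omega>))"
      by (rule Bochner_Integration.integrable_bound[OF i]) (use between[OF that(1)] in \<open>auto simp: add_nonneg_nonneg\<close>)
    have "(\<integral>\<omega>. exp (x * Y \<omega>) \<partial>M) \<le> (\<integral>\<omega>. 1 + exp (s * Y \<omega>) \<partial>M)"
      using i i2 between[OF that(1)] by (intro integral_mono) auto
    also have "\<dots> = 1 + (\<integral>\<omega>. exp (s * Y \<omega>) \<partial>M)" using int1[OF that(2,3)] by (simp add: prob_space)
    finally show "(\<integral>\<omega>. exp (x * Y \<omega>) \<partial>M) \<le> 1 + (\<integral>\<omega>. exp (s * Y \<omega>) \<partial>M)" .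
  qed
  define lo hi where "lo = min 0 u" and "hi = max 0 v"
  have int: "integrable M (\<lambda>\<omega>. exp (x * Y \<omega>))" if x: "lo < x" "x < hi" for x
  proof (cases "u < x \<and> x < v")
    case True
    then show ?thesis using int1 by simp
  next
    case False
    define s where "s = (u + v) / 2"
    have "(0 \<le> x \<and> x \<le> s) \<or> (s \<le> x \<and> x \<le> 0)"
      using False x uv unfolding lo_def hi_def s_def by (auto simp: min_def max_def field_simps split: if_splits)
    then show ?thesis using uv by (intro int_between[of x s]) (auto simp: s_def)
  qed
  define S where "S = {s. lo < Re s} \<inter> {s. Re s < hi}"
  define m where "m s = (\<integral>\<omega>. exp (s * of_real (Y \<omega>)) \<partial>M)" for s :: complex
  have hol: "m holomorphic_on S" unfolding m_def S_def by (rule exp_moment_holomorphic) (use int in auto)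
  have m_real: "m (of_real x) = of_real (\<integral>\<omega>. exp (x * Y \<omega>) \<partial>M)" for x
    unfolding m_def by (subst integral_complex_of_real[symmetric]) (simp add: exp_of_real flip: of_real_mult)
  have S: "open S" "connected S" "of_real x \<in> S \<longleftrightarrow> lo < x \<and> x < hi" for x
    unfolding S_def
    by (auto intro!: open_Int open_halfspace_Re_gt open_halfspace_Re_lt convex_connected convex_Int convex_halfspace_Re_gt convex_halfspace_Re_lt)
  \<comment> \<open>Multiplying by the entire reciprocal Gamma functions removes the denominators,
    so that the identity theorem applies on the whole strip although quotient and moment function
    can only be compared off \<open>S0\<close>.\<close>
  define h where "h s = m s * (\<Prod>j=1..J. rGamma (of_real (a j) * s + of_real (b j)))
      - of_real C * of_real D powr s * (\<Prod>k=1..K. rGamma (of_real (a' k) * s + of_real (b' k)))" for s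
  have off: "(\<Prod>j=1..J. Gamma (of_real (a j) * s + of_real (b j))) * (\<Prod>j=1..J. rGamma (of_real (a j) * s + of_real (b j))) = 1"
    if "s \<notin> S0" for s
    using that unfolding prod.distrib[symmetric] by (intro prod.neutral) (auto simp: rGamma_inverse_Gamma S0_def Gamma_eq_zero_iff)
  have h_iff: "h s = 0 \<longleftrightarrow> m s = F s" if "s \<notin> S0" for s
  proof -
    have n: "(\<Prod>j=1..J. rGamma (of_real (a j) * s + of_real (b j))) \<noteq> 0" using off[OF that] by (metis mult_zero_right zero_neq_one)
    have "h s = (m s - quot s) * (\<Prod>j=1..J. rGamma (of_real (a j) * s + of_real (b j)))"
      using off[OF that] by (simp add: h_def quot_eq left_diff_distrib mult.assoc)
    then show ?thesis using n F_eq_quot[OF that] by simp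
  qed
  have "h s = 0" if "s \<in> S" for s
  proof (rule analytic_continuation[of h S "of_real ` {x. u < x \<and> x < v \<and> complex_of_real x \<notin> S0}" "of_real ((u + v) / 2)"])
    show "h holomorphic_on S" unfolding h_def
      by (intro holomorphic_intros hol analytic_imp_holomorphic[OF D_powr_analytic])
    show "of_real ` {x. u < x \<and> x < v \<and> complex_of_real x \<notin> S0} \<subseteq> S" by (auto simp: S lo_def hi_def)
    show "complex_of_real ((u + v) / 2) \<in> S" using uv unfolding S by (auto simp: lo_def hi_def min_def max_def field_simps)
    show "complex_of_real ((u + v) / 2) islimpt of_real ` {x. u < x \<and> x < v \<and> complex_of_real x \<notin> S0}"
      unfolding islimpt_approachable
    proof (intro allI impI)
      fix e :: real assume "e > 0"
      then obtain x where "u < x" "x < v" "\<bar>x - (u + v) / 2\<bar> < e" "x \<noteq> (u + v) / 2" "complex_of_real x \<notin> S0"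
        using exists_near_not_S0[of u v "(u+v)/2" e] uv by auto
      then show "\<exists>x'\<in>of_real ` {x. u < x \<and> x < v \<and> complex_of_real x \<notin> S0}. x' \<noteq> complex_of_real ((u + v) / 2) \<and> dist x' (complex_of_real ((u + v) / 2)) < e"
        by (intro bexI[of _ "of_real x"] conjI) (simp_all only: dist_of_real dist_real_def of_real_eq_iff not_False_eq_True, auto)
    qed
    show "h z = 0" if "z \<in> of_real ` {x. u < x \<and> x < v \<and> complex_of_real x \<notin> S0}" for z
      using that h_iff val1 m_real by auto
  qed (use that S in auto)
  then have mF: "m s = F s" if "s \<in> S" "s \<notin> S0" for s using that h_iff by blast
  obtain c where c: "u < c" "c < v" "complex_of_real c \<notin> S0" "c \<noteq> 0"
  proof -
    \<comment> \<open>The point to be avoided: 0 if it lies in the interval. Then c is nonzero, so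
      the segment between 0 and c is not degenerate and every point of it can be approached from its
      interior.\<close>
    define \<rho> where "\<rho> = (if u < 0 \<and> 0 < v then 0 else (u + v) / 2)"
    have "u \<le> \<rho>" "\<rho> \<le> v" using uv by (auto simp: \<rho>_def field_simps)
    then obtain x where "u < x" "x < v" "x \<noteq> \<rho>" "complex_of_real x \<notin> S0"
      using exists_near_not_S0[of u v \<rho> 1] uv by auto
    then show ?thesis using that[of x] by (auto simp: \<rho>_def split: if_splits)
  qed
  have cS: "Complex c t \<in> S" for t using c by (auto simp: S_def lo_def hi_def)
  have cS0: "Complex c t \<notin> S0" for t
  proof
    assume "Complex c t \<in> S0"
    moreover from S0_lattice(1)[OF this] have "Complex c t = of_real c" by (simp add: complex_eq_iff)
    ultimately show False using c by simp
  qed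
  show ?thesis
  proof (rule that[OF c(3)])
    fix \<rho> assume \<rho>: "is_pole F (of_real \<rho>)" "min 0 c \<le> \<rho>" "\<rho> \<le> max 0 c"
    \<comment> \<open>A bound for all moments of order between 0 and c; it contradicts |F| tending
      to infinity at \<rho>.\<close>
    define B where "B = 1 + (\<integral>\<omega>. exp (c * Y \<omega>) \<partial>M)"
    have "filterlim F at_infinity (at (of_real \<rho>))" using \<rho>(1) by (simp add: is_pole_def)
    then have "\<forall>\<^sub>F s in at (of_real \<rho>). norm (F s) \<ge> \<bar>B\<bar> + 1"
      unfolding filterlim_at_infinity[OF order_refl] by (metis abs_ge_zero add_nonneg_pos zero_less_one)
    then obtain e where e: "e > 0" "\<And>s. s \<noteq> of_real \<rho> \<Longrightarrow> dist s (of_real \<rho>) < e \<Longrightarrow> norm (F s) \<ge> \<bar>B\<bar> + 1"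
      by (auto simp: eventually_at)
    obtain x where x: "min 0 c < x" "x < max 0 c" "\<bar>x - \<rho>\<bar> < e" "x \<noteq> \<rho>" "complex_of_real x \<notin> S0"
      using exists_near_not_S0[of "min 0 c" "max 0 c" \<rho> e] \<rho> c e by (auto simp: min_def max_def split: if_splits)
    have "of_real x \<in> S" using x c unfolding S by (auto simp: lo_def hi_def min_def max_def split: if_splits)
    then have "F (of_real x) = of_real (\<integral>\<omega>. exp (x * Y \<omega>) \<partial>M)" using mF[OF _ x(5)] m_real by simp
    then have "norm (F (of_real x)) = (\<integral>\<omega>. exp (x * Y \<omega>) \<partial>M)" by (simp add: integral_nonneg)
    also have "\<dots> \<le> B" unfolding B_def using x c by (intro le_between) (auto simp: min_def max_def split: if_splits)
    finally have "norm (F (of_real x)) \<le> B" .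
    moreover have "norm (F (of_real x)) \<ge> \<bar>B\<bar> + 1" using x by (intro e(2)) (auto simp: dist_real_def)
    ultimately show False by linarith
  next
    fix y
    obtain A T where A: "A \<ge> 0" "T \<ge> 0" "\<forall>s. c \<le> Re s \<longrightarrow> Re s \<le> c \<longrightarrow> T \<le> \<bar>Im s\<bar> \<longrightarrow>
      norm (quot s) \<le> A * exp (- (pi * \<gamma> / 4) * \<bar>Im s\<bar>)"
      by (rule quot_strip_bound[OF \<gamma>])
    have e: "pi * \<gamma> / 4 > 0" using \<gamma> by simp
    obtain A2 where A2: "A2 > 0" "\<forall>t::real. exp (- (pi * \<gamma> / 4) * \<bar>t\<bar>) \<le> A2 / (1 + t\<^sup>2)"
      by (rule exp_le_inverse_square[OF e])
    have mc: "norm (m (Complex c t)) \<le> (\<integral>\<omega>. exp (c * Y \<omega>) \<partial>M)" for t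
      unfolding m_def by (rule order_trans[OF integral_norm_bound]) (simp add: norm_exp_eq_Re)
    define E where "E = (\<integral>\<omega>. exp (c * Y \<omega>) \<partial>M)"
    have E0: "E \<ge> 0" unfolding E_def by (simp add: integral_nonneg)
    have bd: "norm (m (Complex c t)) \<le> (A * A2 + E * (1 + T\<^sup>2)) / (1 + t\<^sup>2)" for t
    proof (cases "T \<le> \<bar>t\<bar>")
      case True
      have "norm (m (Complex c t)) \<le> A * exp (- (pi * \<gamma> / 4) * \<bar>t\<bar>)"
        using A(3)[rule_format, of "Complex c t"] True mF[OF cS cS0] F_eq_quot[OF cS0] by simp
      also have "\<dots> \<le> A * (A2 / (1 + t\<^sup>2))" using A(1) A2(2) by (intro mult_left_mono) auto
      also have "\<dots> \<le> (A * A2 + E * (1 + T\<^sup>2)) / (1 + t\<^sup>2)"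
        using E0 by (simp add: add_nonneg_nonneg divide_right_mono)
      finally show ?thesis .
    next
      case False
      then have "t\<^sup>2 \<le> T\<^sup>2" using A(2) by (metis abs_of_nonneg abs_le_square_iff linorder_linear)
      then have "E * (1 + t\<^sup>2) \<le> E * (1 + T\<^sup>2)" using E0 by (intro mult_left_mono) auto
      also have "\<dots> \<le> A * A2 + E * (1 + T\<^sup>2)" using A A2 by simp
      finally have "E \<le> (A * A2 + E * (1 + T\<^sup>2)) / (1 + t\<^sup>2)"
        by (subst pos_le_divide_eq) (auto simp: add_pos_nonneg)
      then show ?thesis using mc[of t] by (simp add: E_def)
    qed
    have "(\<lambda>n. integral {-real n..real n} (\<lambda>t. m (Complex c t) * exp (- of_real y * Complex c t))) \<longlonglongrightarrow> 2 * pi * fY y"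
      unfolding m_def
    proof (rule density_inversion)
      show "prob_space M" by (rule prob_space_axioms)
      show "continuous_density_on M Y UNIV fY" using fY by (simp add: Y_def[abs_def])
      show "integrable M (\<lambda>\<omega>. exp (c * Y \<omega>))" using c by (intro int1)
    qed (rule bd[unfolded m_def])
    moreover have "m (Complex c t) = F (Complex c t)" for t by (rule mF[OF cS cS0])
    ultimately show "(\<lambda>n. integral {-real n..real n} (\<lambda>t. F (Complex c t) * exp (- of_real y * Complex c t))) \<longlonglongrightarrow> 2 * pi * fY y"
      by simp
  qed
qed

end

section \<open>Divergence\<close>

text \<open>Dirichlet's theorem is applied to the multiples by N, with T = N q: this forces T \<ge>
  N without losing precision. The polynomial upper bound on T later keeps log T of the order of log
  N.\<close>

lemma simultaneous_near_period:
  fixes a a' :: "nat \<Rightarrow> real" and N J K :: nat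
  assumes "N > 0"
  obtains T :: real where "real N \<le> T" "T \<le> real N ^ Suc (J + K)"
    "\<forall>j\<in>{1..J}. \<exists>m::int. \<bar>a j * T - of_int m\<bar> < 1 / real N" "\<forall>k\<in>{1..K}. \<exists>m::int. \<bar>a' k * T - of_int m\<bar> < 1 / real N"
proof -
  define \<theta> where "\<theta> i = real N * (if i < J then a (Suc i) else a' (Suc (i - J)))" for i
  have "\<exists>q p. 0 < q \<and> q \<le> int (N ^ (J + K)) \<and> (\<forall>i<J + K. \<bar>of_int q * \<theta> i - of_int (p i)\<bar> < 1 / real N)"
    by (rule Dirichlet_approx_simult[OF assms, of "J + K" \<theta>]) blast
  then obtain q p where q: "0 < q" "q \<le> int (N ^ (J + K))" "\<And>i. i < J + K \<Longrightarrow> \<bar>of_int q * \<theta> i - of_int (p i)\<bar> < 1 / real N"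
    by blast
  define T where "T = real N * of_int q"
  have "real_of_int q \<le> real_of_int (int (N ^ (J + K)))" using q(2) by (simp only: of_int_le_iff)
  then have q1: "1 \<le> real_of_int q" "real_of_int q \<le> real N ^ (J + K)" using q(1) by simp_all
  show ?thesis
  proof (rule that[of T])
    show "real N \<le> T" using mult_left_mono[OF q1(1), of "real N"] by (simp add: T_def)
    show "T \<le> real N ^ Suc (J + K)" using mult_left_mono[OF q1(2), of "real N"] by (simp add: T_def)
    show "\<forall>j\<in>{1..J}. \<exists>m::int. \<bar>a j * T - of_int m\<bar> < 1 / real N"
    proof
      fix j assume "j \<in> {1..J}"
      then obtain i where "j = Suc i" "i < J" by (cases j) auto
      then show "\<exists>m::int. \<bar>a j * T - of_int m\<bar> < 1 / real N"
        using q(3)[of i] by (intro exI[of _ "p i"]) (auto simp: \<theta>_def T_def mult_ac)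
    qed
    show "\<forall>k\<in>{1..K}. \<exists>m::int. \<bar>a' k * T - of_int m\<bar> < 1 / real N"
    proof
      fix k assume "k \<in> {1..K}"
      then obtain i where "k = Suc i" "i < K" by (cases k) auto
      then show "\<exists>m::int. \<bar>a' k * T - of_int m\<bar> < 1 / real N"
        using q(3)[of "J + i"] by (intro exI[of _ "p (J + i)"]) (auto simp: \<theta>_def T_def mult_ac)
    qed
  qed
qed

text \<open>The zeros of the sine are simple. The case sin u0 \<noteq> 0 is included because not
  every sine vanishes at the pole under consideration.\<close>

lemma norm_sin_ge_linear:
  fixes u0 :: complex
  shows "\<exists>c>0. \<forall>\<^sub>F u in at u0. c * norm (u - u0) \<le> norm (sin u)"
proof (cases "sin u0 = 0")
  case True
  then have "cos u0 \<noteq> 0" using sin_cos_squared_add[of u0] by auto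
  have "(sin has_field_derivative cos u0) (at u0)" by (rule DERIV_sin)
  then have "((\<lambda>u. (sin u - sin u0) / (u - u0)) \<longlongrightarrow> cos u0) (at u0)" by (simp add: has_field_derivative_iff)
  then have "((\<lambda>u. norm (sin u / (u - u0))) \<longlongrightarrow> norm (cos u0)) (at u0)" using True by (intro tendsto_norm) simp
  then have "\<forall>\<^sub>F u in at u0. norm (cos u0) / 2 < norm (sin u / (u - u0))"
    by (rule order_tendstoD) (use \<open>cos u0 \<noteq> 0\<close> in simp)
  then have "\<forall>\<^sub>F u in at u0. norm (cos u0) / 2 * norm (u - u0) \<le> norm (sin u)"
    using eventually_neq_at_within[of u0 u0 UNIV]
    by eventually_elim (simp add: norm_divide field_simps)
  then show ?thesis using \<open>cos u0 \<noteq> 0\<close> by (intro exI[of _ "norm (cos u0) / 2"]) simp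
next
  case False
  have "((\<lambda>u. norm (sin u) - norm (u - u0)) \<longlongrightarrow> norm (sin u0) - norm (u0 - u0)) (at u0)"
    by (intro tendsto_intros)
  then have "\<forall>\<^sub>F u in at u0. 0 < norm (sin u) - norm (u - u0)"
    by (rule order_tendstoD) (use False in simp)
  then show ?thesis by (intro exI[of _ 1]) (auto elim: eventually_mono)
qed

text \<open>The sign (-1)^m, with m the integer nearest to a T, that the sine in
  \<open>gam_trig\<close> acquires under translation by T.\<close>

definition trig_sign :: "real \<Rightarrow> real \<Rightarrow> real" where
  "trig_sign a T = (if a < 0 then 1 else cos (pi * of_int (round (a * T))))"

lemma abs_trig_sign [simp]: "\<bar>trig_sign a T\<bar> = 1"
  by (simp add: trig_sign_def cos_npi_int)

text \<open>Up to the sign, sin (u + pi \<epsilon>) / sin u = cos (pi \<epsilon>) + cos u * sin (pi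
  \<epsilon>) / sin u. Near a zero, 1 / sin u may be as large as a multiple of 1 / |w - w0|, so the
  error \<epsilon> has to be small relative to that distance.\<close>

lemma gam_trig_near_period:
  fixes a b :: real and w0 :: complex
  assumes w: "w \<longlonglongrightarrow> w0" "\<And>n. w n \<noteq> w0"
    and T: "(\<lambda>n. (a * T n - of_int (round (a * T n))) / norm (w n - w0)) \<longlonglongrightarrow> 0"
      "(\<lambda>n. a * T n - of_int (round (a * T n))) \<longlonglongrightarrow> 0"
    and a: "a \<noteq> 0"
  shows "(\<lambda>n. of_real (trig_sign a (T n)) * (gam_trig a b (w n + of_real (T n)) / gam_trig a b (w n))) \<longlonglongrightarrow> 1"
proof (cases "a < 0")
  case True
  then show ?thesis by (simp add: gam_trig_def trig_sign_def)
next
  case False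
  define u where "u w = of_real pi * (of_real a * w + of_real (1 - b))" for w :: complex
  define \<epsilon> where "\<epsilon> n = a * T n - of_int (round (a * T n))" for n
  define \<sigma> where "\<sigma> n = trig_sign a (T n)" for n
  have \<sigma>: "\<sigma> n = cos (pi * of_int (round (a * T n)))" for n using False by (simp add: \<sigma>_def trig_sign_def)
  have u0: "(\<lambda>n. u (w n)) \<longlonglongrightarrow> u w0" unfolding u_def by (intro tendsto_intros w)
  have du: "u (w n) - u w0 = of_real (pi * a) * (w n - w0)" for n by (simp add: u_def algebra_simps)
  have une: "u (w n) \<noteq> u w0" for n using du[of n] w(2)[of n] a by auto
  obtain c where c: "c > 0" "\<forall>\<^sub>F z in at (u w0). c * norm (z - u w0) \<le> norm (sin z)"
    using norm_sin_ge_linear by blast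
  have "filterlim (\<lambda>n. u (w n)) (at (u w0)) sequentially"
    unfolding filterlim_at using u0 une by auto
  from eventually_compose_filterlim[OF c(2) this]
  have ev: "\<forall>\<^sub>F n in sequentially. c * (pi * \<bar>a\<bar> * norm (w n - w0)) \<le> norm (sin (u (w n)))"
    by (simp add: du norm_mult abs_mult mult.assoc)
  have wpos: "norm (w n - w0) > 0" for n using w(2)[of n] by simp
  have small: "(\<lambda>n. sin (of_real (pi * \<epsilon> n)) / sin (u (w n))) \<longlonglongrightarrow> 0"
  proof (rule Lim_null_comparison)
    show "\<forall>\<^sub>F n in sequentially. norm (sin (complex_of_real (pi * \<epsilon> n)) / sin (u (w n))) \<le> pi / (c * (pi * \<bar>a\<bar>)) * \<bar>\<epsilon> n / norm (w n - w0)\<bar>"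
      using ev
    proof eventually_elim
      case (elim n)
      have "norm (sin (complex_of_real (pi * \<epsilon> n))) \<le> pi * \<bar>\<epsilon> n\<bar>"
        using abs_sin_x_le_abs_x[of "pi * \<epsilon> n"] unfolding sin_of_real norm_of_real by (simp add: abs_mult)
      then have "norm (sin (complex_of_real (pi * \<epsilon> n)) / sin (u (w n))) \<le> pi * \<bar>\<epsilon> n\<bar> / (c * (pi * \<bar>a\<bar> * norm (w n - w0)))"
        unfolding norm_divide using elim c a wpos[of n] by (intro frac_le) auto
      also have "\<dots> = pi / (c * (pi * \<bar>a\<bar>)) * \<bar>\<epsilon> n / norm (w n - w0)\<bar>"
        by (simp add: abs_divide)
      finally show ?case .
    qed
    have "(\<lambda>n. pi / (c * (pi * \<bar>a\<bar>)) * \<bar>\<epsilon> n / norm (w n - w0)\<bar>) \<longlonglongrightarrow> pi / (c * (pi * \<bar>a\<bar>)) * \<bar>0\<bar>"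
      unfolding \<epsilon>_def by (intro tendsto_mult tendsto_const tendsto_rabs T)
    then show "(\<lambda>n. pi / (c * (pi * \<bar>a\<bar>)) * \<bar>\<epsilon> n / norm (w n - w0)\<bar>) \<longlonglongrightarrow> 0" by simp
  qed
  have "(\<lambda>n. cos (complex_of_real (pi * \<epsilon> n))) \<longlonglongrightarrow> cos (of_real (pi * 0))"
    unfolding \<epsilon>_def by (intro tendsto_intros T)
  from tendsto_add[OF this tendsto_mult[OF tendsto_cos[OF u0] small]]
  have "(\<lambda>n. cos (of_real (pi * \<epsilon> n)) + cos (u (w n)) * (sin (of_real (pi * \<epsilon> n)) / sin (u (w n)))) \<longlonglongrightarrow> 1"
    by (rule tendsto_eq_rhs) simp
  from tendsto_inverse[OF this]
  have "(\<lambda>n. inverse (cos (of_real (pi * \<epsilon> n)) + cos (u (w n)) * (sin (of_real (pi * \<epsilon> n)) / sin (u (w n))))) \<longlonglongrightarrow> inverse 1"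
    by simp
  moreover have "\<forall>\<^sub>F n in sequentially. inverse (cos (of_real (pi * \<epsilon> n)) + cos (u (w n)) * (sin (of_real (pi * \<epsilon> n)) / sin (u (w n))))
     = of_real (trig_sign a (T n)) * (gam_trig a b (w n + of_real (T n)) / gam_trig a b (w n))"
    using ev
  proof eventually_elim
    case (elim n)
    have "0 < c * (pi * \<bar>a\<bar> * norm (w n - w0))" using c a wpos[of n] by (intro mult_pos_pos) auto
    then have sn: "sin (u (w n)) \<noteq> 0" using elim by auto
    have s2: "complex_of_real (\<sigma> n) * of_real (\<sigma> n) = 1"
    proof -
      have "\<sigma> n * \<sigma> n = 1" using abs_trig_sign[of a "T n"] unfolding \<sigma>_def[symmetric] by (metis abs_mult_self_eq mult_1)
      then show ?thesis by (simp flip: of_real_mult)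
    qed
    define m where "m = round (a * T n)"
    have arg: "u (w n + of_real (T n)) = (u (w n) + of_real (pi * \<epsilon> n)) + of_real (pi * of_int m)"
      by (simp add: u_def \<epsilon>_def m_def algebra_simps)
    have "sin (complex_of_real (pi * of_int m)) = of_real (sin (pi * of_int m))" "cos (complex_of_real (pi * of_int m)) = of_real (cos (pi * of_int m))"
      by (simp_all only: sin_of_real cos_of_real)
    then have sm: "sin (complex_of_real (pi * of_int m)) = 0" "cos (complex_of_real (pi * of_int m)) = of_real (\<sigma> n)"
      by (simp_all add: \<sigma> m_def sin_npi_int)
    have "sin (u (w n + of_real (T n))) = sin (u (w n) + of_real (pi * \<epsilon> n)) * of_real (\<sigma> n)"
      unfolding arg sin_add[of _ "of_real (pi * of_int m)"] sm by simp
    also have "sin (u (w n) + of_real (pi * \<epsilon> n)) = sin (u (w n)) * (cos (of_real (pi * \<epsilon> n)) + cos (u (w n)) * (sin (of_real (pi * \<epsilon> n)) / sin (u (w n))))"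
      using sn by (simp add: sin_add distrib_left)
    finally have S: "sin (u (w n + of_real (T n))) = sin (u (w n)) * (cos (of_real (pi * \<epsilon> n)) + cos (u (w n)) * (sin (of_real (pi * \<epsilon> n)) / sin (u (w n)))) * of_real (\<sigma> n)" (is "_ = _ * ?Q * _") .
    have "gam_trig a b (w n + of_real (T n)) / gam_trig a b (w n) = sin (u (w n)) / sin (u (w n + of_real (T n)))"
      using False by (simp add: gam_trig_def u_def)
    also have "\<dots> = inverse (?Q * of_real (\<sigma> n))" unfolding S using sn by (simp add: divide_inverse)
    finally have "of_real (\<sigma> n) * (gam_trig a b (w n + of_real (T n)) / gam_trig a b (w n)) = of_real (\<sigma> n) * inverse (of_real (\<sigma> n)) * inverse ?Q"
      by simp
    also have "of_real (\<sigma> n) * inverse (complex_of_real (\<sigma> n)) = 1" using s2 by (metis right_inverse mult_zero_left zero_neq_one)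
    finally show ?case by (simp add: \<sigma>_def)
  qed
  ultimately show ?thesis by (rule Lim_transform_eventually[THEN tendsto_eq_rhs]) simp
qed

section \<open>Translation by near-periods and clusters of poles\<close>

context gamma_type_params
begin

text \<open>The errors are at most 1 / (n + 1) and the distance to w0 is their square root scale, so
  the quotient required by \<open>gam_trig_near_period\<close> is at most 1 / sqrt (n + 1).\<close>

lemma atrig_near_period:
  fixes w :: "nat \<Rightarrow> complex"
  assumes w: "w \<longlonglongrightarrow> w0" "\<And>n. norm (w n - w0) = 1 / sqrt (real (Suc n))"
    and T: "\<And>n. \<forall>j\<in>{1..J}. \<exists>m::int. \<bar>a j * T n - of_int m\<bar> < 1 / real (Suc n)"
      "\<And>n. \<forall>k\<in>{1..K}. \<exists>m::int. \<bar>a' k * T n - of_int m\<bar> < 1 / real (Suc n)"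
  shows "(\<lambda>n. of_real ((\<Prod>j=1..J. trig_sign (a j) (T n)) / (\<Prod>k=1..K. trig_sign (a' k) (T n))) *
     (atrig (w n + of_real (T n)) / atrig (w n))) \<longlonglongrightarrow> 1"
proof -
  have wne: "w n \<noteq> w0" for n using w(2)[of n] by auto
  have one: "(\<lambda>n. of_real (trig_sign x (T n)) * (gam_trig x z (w n + of_real (T n)) / gam_trig x z (w n))) \<longlonglongrightarrow> 1"
    if x: "x \<noteq> 0" "\<And>n. \<exists>m::int. \<bar>x * T n - of_int m\<bar> < 1 / real (Suc n)" for x z
  proof -
    define \<epsilon> where "\<epsilon> n = x * T n - of_int (round (x * T n))" for n
    have \<epsilon>: "\<bar>\<epsilon> n\<bar> \<le> 1 / real (Suc n)" for n
    proof -
      obtain m :: int where "\<bar>x * T n - of_int m\<bar> < 1 / real (Suc n)" using x(2) by blast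
      then show ?thesis using round_diff_minimal[of "x * T n" m] by (simp add: \<epsilon>_def abs_minus_commute del: of_nat_Suc)
    qed
    have "(\<lambda>n. 1 / real (Suc n)) \<longlonglongrightarrow> 0" using LIMSEQ_Suc[OF lim_1_over_n] by simp
    then have e0: "\<epsilon> \<longlonglongrightarrow> 0" using \<epsilon> by (intro Lim_null_comparison[of \<epsilon>]) (auto intro!: always_eventually)
    have "(\<lambda>n. \<epsilon> n / norm (w n - w0)) \<longlonglongrightarrow> 0"
    proof (rule Lim_null_comparison)
      show "\<forall>\<^sub>F n in sequentially. norm (\<epsilon> n / norm (w n - w0)) \<le> 1 / sqrt (real (Suc n))"
      proof (intro always_eventually allI)
        fix n
        have "norm (\<epsilon> n / norm (w n - w0)) = \<bar>\<epsilon> n\<bar> * sqrt (real (Suc n))" by (simp add: w(2) abs_mult)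
        also have "\<dots> \<le> 1 / real (Suc n) * sqrt (real (Suc n))" using \<epsilon>[of n] by (intro mult_right_mono) auto
        also have "\<dots> = 1 / sqrt (real (Suc n))" 
        proof -
          have "1 / (s * s) * s = 1 / s" if "s > 0" for s :: real using that by simp
          from this[of "sqrt (real (Suc n))"] show ?thesis by (simp del: of_nat_Suc)
        qed
        finally show "norm (\<epsilon> n / norm (w n - w0)) \<le> 1 / sqrt (real (Suc n))" .
      qed
      show "(\<lambda>n. 1 / sqrt (real (Suc n))) \<longlonglongrightarrow> 0" by real_asymp
    qed
    then show ?thesis using e0 x(1) w(1) wne unfolding \<epsilon>_def by (intro gam_trig_near_period[of w w0]) auto
  qed
  have "(\<lambda>n. (\<Prod>j=1..J. of_real (trig_sign (a j) (T n)) * (gam_trig (a j) (b j) (w n + of_real (T n)) / gam_trig (a j) (b j) (w n)))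
     / (\<Prod>k=1..K. of_real (trig_sign (a' k) (T n)) * (gam_trig (a' k) (b' k) (w n + of_real (T n)) / gam_trig (a' k) (b' k) (w n))))
     \<longlonglongrightarrow> (\<Prod>j=1..J. 1) / (\<Prod>k=1..K. 1)"
    using a_nz a'_nz T by (intro tendsto_divide tendsto_prod one) auto
  moreover have "(\<Prod>j=1..J. of_real (trig_sign (a j) (T n)) * (gam_trig (a j) (b j) (w n + of_real (T n)) / gam_trig (a j) (b j) (w n)))
     / (\<Prod>k=1..K. of_real (trig_sign (a' k) (T n)) * (gam_trig (a' k) (b' k) (w n + of_real (T n)) / gam_trig (a' k) (b' k) (w n)))
     = of_real ((\<Prod>j=1..J. trig_sign (a j) (T n)) / (\<Prod>k=1..K. trig_sign (a' k) (T n))) *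
     (atrig (w n + of_real (T n)) / atrig (w n))" for n
  proof -
    have "(X * (A / B)) / (Y * (A' / B')) = (X / Y) * ((A / A') / (B / B'))" for X Y A B A' B' :: complex
      by (simp add: divide_inverse mult_ac)
    then show ?thesis unfolding atrig_def prod.distrib prod_dividef of_real_divide of_real_prod .
  qed
  ultimately show ?thesis by simp
qed

text \<open>The derivative of \<open>aexp\<close> is O(log |z|), hence O(log n) here because T is
  polynomially bounded; the factor 1 / sqrt (n + 1) wins. The bound x0 > 1 keeps the unit disc
  around x0 + T off the branch cut.\<close>

lemma aexp_difference_tendsto:
  fixes w :: "nat \<Rightarrow> complex" and x0 :: real
  assumes x0: "x0 > 1"
    and w: "\<And>n. norm (w n - of_real x0) = 1 / sqrt (real (Suc n))"
    and T: "\<And>n. real (Suc n) \<le> T n" "\<And>n. T n \<le> real (Suc n) ^ d"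
  shows "(\<lambda>n. aexp (w n + of_real (T n)) - aexp (of_real (x0 + T n))) \<longlonglongrightarrow> 0"
proof (rule Lim_null_comparison)
  define M where "M n = \<bar>\<gamma>'\<bar> * (ln (x0 + 2) + real d * ln (real (Suc n)) + pi) + \<bar>\<kappa>\<bar> + \<bar>\<beta>\<bar>" for n
  show "\<forall>\<^sub>F n in sequentially. norm (aexp (w n + of_real (T n)) - aexp (of_real (x0 + T n))) \<le> M n * (1 / sqrt (real (Suc n)))"
  proof (intro always_eventually allI)
    fix n
    have T1: "T n \<ge> 1" using T(1)[of n] by simp
    have r1: "1 / sqrt (real (Suc n)) \<le> 1" by simp
    have bd: "norm (z - of_real (x0 + T n)) \<le> 1 \<Longrightarrow> Re z \<ge> 1 \<and> norm z \<le> (x0 + 2) * T n" for z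
    proof -
      assume z: "norm (z - of_real (x0 + T n)) \<le> 1"
      have "\<bar>Re z - (x0 + T n)\<bar> \<le> 1" using abs_Re_le_cmod[of "z - of_real (x0 + T n)"] z by simp
      then have "Re z \<ge> 1" using x0 T1 by linarith
      have "norm z \<le> norm (z - of_real (x0 + T n)) + norm (complex_of_real (x0 + T n))"
        using norm_triangle_ineq[of "z - of_real (x0 + T n)" "of_real (x0 + T n)"] by simp
      also have "\<dots> \<le> 1 + (x0 + T n)" using z x0 T1 by (simp add: norm_of_real del: of_real_add)
      also have "\<dots> \<le> (x0 + 2) * T n"
        using mult_left_mono[OF T1, of "x0 + 1"] x0 by (simp add: algebra_simps)
      finally show "Re z \<ge> 1 \<and> norm z \<le> (x0 + 2) * T n" using \<open>Re z \<ge> 1\<close> by simp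
    qed
    have "norm (aexp (w n + of_real (T n)) - aexp (of_real (x0 + T n))) \<le> M n * norm (w n + of_real (T n) - of_real (x0 + T n))"
    proof (rule field_differentiable_bound[where S = "cball (of_real (x0 + T n)) 1" and f' = "\<lambda>z. of_real (- \<gamma>') * Ln z - of_real \<kappa> + of_real \<beta> / z"])
      fix z assume "z \<in> cball (complex_of_real (x0 + T n)) 1"
      then have z: "Re z \<ge> 1" "norm z \<le> (x0 + 2) * T n" using bd[of z] by (auto simp: dist_norm norm_minus_commute)
      have z0: "z \<noteq> 0" "z \<notin> \<real>\<^sub>\<le>\<^sub>0" using z by (auto simp: complex_nonpos_Reals_iff)
      show "(aexp has_field_derivative of_real (- \<gamma>') * Ln z - of_real \<kappa> + of_real \<beta> / z) (at z within cball (of_real (x0 + T n)) 1)"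
        unfolding aexp_def[abs_def] using z0 by (auto intro!: derivative_eq_intros simp: field_simps)
      have nz1: "norm z \<ge> 1" using z abs_Re_le_cmod[of z] by simp
      have "ln (norm z) \<le> ln ((x0 + 2) * T n)" using z nz1 by (intro ln_mono) auto
      also have "\<dots> = ln (x0 + 2) + ln (T n)" using x0 T1 by (simp add: ln_mult)
      also have "ln (T n) \<le> ln (real (Suc n) ^ d)" using T(2)[of n] T1 by (intro ln_mono) auto
      also have "\<dots> = real d * ln (real (Suc n))" by (simp add: ln_realpow del: of_nat_Suc)
      finally have l: "ln (norm z) \<le> ln (x0 + 2) + real d * ln (real (Suc n))" by simp
      have "norm (Ln z) \<le> \<bar>Re (Ln z)\<bar> + \<bar>Im (Ln z)\<bar>" by (rule cmod_le)
      also have "\<bar>Re (Ln z)\<bar> = ln (norm z)" using z0 nz1 by simp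
      also have "\<bar>Im (Ln z)\<bar> \<le> pi" using mpi_less_Im_Ln[OF z0(1)] Im_Ln_le_pi[OF z0(1)] by simp
      finally have L: "norm (Ln z) \<le> ln (x0 + 2) + real d * ln (real (Suc n)) + pi" using l by simp
      have "norm (of_real (- \<gamma>') * Ln z - of_real \<kappa> + of_real \<beta> / z) \<le> norm (of_real (- \<gamma>') * Ln z) + norm (complex_of_real \<kappa>) + norm (of_real \<beta> / z)"
        by (intro order_trans[OF norm_triangle_ineq] add_right_mono norm_triangle_ineq4)
      also have "norm (of_real (- \<gamma>') * Ln z) \<le> \<bar>\<gamma>'\<bar> * (ln (x0 + 2) + real d * ln (real (Suc n)) + pi)"
        unfolding norm_mult using L by (intro mult_mono) auto
      also have "norm (of_real \<beta> / z) \<le> \<bar>\<beta>\<bar> / 1"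
        unfolding norm_divide norm_of_real using nz1 by (intro frac_le) auto
      finally show "norm (of_real (- \<gamma>') * Ln z - of_real \<kappa> + of_real \<beta> / z) \<le> M n" by (simp add: M_def)
    next
      show "w n + of_real (T n) \<in> cball (of_real (x0 + T n)) 1"
        using w[of n] r1 by (simp add: dist_norm norm_minus_commute algebra_simps del: of_nat_Suc)
    qed auto
    also have "norm (w n + of_real (T n) - of_real (x0 + T n)) = 1 / sqrt (real (Suc n))" using w[of n] by simp
    finally show "norm (aexp (w n + of_real (T n)) - aexp (of_real (x0 + T n))) \<le> M n * (1 / sqrt (real (Suc n)))" .
  qed
  have "(\<lambda>n. (A * (B + real d * ln (real (Suc n)) + P) + E + G) * (1 / sqrt (real (Suc n)))) \<longlonglongrightarrow> 0" for A B P E G :: real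
    by real_asymp
  then show "(\<lambda>n. M n * (1 / sqrt (real (Suc n)))) \<longlonglongrightarrow> 0" unfolding M_def .
qed

lemma aexp_filterlim:
  assumes "\<gamma>' < 0 \<or> (\<gamma>' = 0 \<and> y > \<kappa>)"
  shows "filterlim (\<lambda>x. exp (Re (aexp (of_real x)) + y * x)) at_top at_top"
proof -
  have ev: "\<forall>\<^sub>F x in at_top. Re (aexp (of_real x)) + y * x = - \<gamma>' * (x * ln x - x) - \<kappa> * x + \<beta> * ln x + y * x"
    using eventually_gt_at_top[of 0] by eventually_elim (simp add: Re_aexp)
  moreover have "filterlim (\<lambda>x. - \<gamma>' * (x * ln x - x) - \<kappa> * x + \<beta> * ln x + y * x) at_top at_top"
    using assms
  proof
    assume g: "\<gamma>' < 0"
    have "filterlim (\<lambda>x. - g * (x * ln x - x) - k * x + b * ln x + y * x) at_top at_top" if "g < 0" for g k b :: real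
      using that by real_asymp
    from this[OF g] show ?thesis .
  next
    assume g: "\<gamma>' = 0 \<and> y > \<kappa>"
    have "filterlim (\<lambda>x. e * x + b * ln x) at_top at_top" if "e > 0" for e b :: real
      using that by real_asymp
    from this[of "y - \<kappa>" \<beta>] show ?thesis using g by (simp add: algebra_simps)
  qed
  ultimately have "filterlim (\<lambda>x. Re (aexp (of_real x)) + y * x) at_top at_top"
    unfolding filterlim_cong[OF refl refl ev] by simp
  then show ?thesis by (rule filterlim_compose[OF exp_at_top])
qed

lemma simple_pole_limit:
  assumes "is_pole F z" "pole_order F z = 1"
  obtains q where "q \<noteq> 0" "((\<lambda>s. (s - z) * F s) \<longlongrightarrow> q) (at z)"
proof -
  have z1: "zorder F z = -1" using assms(2) by (simp add: pole_order_def)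
  have "\<exists>\<^sub>F w in at z. F w \<noteq> 0"
    using non_zero_neighbour_pole[OF assms(1)] by (simp add: eventually_frequently)
  from zorder_exist[OF F_isolated F_not_essential this]
  obtain r where r: "zor_poly F z z \<noteq> 0" "r > 0" "zor_poly F z holomorphic_on cball z r"
    "\<forall>w\<in>cball z r - {z}. F w = zor_poly F z w * (w - z) powi zorder F z \<and> zor_poly F z w \<noteq> 0"
    by blast
  have "isCont (zor_poly F z) z"
    using r(2,3) holomorphic_on_imp_continuous_on continuous_on_interior[of "cball z r"] by force
  then have "(zor_poly F z \<longlongrightarrow> zor_poly F z z) (at z)" by (simp add: isCont_def)
  moreover have "\<forall>\<^sub>F s in at z. zor_poly F z s = (s - z) * F s"
    unfolding eventually_at using r by (intro exI[of _ r]) (auto simp: z1 power_int_minus dist_commute)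
  ultimately have "((\<lambda>s. (s - z) * F s) \<longlongrightarrow> zor_poly F z z) (at z)" by (rule Lim_transform_eventually)
  then show ?thesis by (rule that[OF r(1)])
qed

theorem pole_sum_diverges:
  assumes g: "\<gamma>' < 0 \<or> (\<gamma>' = 0 \<and> y > \<kappa>)"
    and inf: "infinite (neg_poles F)"
    and simple: "\<forall>\<rho>\<in>neg_poles F. pole_order F (of_real \<rho>) = 1"
  shows "outward_divergent (neg_poles F) (pole_term F y)"
proof -
  obtain l where l: "l \<noteq> 0" "(arest \<longlongrightarrow> l) at_Re_top" by (rule arest_asymp)
  have "\<forall>\<^sub>F w in at_Re_top. quot (-w) = of_real C * exp (aexp w) * atrig w * arest w \<and> isCont arest w \<and> arest w \<noteq> 0"
    using quot_factor arest_isCont tendsto_imp_eventually_ne[OF l(2,1)] by eventually_elim auto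
  then obtain X0 where X0: "\<And>w. Re w \<ge> X0 \<Longrightarrow> quot (-w) = of_real C * exp (aexp w) * atrig w * arest w \<and> isCont arest w \<and> arest w \<noteq> 0"
    unfolding eventually_at_Re_top by blast
  \<comment> \<open>The pole is taken so far to the left that the factorization of
    \<open>quot\<close> holds in a neighbourhood of w0 and after translation by T.\<close>
  have "neg_poles F - {\<rho> \<in> neg_poles F. - (max X0 1) - 1 < \<rho>} \<noteq> {}"
    using inf finite_neg_poles by (metis Diff_infinite_finite finite.emptyI)
  then obtain \<rho>0 where "\<rho>0 \<in> neg_poles F - {\<rho> \<in> neg_poles F. - (max X0 1) - 1 < \<rho>}" by blast
  then have \<rho>0: "\<rho>0 \<in> neg_poles F" "\<rho>0 \<le> - (max X0 1) - 1" unfolding Diff_iff mem_Collect_eq by argo+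
  define x0 where "x0 = - \<rho>0"
  define w0 where "w0 = complex_of_real x0"
  have x0: "x0 > 1" "x0 \<ge> X0 + 1" using \<rho>0 by (auto simp: x0_def)
  have pole0: "is_pole F (of_real \<rho>0)" "pole_order F (of_real \<rho>0) = 1" using \<rho>0 simple by (auto simp: neg_poles_def)
  obtain q0 where q0: "q0 \<noteq> 0" "((\<lambda>s. (s - of_real \<rho>0) * F s) \<longlongrightarrow> q0) (at (of_real \<rho>0))"
    by (rule simple_pole_limit[OF pole0])
  define d where "d = Suc (J + K)"
  have "\<exists>T. real (Suc n) \<le> T \<and> T \<le> real (Suc n) ^ d \<and>
    (\<forall>j\<in>{1..J}. \<exists>m::int. \<bar>a j * T - of_int m\<bar> < 1 / real (Suc n)) \<and> (\<forall>k\<in>{1..K}. \<exists>m::int. \<bar>a' k * T - of_int m\<bar> < 1 / real (Suc n))" for n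
    unfolding d_def by (rule simultaneous_near_period[of "Suc n" J K a a']) (simp, blast)
  then obtain T where T: "\<And>n. real (Suc n) \<le> T n" "\<And>n. T n \<le> real (Suc n) ^ d"
    "\<And>n. \<forall>j\<in>{1..J}. \<exists>m::int. \<bar>a j * T n - of_int m\<bar> < 1 / real (Suc n)"
    "\<And>n. \<forall>k\<in>{1..K}. \<exists>m::int. \<bar>a' k * T n - of_int m\<bar> < 1 / real (Suc n)"
    by metis
  have T1: "T n \<ge> 1" for n using T(1)[of n] by simp
  have Ttop: "filterlim T at_top sequentially"
    by (rule filterlim_at_top_mono[OF filterlim_compose[OF filterlim_real_sequentially filterlim_Suc]]) (use T(1) in simp)
  define \<sigma> where "\<sigma> n = (\<Prod>j=1..J. trig_sign (a j) (T n)) / (\<Prod>k=1..K. trig_sign (a' k) (T n))" for n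
  have \<sigma>1: "\<bar>\<sigma> n\<bar> = 1" for n by (simp add: \<sigma>_def abs_divide abs_prod)
  have \<sigma>2: "complex_of_real (\<sigma> n) * of_real (\<sigma> n) = 1" for n
  proof -
    have "\<sigma> n * \<sigma> n = 1" using \<sigma>1[of n] by (metis abs_mult_self_eq mult_1)
    then show ?thesis by (simp flip: of_real_mult)
  qed
  define r where "r n = 1 / sqrt (real (Suc n))" for n
  have r: "r n > 0" "r \<longlonglongrightarrow> 0" for n unfolding r_def by (simp, real_asymp)
  \<comment> \<open>Predicted magnitude of the cluster total: the smooth exponential at x0 + T n,
    the accumulated sign and the kernel.\<close>
  define U where "U n = of_real (\<sigma> n) * exp (aexp (of_real (x0 + T n))) * of_real (exp (y * (x0 + T n)))" for n
  define \<Phi> where "\<Phi> n w = (w - w0) * quot (- (w + of_real (T n))) * exp (of_real y * (w + of_real (T n)))" for n w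
  \<comment> \<open>The limit of (w - w0) * quot (- w) is - q0, because s = - w reverses
    orientation. Dividing by exp (aexp w0) * arest w0 leaves the trigonometric part; far out
    \<open>arest\<close> contributes its limit l instead.\<close>
  define q where "q = - q0 / exp (aexp w0) * (l / arest w0)"
  have Uz: "U n \<noteq> 0" for n using \<sigma>1[of n] by (auto simp: U_def)
  have ar0: "arest w0 \<noteq> 0" "isCont arest w0" using X0[of w0] x0 by (auto simp: w0_def)
  then have qz: "q \<noteq> 0" using q0 l by (simp add: q_def)
  have lim: "(\<lambda>n. \<Phi> n (w n) / U n) \<longlonglongrightarrow> q" if w: "\<And>n. norm (w n - w0) = r n" for w
  proof -
    have wne: "w n \<noteq> w0" for n using w[of n] r(1)[of n] by auto
    have "(\<lambda>n. norm (w n - w0)) \<longlonglongrightarrow> 0" using r(2) w by simp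
    then have wlim: "w \<longlonglongrightarrow> w0" using Lim_null tendsto_norm_zero_iff by blast
    have Rew: "(\<lambda>n. Re (w n)) \<longlonglongrightarrow> x0" using tendsto_Re[OF wlim] by (simp add: w0_def)
    have ReX: "\<forall>\<^sub>F n in sequentially. Re (w n) > X0" by (rule order_tendstoD[OF Rew]) (use x0 in simp)
    have w0m: "- w0 = of_real \<rho>0" by (simp add: w0_def x0_def)
    have "- w n \<noteq> of_real \<rho>0" for n unfolding w0m[symmetric] using wne[of n] by simp
    then have wat: "filterlim (\<lambda>n. - w n) (at (of_real \<rho>0)) sequentially"
      unfolding filterlim_at using tendsto_minus[OF wlim] by (auto simp: w0m)
    have "\<forall>\<^sub>F s in at (of_real \<rho>0). F s = quot s"
      unfolding F_eq_remove_sings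
      by (intro eventually_remove_sings_eq_at meromorphic_on_isolated_singularity meromorphic_on_subset[OF quot_meromorphic]) auto
    from eventually_compose_filterlim[OF this wat] have Fq: "\<forall>\<^sub>F n in sequentially. F (- w n) = quot (- w n)" .
    have "(\<lambda>n. - ((- w n - of_real \<rho>0) * F (- w n))) \<longlonglongrightarrow> - q0"
      by (intro tendsto_minus filterlim_compose[OF q0(2) wat])
    moreover have "\<forall>\<^sub>F n in sequentially. - ((- w n - of_real \<rho>0) * F (- w n)) = (w n - w0) * quot (- w n)"
      using Fq by eventually_elim (simp add: w0_def x0_def algebra_simps)
    ultimately have L1: "(\<lambda>n. (w n - w0) * quot (- w n)) \<longlonglongrightarrow> - q0" by (rule Lim_transform_eventually)
    have nz: "\<forall>\<^sub>F n in sequentially. (w n - w0) * quot (- w n) \<noteq> 0"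
      by (rule tendsto_imp_eventually_ne[OF L1]) (use q0 in simp)
    have w0n: "w0 \<notin> \<real>\<^sub>\<le>\<^sub>0" using x0 by (auto simp: w0_def complex_nonpos_Reals_iff)
    have L2: "(\<lambda>n. exp (aexp (w n))) \<longlonglongrightarrow> exp (aexp w0)"
      unfolding aexp_def using w0n by (intro tendsto_intros wlim)
    have L3: "(\<lambda>n. exp (aexp (w n + of_real (T n)) - aexp (of_real (x0 + T n)))) \<longlonglongrightarrow> exp 0"
      by (intro tendsto_exp aexp_difference_tendsto[where d = d] x0 T) (use w in \<open>simp_all add: w0_def r_def\<close>)
    have L4: "(\<lambda>n. of_real (\<sigma> n) * (atrig (w n + of_real (T n)) / atrig (w n))) \<longlonglongrightarrow> 1"
      unfolding \<sigma>_def by (rule atrig_near_period[OF wlim _ T(3,4)]) (simp add: w r_def)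
    have "filterlim (\<lambda>n. w n + of_real (T n)) at_Re_top sequentially"
      using filterlim_tendsto_add_at_top[OF Rew Ttop] by (simp add: filterlim_filtercomap_iff o_def)
    from filterlim_compose[OF l(2) this] have L5: "(\<lambda>n. arest (w n + of_real (T n))) \<longlonglongrightarrow> l" .
    have L6: "(\<lambda>n. arest (w n)) \<longlonglongrightarrow> arest w0" by (rule isCont_tendsto_compose[OF ar0(2) wlim])
    have L7: "(\<lambda>n. exp (of_real y * (w n - w0))) \<longlonglongrightarrow> exp (of_real y * (w0 - w0))"
      by (intro tendsto_intros wlim)
    have Lbig: "(\<lambda>n. ((w n - w0) * quot (- w n)) / exp (aexp (w n)) * exp (aexp (w n + of_real (T n)) - aexp (of_real (x0 + T n)))
       * (of_real (\<sigma> n) * (atrig (w n + of_real (T n)) / atrig (w n))) * (arest (w n + of_real (T n)) / arest (w n)) * exp (of_real y * (w n - w0)))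
       \<longlonglongrightarrow> - q0 / exp (aexp w0) * exp 0 * 1 * (l / arest w0) * exp (of_real y * (w0 - w0))"
      by (intro tendsto_mult tendsto_divide L1 L2 L3 L4 L5 L6 L7) (use ar0 in auto)
    have qeq: "- q0 / exp (aexp w0) * exp 0 * 1 * (l / arest w0) * exp (of_real y * (w0 - w0)) = q" by (simp add: q_def)
    have "\<forall>\<^sub>F n in sequentially. ((w n - w0) * quot (- w n)) / exp (aexp (w n)) * exp (aexp (w n + of_real (T n)) - aexp (of_real (x0 + T n)))
       * (of_real (\<sigma> n) * (atrig (w n + of_real (T n)) / atrig (w n))) * (arest (w n + of_real (T n)) / arest (w n)) * exp (of_real y * (w n - w0))
       = \<Phi> n (w n) / U n"
      using nz ReX
    proof eventually_elim
      case (elim n)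
      define v where "v = w n + of_real (T n)"
      have "Re v \<ge> X0" using elim T1[of n] by (simp add: v_def)
      then have Q1: "quot (- v) = of_real C * exp (aexp v) * atrig v * arest v" using X0 by blast
      have Q2: "quot (- w n) = of_real C * exp (aexp (w n)) * atrig (w n) * arest (w n)" using X0[of "w n"] elim by simp
      have nn: "complex_of_real C \<noteq> 0" "atrig (w n) \<noteq> 0" "arest (w n) \<noteq> 0" using elim unfolding Q2 by auto
      have E: "exp (of_real y * v) = exp (of_real y * (w n - w0)) * complex_of_real (exp (y * (x0 + T n)))"
      proof -
        have "of_real y * v = of_real y * (w n - w0) + of_real (y * (x0 + T n))" by (simp add: v_def w0_def algebra_simps)
        then show ?thesis by (simp only: exp_add exp_of_real)
      qed
      have gen: "(W * (c * e1 * t1 * s1)) / e1 * (e2 / e3) * (g * (t2 / t1)) * (s2 / s1) * Y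
         = W * (c * e2 * t2 * s2) * (Y * Z) / (g * e3 * Z)"
        if "e1 \<noteq> 0" "t1 \<noteq> 0" "s1 \<noteq> 0" "e3 \<noteq> 0" "Z \<noteq> 0" "g * g = 1" for W c e1 t1 s1 e2 e3 g t2 s2 Y Z :: complex
      proof -
        have "g \<noteq> 0" using that(6) by auto
        have "inverse g = g" using that(6) by (metis inverse_unique)
        have "W * (c * e2 * t2 * s2) * (Y * Z) / (g * e3 * Z) = W * (c * e2 * t2 * s2) * Y / e3 * inverse g"
          using that \<open>g \<noteq> 0\<close> by (simp add: field_simps)
        also have "\<dots> = (W * (c * e1 * t1 * s1)) / e1 * (e2 / e3) * (g * (t2 / t1)) * (s2 / s1) * Y"
          unfolding \<open>inverse g = g\<close> using that(1-5) by (simp add: field_simps)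
        finally show ?thesis ..
      qed
      have "((w n - w0) * quot (- w n)) / exp (aexp (w n)) * (exp (aexp v) / exp (aexp (of_real (x0 + T n))))
       * (of_real (\<sigma> n) * (atrig v / atrig (w n))) * (arest v / arest (w n)) * exp (of_real y * (w n - w0))
       = (w n - w0) * quot (- v) * (exp (of_real y * (w n - w0)) * complex_of_real (exp (y * (x0 + T n)))) / (of_real (\<sigma> n) * exp (aexp (of_real (x0 + T n))) * complex_of_real (exp (y * (x0 + T n))))"
        unfolding Q1 Q2 by (rule gen) (use nn \<sigma>2 in auto)
      then show ?case unfolding exp_diff \<Phi>_def U_def v_def[symmetric] E .
    qed
    from Lim_transform_eventually[OF Lbig this] show ?thesis unfolding qeq .
  qed
  \<comment> \<open>\<open>lim\<close> holds for every choice of points on the circles. Applied to a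
    sequence of points violating the bound wherever there are any, it yields uniformity.\<close>
  have unif: "\<forall>\<^sub>F n in sequentially. \<forall>w. norm (w - w0) = r n \<longrightarrow> norm (\<Phi> n w / U n - q) \<le> norm q / 2"
  proof -
    define bad where "bad n w \<longleftrightarrow> norm (w - w0) = r n \<and> \<not> norm (\<Phi> n w / U n - q) \<le> norm q / 2" for n w
    define w where "w n = (if \<exists>w. bad n w then SOME w. bad n w else w0 + of_real (r n))" for n
    have wbad: "bad n (w n)" if "\<exists>w. bad n w" for n using that someI_ex[OF that] by (simp add: w_def)
    have "norm (w n - w0) = r n" for n
    proof (cases "\<exists>w. bad n w")
      case True
      then show ?thesis using wbad by (auto simp: bad_def)
    next
      case False
      then show ?thesis using r(1)[of n] by (simp add: w_def)
    qed
    from tendstoD[OF lim[OF this], of "norm q / 2"] qz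
    have "\<forall>\<^sub>F n in sequentially. dist (\<Phi> n (w n) / U n) q < norm q / 2" by simp
    then show ?thesis
    proof eventually_elim
      case (elim n)
      then have "\<not> bad n (w n)" by (simp add: bad_def dist_norm)
      then show ?case using wbad by (auto simp: bad_def)
    qed
  qed
  define \<Lambda> where "\<Lambda> = {x. \<rho>0 - 1 \<le> x \<and> x \<le> \<rho>0 + 1 \<and> (\<exists>j\<in>{1..J}. \<exists>m::int. a j * x + b j = of_int m)}"
  have "finite \<Lambda>" unfolding \<Lambda>_def by (rule finite_lattice_strip)
  from finite_set_avoid[OF this, of \<rho>0] obtain e where e: "e > 0" "\<And>x. x \<in> \<Lambda> \<Longrightarrow> x \<noteq> \<rho>0 \<Longrightarrow> e \<le> dist \<rho>0 x" by blast
  \<comment> \<open>Small enough that \<rho>0 is the only lattice point within 2 \<epsilon> and that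
    the disc of radius 3 \<epsilon> / 2 around z n stays in the left half-plane.\<close>
  define \<epsilon> where "\<epsilon> = min e 1 / 4"
  have \<epsilon>: "\<epsilon> > 0" "2 * \<epsilon> < e" "\<epsilon> \<le> 1 / 4" using e(1) by (auto simp: \<epsilon>_def)
  define z where "z n = \<rho>0 - T n" for n
  define A where "A = (\<Sum>j=1..J. 1 / \<bar>a j\<bar>)"
  have A: "1 / \<bar>a j\<bar> \<le> A" if "j \<in> {1..J}" for j unfolding A_def using that by (intro member_le_sum) auto
  have A0: "A \<ge> 0" unfolding A_def by (intro sum_nonneg) auto
  have evA: "\<forall>\<^sub>F n in sequentially. A / real (Suc n) < r n" "\<forall>\<^sub>F n in sequentially. r n < \<epsilon> / 2" "\<forall>\<^sub>F n in sequentially. A / real (Suc n) < \<epsilon> / 2"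
  proof -
    show "\<forall>\<^sub>F n in sequentially. r n < \<epsilon> / 2" by (rule order_tendstoD[OF r(2)]) (use \<epsilon> in simp)
    have "(\<lambda>n. A / real (Suc n)) \<longlonglongrightarrow> 0" by real_asymp
    then show "\<forall>\<^sub>F n in sequentially. A / real (Suc n) < \<epsilon> / 2" by (rule order_tendstoD) (use \<epsilon> in simp)
    have "(\<lambda>n. A / sqrt (real (Suc n))) \<longlonglongrightarrow> 0" by real_asymp
    then have "\<forall>\<^sub>F n in sequentially. A / sqrt (real (Suc n)) < 1" by (rule order_tendstoD) simp
    then show "\<forall>\<^sub>F n in sequentially. A / real (Suc n) < r n"
    proof eventually_elim
      case (elim n)
      have "s > 0 \<Longrightarrow> A / s < 1 \<Longrightarrow> A / (s * s) < 1 / s" for s :: real by (simp add: field_simps)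
      from this[of "sqrt (real (Suc n))"] elim show ?case by (simp add: r_def del: of_nat_Suc)
    qed
  qed
  \<comment> \<open>Translating x by T n and correcting by \<eta> gives a point of the same lattice
    within 2 \<epsilon> of \<rho>0, hence \<rho>0 itself. So x is within |\<eta>| \<le> A / (n + 1)
    of z n: around z n there is a tight cluster and then a gap.\<close>
  have near: "\<bar>x - z n\<bar> < r n"
    if n: "A / real (Suc n) < r n" "A / real (Suc n) < \<epsilon> / 2" and x: "\<exists>j\<in>{1..J}. \<exists>m::int. a j * x + b j = of_int m" "\<bar>x - z n\<bar> \<le> 3 * \<epsilon> / 2" for n x
  proof -
    obtain j m where j: "j \<in> {1..J}" "a j * x + b j = of_int m" using x by blast
    obtain m' :: int where m': "\<bar>a j * T n - of_int m'\<bar> < 1 / real (Suc n)" using T(3) j(1) by blast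
    have aj: "a j \<noteq> 0" using a_nz j by blast
    define \<eta> where "\<eta> = (a j * T n - of_int m') / a j"
    have \<eta>: "\<bar>\<eta>\<bar> \<le> A / real (Suc n)"
    proof -
      have "\<bar>\<eta>\<bar> = \<bar>a j * T n - of_int m'\<bar> * (1 / \<bar>a j\<bar>)" by (simp add: \<eta>_def abs_divide)
      also have "\<dots> \<le> (1 / real (Suc n)) * A" using m' A[OF j(1)] by (intro mult_mono) auto
      finally show ?thesis by simp
    qed
    define x' where "x' = x + T n - \<eta>"
    have "a j * \<eta> = a j * T n - of_int m'" using aj by (simp add: \<eta>_def)
    then have "a j * x' + b j = of_int (m + m')" using j(2) by (simp add: x'_def algebra_simps)
    moreover have near': "\<bar>x' - \<rho>0\<bar> < 2 * \<epsilon>" using x(2) n(2) \<eta> unfolding x'_def z_def by linarith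
    moreover have "\<rho>0 - 1 \<le> x'" "x' \<le> \<rho>0 + 1" using near' \<epsilon> by linarith+
    ultimately have "x' \<in> \<Lambda>" using j(1) unfolding \<Lambda>_def by blast
    then have "x' = \<rho>0" using e(2)[of x'] near' \<epsilon>(2) unfolding dist_real_def by argo
    then have "x - z n = \<eta>" by (simp add: x'_def z_def)
    then show ?thesis using \<eta> n(1) by simp
  qed
  have zneg: "z n + 3 * \<epsilon> / 2 < 0" for n using x0 T1[of n] \<epsilon> by (simp add: z_def x0_def)
  have lattice: "\<exists>j\<in>{1..J}. \<exists>m::int. a j * \<rho> + b j = of_int m" if "\<rho> \<in> neg_poles F" for \<rho>
    using that S0_lattice(2)[OF pole_in_S0, of "of_real \<rho>"] by (simp add: neg_poles_def)
  define P where "P n = {\<rho> \<in> neg_poles F. \<bar>\<rho> - z n\<bar> < r n}" for n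
  \<comment> \<open>On the circle the integrand divided by U n differs from - q / (s - z n) by at
    most |q| / (2 r n). The error in the integral is at most pi |q|, half of the main term 2 pi
    |q|.\<close>
  have big: "\<forall>\<^sub>F n in sequentially. norm (\<Sum>\<rho>\<in>P n. pole_term F y \<rho>) \<ge> norm (U n) * (norm q / 2)"
    using unif evA
  proof eventually_elim
    case (elim n)
    let ?f = "\<lambda>s. F s * exp (- of_real y * s)"
    let ?g = "circlepath (of_real (z n)) (r n)"
    let ?V = "ball (complex_of_real (z n)) (3 * \<epsilon> / 2)"
    have S0near: "norm (s - of_real (z n)) < r n" if "s \<in> S0" "norm (s - of_real (z n)) \<le> 3 * \<epsilon> / 2" for s
    proof -
      have "s = of_real (Re s)" using S0_lattice(1)[OF that(1)] by (simp add: complex_eq_iff)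
      then have "norm (s - of_real (z n)) = \<bar>Re s - z n\<bar>" by (metis norm_of_real of_real_diff)
      then show ?thesis using near[of n "Re s"] elim S0_lattice(2)[OF that(1)] that(2) by simp
    qed
    have circ: "norm (s - of_real (z n)) = r n" if "s \<in> path_image ?g" for s
      using that r(1)[of n] by (simp add: path_image_circlepath dist_norm norm_minus_commute)
    have circS0: "s \<notin> S0" if "norm (s - of_real (z n)) = r n" for s
    proof
      assume "s \<in> S0"
      moreover have "norm (s - of_real (z n)) \<le> 3 * \<epsilon> / 2" using that elim(3) \<epsilon>(1) by linarith
      ultimately show False using S0near[of s] that by simp
    qed
    have I: "contour_integral ?g ?f = 2 * pi * \<i> * (\<Sum>\<rho>\<in>P n. pole_term F y \<rho>)"
    proof (rule residue_sum[of ?V])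
      show "finite (S0 \<inter> ?V)"
      proof (rule finite_subset[OF _ finite_S0_strip[of "z n - 3 * \<epsilon> / 2" "z n + 3 * \<epsilon> / 2"]])
        have "z n - 3 * \<epsilon> / 2 \<le> Re s \<and> Re s \<le> z n + 3 * \<epsilon> / 2" if "s \<in> ?V" for s
          using that abs_Re_le_cmod[of "s - of_real (z n)"] by (auto simp: dist_norm norm_minus_commute)
        then show "S0 \<inter> ?V \<subseteq> {s \<in> S0. z n - 3 * \<epsilon> / 2 \<le> Re s \<and> Re s \<le> z n + 3 * \<epsilon> / 2}" by blast
      qed
      show "path_image ?g \<subseteq> ?V - S0"
      proof
        fix s assume "s \<in> path_image ?g"
        then have "norm (s - of_real (z n)) = r n" by (rule circ)
        then show "s \<in> ?V - S0" using circS0[of s] elim(3) \<epsilon>(1) by (simp add: dist_norm norm_minus_commute)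
      qed
      show "winding_number ?g s = 0" if "s \<notin> ?V" for s
      proof (rule winding_number_zero_outside[of _ "cball (of_real (z n)) (r n)"])
        show "s \<notin> cball (of_real (z n)) (r n)" using that elim \<epsilon> by auto
        show "path_image ?g \<subseteq> cball (of_real (z n)) (r n)" using circ by (force simp: dist_norm norm_minus_commute)
      qed auto
      show "P n \<subseteq> neg_poles F" by (auto simp: P_def)
      show "of_real ` P n \<subseteq> ?V"
      proof
        fix s assume "s \<in> complex_of_real ` P n"
        then obtain \<rho> where "s = of_real \<rho>" "\<bar>\<rho> - z n\<bar> < r n" by (auto simp: P_def)
        moreover have "dist (z n) \<rho> = \<bar>\<rho> - z n\<bar>" by (simp add: dist_real_def abs_minus_commute)
        ultimately show "s \<in> ?V" using elim(3) \<epsilon>(1) by simp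
      qed
      show "winding_number ?g (of_real \<rho>) = 1" if "\<rho> \<in> P n" for \<rho>
        using that by (intro winding_number_circlepath) (auto simp: P_def simp flip: of_real_diff)
      show "winding_number ?g s = 0" if s: "is_pole F s" "s \<in> ?V" "s \<notin> of_real ` P n" for s
      proof -
        have sr: "s = of_real (Re s)" by (rule pole_real[OF s(1)])
        have n1: "norm (s - of_real (z n)) < r n" using S0near[OF pole_in_S0[OF s(1)]] s(2) by (simp add: dist_norm norm_minus_commute)
        then have n2: "\<bar>Re s - z n\<bar> < r n" using abs_Re_le_cmod[of "s - of_real (z n)"] by simp
        then have "Re s < 0" using zneg[of n] elim \<epsilon> by linarith
        then have "Re s \<in> P n" using s(1) sr n2 by (simp add: P_def neg_poles_def)
        then show ?thesis using s(3) sr by blast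
      qed
    qed auto
    have fi: "?f contour_integrable_on ?g"
      using circS0 r(1)[of n]
      by (intro contour_integrable_continuous_circlepath kernel_continuous_on) (auto simp: path_image_circlepath dist_norm norm_minus_commute)
    have h1: "((\<lambda>s. ?f s / U n) has_contour_integral contour_integral ?g ?f / U n) ?g"
      by (intro has_contour_integral_div has_contour_integral_integral fi)
    have h2: "((\<lambda>s. q / (s - of_real (z n))) has_contour_integral 2 * of_real pi * \<i> * q) ?g"
      using Cauchy_integral_circlepath_simple[of "\<lambda>_. q" "of_real (z n)" "r n" "of_real (z n)"] r(1)[of n] by auto
    have "norm (contour_integral ?g ?f / U n + 2 * of_real pi * \<i> * q) \<le> norm q / (2 * r n) * (2 * pi * r n)"
    proof (rule has_contour_integral_bound_circlepath[OF has_contour_integral_add[OF h1 h2]])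
      fix s :: complex assume s: "norm (s - of_real (z n)) = r n"
      define w where "w = - s - of_real (T n)"
      have ww: "w - w0 = - (s - of_real (z n))" by (simp add: w_def w0_def x0_def z_def)
      then have "norm (w - w0) = r n" using s by (simp add: norm_minus_commute)
      then have "norm (\<Phi> n w / U n - q) \<le> norm q / 2" using elim by blast
      moreover have "\<Phi> n w = - ((s - of_real (z n)) * ?f s)"
      proof -
        have "w + of_real (T n) = - s" by (simp add: w_def)
        then show ?thesis unfolding \<Phi>_def ww F_eq_quot[OF circS0[OF s]] by (simp add: algebra_simps)
      qed
      moreover have mm: "- X / V - q = - (X / V + q)" for X V :: complex by simp
      ultimately have "norm (- (((s - of_real (z n)) * ?f s) / U n + q)) \<le> norm q / 2" by (simp only: mm)
      then have *: "norm (((s - of_real (z n)) * ?f s) / U n + q) \<le> norm q / 2" unfolding norm_minus_cancel .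
      have sz: "s - of_real (z n) \<noteq> 0" using s r(1)[of n] by auto
      have "?f s / U n + q / (s - of_real (z n)) = (((s - of_real (z n)) * ?f s) / U n + q) / (s - of_real (z n))"
        using sz Uz[of n] by (simp add: add_divide_distrib)
      then have "norm (?f s / U n + q / (s - of_real (z n))) = norm (((s - of_real (z n)) * ?f s) / U n + q) / r n"
        by (simp add: norm_divide s)
      also have "\<dots> \<le> (norm q / 2) / r n" using * r(1)[of n] by (intro divide_right_mono) auto
      finally show "norm (?f s / U n + q / (s - of_real (z n))) \<le> norm q / (2 * r n)" by simp
    qed (use r(1)[of n] in auto)
    also have "norm q / (2 * r n) * (2 * pi * r n) = pi * norm q" using r(1)[of n] by simp
    finally have B: "norm (contour_integral ?g ?f / U n + 2 * of_real pi * \<i> * q) \<le> pi * norm q" .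
    have "norm (2 * of_real pi * \<i> * q) \<le> norm (contour_integral ?g ?f / U n + 2 * of_real pi * \<i> * q) + norm (contour_integral ?g ?f / U n)"
    proof -
      have "norm Z \<le> norm (X + Z) + norm X" for X Z :: complex using norm_triangle_ineq4[of "X + Z" X] by simp
      then show ?thesis by blast
    qed
    moreover have "norm (2 * of_real pi * \<i> * q) = 2 * pi * norm q" by (simp add: norm_mult)
    ultimately have "pi * norm q \<le> norm (contour_integral ?g ?f / U n)" using B by linarith
    also have "\<dots> = 2 * pi * norm (\<Sum>\<rho>\<in>P n. pole_term F y \<rho>) / norm (U n)"
      unfolding I by (simp add: norm_mult norm_divide)
    finally have "pi * (norm q * norm (U n)) \<le> pi * (2 * norm (\<Sum>\<rho>\<in>P n. pole_term F y \<rho>))"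
      using Uz[of n] by (simp add: field_simps)
    then have "norm q * norm (U n) \<le> 2 * norm (\<Sum>\<rho>\<in>P n. pole_term F y \<rho>)" by simp
    then show ?case by (simp add: field_simps)
  qed
  have Utop: "filterlim (\<lambda>n. norm (U n)) at_top sequentially"
  proof -
    have "filterlim (\<lambda>n. x0 + T n) at_top sequentially" by (rule filterlim_tendsto_add_at_top[OF tendsto_const Ttop])
    from filterlim_compose[OF aexp_filterlim[OF g] this]
    have "filterlim (\<lambda>n. exp (Re (aexp (of_real (x0 + T n))) + y * (x0 + T n))) at_top sequentially" .
    moreover have "norm (U n) = exp (Re (aexp (of_real (x0 + T n))) + y * (x0 + T n))" for n
      using \<sigma>1[of n] by (simp add: U_def norm_mult exp_add)
    ultimately show ?thesis by simp
  qed
  show ?thesis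
    unfolding outward_divergent_def
  proof (rule notI, elim exE)
    fix L assume L: "has_outward_sum (neg_poles F) (pole_term F y) L"
    have "\<forall>\<^sub>F n in sequentially. A / real (Suc n) < r n \<and> r n < \<epsilon> / 2 \<and> A / real (Suc n) < \<epsilon> / 2"
      using evA by eventually_elim auto
    then obtain n0 where n0: "\<And>n. n \<ge> n0 \<Longrightarrow> A / real (Suc n) < r n \<and> r n < \<epsilon> / 2 \<and> A / real (Suc n) < \<epsilon> / 2"
      by (auto simp: eventually_sequentially)
    have nearP: "\<bar>\<rho> - z n\<bar> < r n" if "n \<ge> n0" "\<rho> \<in> neg_poles F" "\<bar>\<rho> - z n\<bar> \<le> 3 * \<epsilon> / 2" for n \<rho>
      using near n0[OF that(1)] lattice[OF that(2)] that(3) by blast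
    define S where "S R = (\<Sum>\<rho>\<in>{\<rho>\<in>neg_poles F. - R < \<rho>}. pole_term F y \<rho>)" for R
    \<comment> \<open>Cut-offs at distance \<epsilon> on either side of the cluster lie in the gap
      and stay \<epsilon>/2 away from all poles. The index is shifted by n0 because
      \<open>has_outward_sum\<close> demands this for every n, not only eventually.\<close>
    have conv: "(\<lambda>n. S (- z (n + n0) + s * \<epsilon>)) \<longlonglongrightarrow> L" if s: "s = 1 \<or> s = -1" for s
    proof -
      have "filterlim (\<lambda>n. (x0 + s * \<epsilon>) + T (n + n0)) at_top sequentially"
        by (intro filterlim_tendsto_add_at_top[OF tendsto_const] filterlim_compose[OF Ttop filterlim_add_const_nat_at_top])
      then have "filterlim (\<lambda>n. - z (n + n0) + s * \<epsilon>) at_top sequentially" by (simp add: z_def x0_def algebra_simps)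
      moreover have "\<epsilon> / 2 \<le> \<bar>\<rho> - (- (- z (n + n0) + s * \<epsilon>))\<bar>" if "\<rho> \<in> neg_poles F" for \<rho> n
      proof (rule ccontr)
        assume "\<not> \<epsilon> / 2 \<le> \<bar>\<rho> - (- (- z (n + n0) + s * \<epsilon>))\<bar>"
        moreover have "s * \<epsilon> = \<epsilon> \<or> s * \<epsilon> = - \<epsilon>" using s by fastforce
        ultimately have c: "\<bar>\<rho> - z (n + n0)\<bar> \<le> 3 * \<epsilon> / 2" "\<epsilon> / 2 < \<bar>\<rho> - z (n + n0)\<bar>"
          using \<epsilon>(1) by (smt (verit) field_sum_of_halves)+
        then show False using nearP[OF _ that c(1)] n0[of "n + n0"] by simp
      qed
      ultimately show ?thesis
        using L[unfolded has_outward_sum_def, rule_format, of "\<epsilon> / 2" "\<lambda>n. - z (n + n0) + s * \<epsilon>"] \<epsilon> unfolding S_def by auto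
    qed
    have split: "S (- z n + 1 * \<epsilon>) - S (- z n + (-1) * \<epsilon>) = (\<Sum>\<rho>\<in>P n. pole_term F y \<rho>)" if n: "n \<ge> n0" for n
    proof -
      have "{\<rho>\<in>neg_poles F. - (- z n + 1 * \<epsilon>) < \<rho>} = {\<rho>\<in>neg_poles F. - (- z n + (-1) * \<epsilon>) < \<rho>} \<union> P n"
      proof (intro set_eqI iffI)
        fix \<rho> assume "\<rho> \<in> {\<rho>\<in>neg_poles F. - (- z n + 1 * \<epsilon>) < \<rho>}"
        then have \<rho>: "\<rho> \<in> neg_poles F" "z n - \<epsilon> < \<rho>" by simp_all
        show "\<rho> \<in> {\<rho>\<in>neg_poles F. - (- z n + (-1) * \<epsilon>) < \<rho>} \<union> P n"
        proof (cases "\<rho> \<le> z n + \<epsilon>")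
          case True
          then have "\<bar>\<rho> - z n\<bar> \<le> 3 * \<epsilon> / 2" using \<rho> \<epsilon>(1) by linarith
          then show ?thesis using nearP[OF n \<rho>(1)] \<rho> by (simp add: P_def)
        qed (use \<rho> in auto)
      next
        fix \<rho> assume "\<rho> \<in> {\<rho>\<in>neg_poles F. - (- z n + (-1) * \<epsilon>) < \<rho>} \<union> P n"
        then show "\<rho> \<in> {\<rho>\<in>neg_poles F. - (- z n + 1 * \<epsilon>) < \<rho>}"
          using n0[OF n] \<epsilon>(1) by (auto simp: P_def)
      qed
      moreover have "{\<rho>\<in>neg_poles F. - (- z n + (-1) * \<epsilon>) < \<rho>} \<inter> P n = {}"
        using n0[OF n] \<epsilon>(1) by (auto simp: P_def)
      moreover have "finite (P n)"
        by (rule finite_subset[OF _ finite_neg_poles[of "z n - r n"]]) (auto simp: P_def)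
      ultimately show ?thesis unfolding S_def using finite_neg_poles by (simp add: sum.union_disjoint del: minus_add_distrib)
    qed
    have "(\<lambda>n. S (- z (n + n0) + 1 * \<epsilon>) - S (- z (n + n0) + (-1) * \<epsilon>)) \<longlonglongrightarrow> L - L"
      by (intro tendsto_diff conv) auto
    then have "(\<lambda>n. \<Sum>\<rho>\<in>P (n + n0). pole_term F y \<rho>) \<longlonglongrightarrow> 0" using split by simp
    then have "(\<lambda>n. \<Sum>\<rho>\<in>P n. pole_term F y \<rho>) \<longlonglongrightarrow> 0" by (rule LIMSEQ_offset)
    then have "\<forall>\<^sub>F n in sequentially. norm (\<Sum>\<rho>\<in>P n. pole_term F y \<rho>) < norm q / 2"
      using order_tendstoD(2)[OF tendsto_norm_zero, of "\<lambda>n. \<Sum>\<rho>\<in>P n. pole_term F y \<rho>" sequentially "norm q / 2"] qz by simp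
    moreover have "\<forall>\<^sub>F n in sequentially. norm (U n) \<ge> 1"
      using Utop by (simp add: filterlim_at_top)
    ultimately have "\<forall>\<^sub>F n in sequentially. False"
      using big
    proof eventually_elim
      case (elim n)
      have "1 * (norm q / 2) \<le> norm (U n) * (norm q / 2)" using elim by (intro mult_right_mono) auto
      then show False using elim by simp
    qed
    then show False by simp
  qed
qed

end

section \<open>The theorem\<close>

lemma has_outward_sum_cong:
  assumes "\<And>\<rho>. \<rho> \<in> P \<Longrightarrow> t \<rho> = t' \<rho>"
  shows "has_outward_sum P t L \<longleftrightarrow> has_outward_sum P t' L"
proof -
  have "(\<Sum>\<rho>\<in>{\<rho>\<in>P. r < \<rho>}. t \<rho>) = (\<Sum>\<rho>\<in>{\<rho>\<in>P. r < \<rho>}. t' \<rho>)" for r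
    using assms by (intro sum.cong) auto
  then show ?thesis by (simp add: has_outward_sum_def)
qed

lemma has_outward_sum_cmult:
  assumes "has_outward_sum P t L"
  shows "has_outward_sum P (\<lambda>\<rho>. c * t \<rho>) (c * L)"
  using assms unfolding has_outward_sum_def sum_distrib_left[symmetric] by (auto intro!: tendsto_mult)

theorem theorem6p9:
  fixes M :: "'w measure" and X Y :: "'w \<Rightarrow> real"
    and J K :: nat and C D :: real and a b a' b' :: "nat \<Rightarrow> real"
    and F :: "complex \<Rightarrow> complex" and \<gamma> \<gamma>' \<kappa> :: real
    and fX fY :: "real \<Rightarrow> real"
  assumes "prob_space M"
    and "gamma_type_moments M X J K C D a b a' b'"
    and F_def: "F = gamma_type_fun J K C D a b a' b'"
    and Y_def: "Y = (\<lambda>\<omega>. ln (X \<omega>))"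
    and \<gamma>_def: "\<gamma> = gamma_coeff J K a a'"
    and \<gamma>'_def: "\<gamma>' = gamma'_coeff J K a a'"
    and \<kappa>_def: "\<kappa> = kappa_coeff J K D a a'"
    and "\<gamma> > 0"
    and fX: "continuous_density_on M X {0<..} fX"
    and fY: "continuous_density_on M Y UNIV fY"
  shows
    \<comment> \<open>(i)\<close>
    "(\<gamma>' > 0 \<longrightarrow>
       (\<forall>x>0. has_outward_sum (neg_poles F)
          (\<lambda>\<rho>. \<Sum>l<pole_order F (of_real \<rho>). sing_coeff F (l + 1) (of_real \<rho>) / fact l
             * of_real (x powr (\<bar>\<rho>\<bar> - 1)) * of_real (ln (1 / x) ^ l))
          (of_real (fX x)))
       \<and> (\<forall>y. has_outward_sum (neg_poles F)
          (\<lambda>\<rho>. \<Sum>l<pole_order F (of_real \<rho>). sing_coeff F (l + 1) (of_real \<rho>) / fact l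
             * of_real (exp (\<bar>\<rho>\<bar> * y)) * of_real ((- y) ^ l))
          (of_real (fY y)))
       \<and> ((\<forall>s. is_pole F s \<longrightarrow> pole_order F s = 1) \<longrightarrow>
            (\<forall>x>0. has_outward_sum (neg_poles F)
               (\<lambda>\<rho>. residue F (of_real \<rho>) * of_real (x powr (\<bar>\<rho>\<bar> - 1))) (of_real (fX x)))
          \<and> (\<forall>y. has_outward_sum (neg_poles F)
               (\<lambda>\<rho>. residue F (of_real \<rho>) * of_real (exp (\<bar>\<rho>\<bar> * y))) (of_real (fY y)))))
    \<and>
    \<comment> \<open>(ii)\<close>
    (\<gamma>' < 0 \<and> infinite (neg_poles F) \<and> (\<forall>\<rho>\<in>neg_poles F. pole_order F (of_real \<rho>) = 1) \<longrightarrow>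
       (\<forall>x>0. outward_divergent (neg_poles F)
          (\<lambda>\<rho>. residue F (of_real \<rho>) * of_real (x powr (\<bar>\<rho>\<bar> - 1))))
       \<and> (\<forall>y::real. outward_divergent (neg_poles F)
          (\<lambda>\<rho>. residue F (of_real \<rho>) * of_real (exp (\<bar>\<rho>\<bar> * y)))))
    \<and>
    \<comment> \<open>(iii)\<close>
    (\<gamma>' = 0 \<longrightarrow>
       (\<forall>x. 0 < x \<and> x < exp \<kappa> \<longrightarrow> has_outward_sum (neg_poles F)
          (\<lambda>\<rho>. \<Sum>l<pole_order F (of_real \<rho>). sing_coeff F (l + 1) (of_real \<rho>) / fact l
             * of_real (x powr (\<bar>\<rho>\<bar> - 1)) * of_real (ln (1 / x) ^ l))
          (of_real (fX x)))
       \<and> (\<forall>y<\<kappa>. has_outward_sum (neg_poles F)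
          (\<lambda>\<rho>. \<Sum>l<pole_order F (of_real \<rho>). sing_coeff F (l + 1) (of_real \<rho>) / fact l
             * of_real (exp (\<bar>\<rho>\<bar> * y)) * of_real ((- y) ^ l))
          (of_real (fY y)))
       \<and> ((\<forall>s. is_pole F s \<longrightarrow> pole_order F s = 1) \<longrightarrow>
            (\<forall>x. 0 < x \<and> x < exp \<kappa> \<longrightarrow> has_outward_sum (neg_poles F)
               (\<lambda>\<rho>. residue F (of_real \<rho>) * of_real (x powr (\<bar>\<rho>\<bar> - 1))) (of_real (fX x)))
          \<and> (\<forall>y<\<kappa>. has_outward_sum (neg_poles F)
               (\<lambda>\<rho>. residue F (of_real \<rho>) * of_real (exp (\<bar>\<rho>\<bar> * y))) (of_real (fY y))))
       \<and> (infinite (neg_poles F) \<and> (\<forall>\<rho>\<in>neg_poles F. pole_order F (of_real \<rho>) = 1) \<longrightarrow>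
            (\<forall>x>exp \<kappa>. outward_divergent (neg_poles F)
               (\<lambda>\<rho>. residue F (of_real \<rho>) * of_real (x powr (\<bar>\<rho>\<bar> - 1))))
          \<and> (\<forall>y>\<kappa>. outward_divergent (neg_poles F)
               (\<lambda>\<rho>. residue F (of_real \<rho>) * of_real (exp (\<bar>\<rho>\<bar> * y))))))"
proof -
  interpret prob_space M by fact
  obtain u v where X: "X \<in> borel_measurable M" "AE \<omega> in M. X \<omega> > 0" "D > 0" "\<forall>j\<in>{1..J}. a j \<noteq> 0" "\<forall>k\<in>{1..K}. a' k \<noteq> 0"
    and uv: "u < v" "\<And>s. u < s \<Longrightarrow> s < v \<Longrightarrow> integrable M (\<lambda>\<omega>. X \<omega> powr s) \<and> of_real (\<integral>\<omega>. X \<omega> powr s \<partial>M) = F (of_real s)"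
    using assms(2) unfolding gamma_type_moments_def F_def by blast
  interpret G: gamma_type_params J K C D a b a' b' using X by unfold_locales auto
  have F: "F = G.F" by (simp add: F_def G.F_def)
  have params: "\<gamma> = G.\<gamma>" "\<gamma>' = G.\<gamma>'" "\<kappa> = G.\<kappa>"
    by (simp_all add: \<gamma>_def \<gamma>'_def \<kappa>_def G.\<gamma>_def G.\<gamma>'_def G.\<kappa>_def)
  note fY' = fY[unfolded Y_def]
  have "\<exists>c. complex_of_real c \<notin> G.S0 \<and>
    (\<forall>\<rho>. is_pole G.F (of_real \<rho>) \<longrightarrow> min 0 c \<le> \<rho> \<longrightarrow> \<rho> \<le> max 0 c \<longrightarrow> False) \<and>
    (\<forall>y. (\<lambda>n. integral {-real n..real n} (\<lambda>t. G.F (Complex c t) * exp (- of_real y * Complex c t))) \<longlonglongrightarrow> 2 * pi * fY y)"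
    by (rule G.moment_inversion[OF prob_space_axioms X(1,2) uv(1) uv(2)[unfolded F] fY' \<open>\<gamma> > 0\<close>[unfolded params]]) blast+
  then obtain c where c: "complex_of_real c \<notin> G.S0"
    "\<And>\<rho>. is_pole G.F (of_real \<rho>) \<Longrightarrow> min 0 c \<le> \<rho> \<Longrightarrow> \<rho> \<le> max 0 c \<Longrightarrow> False"
    "\<And>y. (\<lambda>n. integral {-real n..real n} (\<lambda>t. G.F (Complex c t) * exp (- of_real y * Complex c t))) \<longlonglongrightarrow> 2 * pi * fY y"
    by blast
  \<comment> \<open>Density and pole terms of X at x are those of Y at ln x divided by x. So all
    claims are proved for Y and transferred by \<open>has_outward_sum_cmult\<close>, with factor 1/x
    for convergence and x for divergence.\<close>
  have fXY: "fX x = fY (ln x) / x" if "x > 0" for x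
    using log_density[OF prob_space_axioms X(2) fX fY', of "ln x"] that by simp
  define tX where "tX x = (\<lambda>\<rho>. \<Sum>l<pole_order F (of_real \<rho>). sing_coeff F (l + 1) (of_real \<rho>) / fact l
    * of_real (x powr (\<bar>\<rho>\<bar> - 1)) * of_real (ln (1 / x) ^ l))" for x
  define tY where "tY y = (\<lambda>\<rho>. \<Sum>l<pole_order F (of_real \<rho>). sing_coeff F (l + 1) (of_real \<rho>) / fact l
    * of_real (exp (\<bar>\<rho>\<bar> * y)) * of_real ((- y) ^ l))" for y
  define rX where "rX x = (\<lambda>\<rho>. residue F (of_real \<rho>) * of_real (x powr (\<bar>\<rho>\<bar> - 1)))" for x
  define rY where "rY y = (\<lambda>\<rho>. residue F (of_real \<rho>) * of_real (exp (\<bar>\<rho>\<bar> * y)))" for y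
  have tY: "tY y = pole_term F y" for y by (simp add: tY_def pole_term_def fun_eq_iff)
  have powr: "x powr (\<bar>\<rho>\<bar> - 1) = exp (\<bar>\<rho>\<bar> * ln x) / x" if "x > 0" for x \<rho> :: real
    using that by (simp add: powr_def left_diff_distrib exp_diff)
  have tXY: "tX x = (\<lambda>\<rho>. of_real (1 / x) * tY (ln x) \<rho>)" if "x > 0" for x
    using that by (simp add: tX_def tY_def powr ln_div fun_eq_iff sum_distrib_left mult_ac)
  have rXY: "rX x = (\<lambda>\<rho>. of_real (1 / x) * rY (ln x) \<rho>)" if "x > 0" for x
    using that by (simp add: rX_def rY_def powr fun_eq_iff)
  have simple: "tY y \<rho> = rY y \<rho>" if "pole_order F (of_real \<rho>) = 1" for y \<rho>
    using G.pole_term_simple[where \<rho> = \<rho> and y = y] that by (simp add: tY rY_def F)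
  have convY: "has_outward_sum (neg_poles F) (tY y) (of_real (fY y))" if "\<gamma>' > 0 \<or> (\<gamma>' = 0 \<and> y < \<kappa>)" for y
    using G.pole_sum_converges[OF \<open>\<gamma> > 0\<close>[unfolded params] c(1,2), where y = y and fy = "of_real (fY y)"] c(3)[of y] that
    by (simp add: tY F params)
  have convX: "has_outward_sum (neg_poles F) (tX x) (of_real (fX x))" if "\<gamma>' > 0 \<or> (\<gamma>' = 0 \<and> x < exp \<kappa>)" "x > 0" for x
  proof -
    have "ln x < \<kappa>" if "x < exp \<kappa>" using that \<open>x > 0\<close> by (metis exp_less_cancel_iff exp_ln)
    then have "has_outward_sum (neg_poles F) (tY (ln x)) (of_real (fY (ln x)))" using that by (intro convY) auto
    from has_outward_sum_cmult[OF this, of "of_real (1 / x)"] show ?thesis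
      using that by (simp add: tXY fXY)
  qed
  have convY1: "has_outward_sum (neg_poles F) (rY y) (of_real (fY y))"
    if "\<gamma>' > 0 \<or> (\<gamma>' = 0 \<and> y < \<kappa>)" "\<forall>s. is_pole F s \<longrightarrow> pole_order F s = 1" for y
    using has_outward_sum_cong[where P = "neg_poles F" and t = "tY y" and t' = "rY y"] simple convY[OF that(1)] that(2)
    by (simp add: neg_poles_def)
  have convX1: "has_outward_sum (neg_poles F) (rX x) (of_real (fX x))"
    if "\<gamma>' > 0 \<or> (\<gamma>' = 0 \<and> x < exp \<kappa>)" "\<forall>s. is_pole F s \<longrightarrow> pole_order F s = 1" "x > 0" for x
  proof -
    have "tX x \<rho> = rX x \<rho>" if "\<rho> \<in> neg_poles F" for \<rho>
      using simple[of \<rho> "ln x"] that \<open>\<forall>s. is_pole F s \<longrightarrow> pole_order F s = 1\<close> \<open>x > 0\<close> by (simp add: tXY rXY neg_poles_def)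
    then show ?thesis using has_outward_sum_cong convX[OF that(1,3)] by blast
  qed
  have divY: "outward_divergent (neg_poles F) (rY y)"
    if "\<gamma>' < 0 \<or> (\<gamma>' = 0 \<and> y > \<kappa>)" "infinite (neg_poles F)" "\<forall>\<rho>\<in>neg_poles F. pole_order F (of_real \<rho>) = 1" for y
  proof -
    have "outward_divergent (neg_poles F) (tY y)"
      unfolding tY F by (rule G.pole_sum_diverges) (use that in \<open>simp_all add: F params\<close>)
    then show ?thesis
      using has_outward_sum_cong[where P = "neg_poles F" and t = "tY y" and t' = "rY y"] simple that(3) unfolding outward_divergent_def by blast
  qed
  have divX: "outward_divergent (neg_poles F) (rX x)"
    if "\<gamma>' < 0 \<or> (\<gamma>' = 0 \<and> x > exp \<kappa>)" "infinite (neg_poles F)" "\<forall>\<rho>\<in>neg_poles F. pole_order F (of_real \<rho>) = 1" "x > 0" for x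
    unfolding outward_divergent_def
  proof (rule notI, elim exE)
    fix L assume "has_outward_sum (neg_poles F) (rX x) L"
    from has_outward_sum_cmult[OF this, of "of_real x"] have "has_outward_sum (neg_poles F) (rY (ln x)) (of_real x * L)"
      using that by (simp add: rXY)
    moreover have "ln x > \<kappa>" if "x > exp \<kappa>" using that \<open>x > 0\<close> by (metis exp_less_cancel_iff exp_ln)
    ultimately show False using divY[of "ln x"] that unfolding outward_divergent_def by blast
  qed
  have pos: "x > 0" if "x > exp \<kappa>" for x :: real using that by (meson exp_gt_zero less_trans)
  show ?thesis
    unfolding tX_def[symmetric] tY_def[symmetric] rX_def[symmetric] rY_def[symmetric]
    using convX convY convX1 convY1 divX divY pos by simp
qed

end
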